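(* Let $(R,\mathfrak{m})$ be a local Cohen-Macaulay ring of dimension $d>0$ with infinite residue field, and let $I$ be an $\mathfrak{m}$-primary ideal of $R$. Then the multiplicity $f_0$ of the special fiber ring $\mathcal{F}$ of $I$ satisfies $$f_0 \leq e_1 - e_0 + \lambda(R/\widetilde{I}) + \mu(\widetilde{I}) - d + 1,$$ where $\widetilde{I}$ is the Ratliff-Rush closure of $I$.
   Context: Local rings are Noetherian. $\lambda(\cdot)$ denotes length and $\mu(\cdot)$ minimal number of generators. The special fiber ring of $I$ is $\mathcal{F}=\mathcal{F}(I)=\bigoplus_{m\ge 0} I^m/\mathfrak{m}I^m$. Since $I$ is $\mathfrak m$-primary, $\dim\mathcal{F}=d$; for $m\gg 0$, $\mu(I^m)$ is a polynomial in $m$ of degree $d-1$, and the multiplicity $f_0=f_0(I)$ of $\mathcal{F}$ is its normalized leading coefficient, i.e. $\mu(I^m)=f_0\binom{m+d-1}{d-1}+(\text{terms of lower degree in } m)$ for $m\gg0$. The integers $e_0=e_0(I)$, $e_1=e_1(I)$ are the first two Hilbert coefficients of $I$: for $m\gg 0$, $\lambda(R/I^m)=e_0\binom{m+d-1}{d}-e_1\binom{m+d-2}{d-1}+\cdots+(-1)^d e_d$; the right-hand side is the Hilbert polynomial of $I$. The Ratliff-Rush closure $\widetilde{I}$ of $I$ is the largest ideal containing $I$ with the same Hilbert polynomial as $I$. *)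

theory Defs
  imports
    "HOL-Algebra.Ring_Divisibility"
    "HOL-Algebra.Ideal_Product"
    "HOL-Algebra.QuotRing"
    "HOL-Algebra.Module"
    "HOL-Computational_Algebra.Polynomial"
    "HOL-Library.Extended_Nat"
begin

section \<open>Noetherian local rings, dimension, depth\<close>

locale noetherian_local_ring = cring R + noetherian_ring R for R (structure) and \<mm> +
  assumes maximal: "maximalideal \<mm> R"
    and unique_maximal: "maximalideal M R \<Longrightarrow> M = \<mm>"

definition krull_dim :: "('a, 'b) ring_scheme \<Rightarrow> enat" where
  "krull_dim R =
     Sup {enat n | n. \<exists>P. (\<forall>i\<le>n. primeideal (P i) R) \<and> (\<forall>i<n. P i \<subset> P (Suc i))}"

definition regular_sequence :: "('a, 'b) ring_scheme \<Rightarrow> 'a list \<Rightarrow> bool" where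
  "regular_sequence R xs \<longleftrightarrow>
     set xs \<subseteq> carrier R \<and>
     (\<forall>i<length xs. \<forall>r\<in>carrier R.
        r \<otimes>\<^bsub>R\<^esub> (xs ! i) \<in> Idl\<^bsub>R\<^esub> (set (take i xs)) \<longrightarrow> r \<in> Idl\<^bsub>R\<^esub> (set (take i xs))) \<and>
     Idl\<^bsub>R\<^esub> (set xs) \<noteq> carrier R"

definition depth :: "('a, 'b) ring_scheme \<Rightarrow> 'a set \<Rightarrow> enat" where
  "depth R \<mm> = Sup {enat (length xs) | xs. regular_sequence R xs \<and> set xs \<subseteq> \<mm>}"

locale cohen_macaulay_local_ring = noetherian_local_ring +
  assumes depth_eq_dim: "depth R \<mm> = krull_dim R"


section \<open>Primary ideals\<close>

definition radical_ideal :: "('a, 'b) ring_scheme \<Rightarrow> 'a set \<Rightarrow> 'a set" where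
  "radical_ideal R I = {a \<in> carrier R. \<exists>n::nat. a [^]\<^bsub>R\<^esub> n \<in> I}"

locale primary_to = ideal I R for P and I and R (structure) +
  assumes proper: "I \<noteq> carrier R"
    and primary: "\<lbrakk>a \<in> carrier R; b \<in> carrier R; a \<otimes> b \<in> I\<rbrakk>
                    \<Longrightarrow> a \<in> I \<or> (\<exists>n::nat. b [^] n \<in> I)"
    and radical: "radical_ideal R I = P"


section \<open>Length and minimal number of generators\<close>

definition module_length :: "('a, 'b) ring_scheme \<Rightarrow> ('a, 'c, 'd) module_scheme \<Rightarrow> enat" where
  "module_length R M =
     Sup {enat n | n. \<exists>N. (\<forall>i\<le>n. submodule (N i) R M) \<and> (\<forall>i<n. N i \<subset> N (Suc i))}"

definition quot_module :: "('a, 'b) ring_scheme \<Rightarrow> 'a set \<Rightarrow> ('a, 'a set) module" where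
  "quot_module R J =
     \<lparr>carrier = carrier (R Quot J), mult = mult (R Quot J), one = one (R Quot J),
      zero = zero (R Quot J), add = add (R Quot J),
      module.smult = (\<lambda>a X. (J +>\<^bsub>R\<^esub> a) \<otimes>\<^bsub>R Quot J\<^esub> X)\<rparr>"

lemma (in cring) quot_module_is_module:
  assumes "ideal J R"
  shows "module R (quot_module R J)"
proof -
  interpret J: ideal J R by fact
  interpret Q: cring "R Quot J" by (rule J.quotient_is_cring[OF is_cring])
  interpret h: ring_hom_ring R "R Quot J" "(+>) J" by (rule J.rcos_ring_hom_ring)
  have "abelian_group (quot_module R J)"
    by (intro abelian_groupI)
       (simp_all add: quot_module_def Q.add.m_ac Q.add.l_inv_ex[simplified])
  then show ?thesis
    by (intro moduleI) (auto simp: quot_module_def Q.l_distr Q.r_distr Q.m_assoc is_cring)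
qed

text \<open>
  The length of \<open>R/J\<close> as a natural number; only meaningful if that length is finite, which is
  the case for all ideals \<open>J\<close> containing a power of the maximal ideal.
\<close>
definition colength :: "('a, 'b) ring_scheme \<Rightarrow> 'a set \<Rightarrow> nat" where
  "colength R J = the_enat (module_length R (quot_module R J))"

definition min_gens :: "('a, 'b) ring_scheme \<Rightarrow> 'a set \<Rightarrow> nat" where
  "min_gens R I = (LEAST n. \<exists>A\<subseteq>carrier R. finite A \<and> card A = n \<and> I = Idl\<^bsub>R\<^esub> A)"


section \<open>Hilbert polynomials\<close>

text \<open>\<open>ideals_set R\<close> is the semiring of ideals, so that this is the usual power \<open>I\<^sup>n\<close>.\<close>
abbreviation ideal_power :: "('a, 'b) ring_scheme \<Rightarrow> 'a set \<Rightarrow> nat \<Rightarrow> 'a set" where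
  "ideal_power R I n \<equiv> I [^]\<^bsub>ideals_set R\<^esub> n"

definition eventual_poly :: "(nat \<Rightarrow> nat) \<Rightarrow> rat poly" where
  "eventual_poly h =
     (THE p. eventually (\<lambda>n. of_nat (h n) = poly p (of_nat n)) sequentially)"

definition hilbert_poly :: "('a, 'b) ring_scheme \<Rightarrow> 'a set \<Rightarrow> rat poly" where
  "hilbert_poly R I = eventual_poly (\<lambda>n. colength R (ideal_power R I n))"

text \<open>
  The coefficients \<open>e\<^sub>0, \<dots>, e\<^sub>d\<close> of the Hilbert polynomial in the binomial basis,
  where \<open>d\<close> is the dimension of \<open>R\<close>. The requirement \<open>e i = 0\<close> for \<open>i > d\<close> only makes the
  sequence unique as a function on all natural numbers.
\<close>
definition hilbert_coeff :: "('a, 'b) ring_scheme \<Rightarrow> nat \<Rightarrow> 'a set \<Rightarrow> nat \<Rightarrow> int" where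
  "hilbert_coeff R d I =
     (THE e. (\<forall>i>d. e i = 0) \<and>
        (\<forall>x. poly (hilbert_poly R I) x =
           (\<Sum>i\<le>d. (-1) ^ i * of_int (e i) * ((x + of_nat d - of_nat i - 1) gchoose (d - i)))))"

text \<open>
  The multiplicity \<open>f\<^sub>0\<close> of the special fiber ring
  \<open>\<F>(I) = \<Oplus>\<^sub>n I\<^sup>n / \<mm>I\<^sup>n\<close>, whose Hilbert function is
  \<open>n \<mapsto> \<mu>(I\<^sup>n)\<close>: since \<open>(n + d - 1) choose (d - 1)\<close> has leading term
  \<open>n\<^sup>d\<^sup>-\<^sup>1 / (d - 1)!\<close>, the number \<open>f\<^sub>0\<close> with
  \<open>\<mu>(I\<^sup>n) = f\<^sub>0 * ((n + d - 1) choose (d - 1)) + (lower terms)\<close> for large \<open>n\<close> is \<open>(d - 1)!\<close> times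
  the coefficient of degree \<open>d - 1\<close>.
\<close>
definition fiber_multiplicity :: "('a, 'b) ring_scheme \<Rightarrow> nat \<Rightarrow> 'a set \<Rightarrow> rat" where
  "fiber_multiplicity R d I =
     fact (d - 1) *
     Polynomial.coeff (eventual_poly (\<lambda>n. min_gens R (ideal_power R I n))) (d - 1)"

text \<open>\<open>GREATEST\<close> refers to the inclusion order on sets.\<close>
definition ratliff_rush :: "('a, 'b) ring_scheme \<Rightarrow> 'a set \<Rightarrow> 'a set" where
  "ratliff_rush R I =
     (GREATEST J. ideal J R \<and> I \<subseteq> J \<and> hilbert_poly R J = hilbert_poly R I)"

end

theory Submission
  imports Defs "HOL-Algebra.Polynomial_Divisibility"
begin

text \<open>
  Let \<open>K\<close> be an \<open>\<mm>\<close>-primary ideal and \<open>J\<close> a reduction of \<open>K\<close> generated by \<open>d\<close> elements. These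
  elements can be chosen to form a regular sequence, they are part of a minimal generating set of \<open>K\<close>,
  and \<open>\<lambda>(R/J\<^sup>n)\<close> is \<open>\<lambda>(R/J)\<close> times the number of monomials of degree less than \<open>n\<close> in \<open>d\<close>
  variables, whence \<open>\<lambda>(R/J) \<le> e\<^sub>0\<close>. The inclusion \<open>J\<^sup>n K \<subseteq> K\<^sup>n\<^sup>+\<^sup>1\<close> gives
  \<open>\<mu>(K\<^sup>n\<^sup>+\<^sup>1) \<le> \<lambda>(R/J\<^sup>n K) - \<lambda>(R/K\<^sup>n\<^sup>+\<^sup>1) + \<mu>(J\<^sup>n K)\<close>, and counting monomials bounds
  \<open>\<lambda>(R/J\<^sup>n K)\<close> and \<open>\<mu>(J\<^sup>n K)\<close>. Comparing the coefficients of \<open>n\<^sup>d\<^sup>-\<^sup>1\<close> yields the bound for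
  \<open>f\<^sub>0(K)\<close>. An ideal containing \<open>I\<close> has the same Hilbert polynomial as \<open>I\<close> iff its large powers
  are those of \<open>I\<close>, so that the Ratliff-Rush closure \<open>K\<close> of \<open>I\<close> has \<open>f\<^sub>0(K) = f\<^sub>0(I)\<close>.

  All Hilbert functions are eventually polynomial by a Groebner basis argument: the length of
  \<open>I\<^sup>n/q I\<^sup>n\<close> is a sum, over the monomials of degree \<open>n\<close> in the generators of \<open>I\<close>, of colengths
  that decrease along divisibility of monomials.
\<close>

text \<open>The bound is read off at \<open>n + 1\<close>. \<open>J^n K\<close> is generated by the
  monomials of degree \<open>n + 1\<close> in the generators of \<open>J\<close> and the products of
  those of degree \<open>n\<close> with \<open>\<mu>(K) - d\<close> further generators of
  \<open>K\<close>; these give the summands \<open>1\<close> and \<open>\<mu>(K) - d\<close>. The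
  quotient \<open>J^n / J^n K\<close> gives \<open>\<lambda>(R/K)\<close>. The length of
  \<open>R/J^n\<close> is \<open>\<lambda>(R/J)\<close> times the binomial coefficient of
  \<open>n + d - 1\<close> over \<open>d\<close>, while the Hilbert polynomial at
  \<open>n + 1\<close> starts with \<open>e_0\<close> times that of \<open>n + d\<close> over
  \<open>d\<close>; their difference leaves \<open>-e_0\<close>, and \<open>e_1\<close> comes from
  the next term. The inequality \<open>\<lambda>(R/J) \<le> e_0\<close> suffices because it is
  multiplied by a number of monomials. The Cohen-Macaulay hypothesis enters as a single regular
  sequence of length \<open>d\<close>. Its members are exchanged for elements of \<open>J\<close>,
  each exchange being a reduction in a ring of dimension one; this is why reductions are treated
  modulo an ideal. All lengths are those of \<open>A/C\<close> for ideals
  \<open>C \<subseteq> A\<close>, measured by chains of ideals, with \<open>R/(B : r)\<close> in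
  place of \<open>(B + (r))/B\<close>.\<close>

no_notation Sum_Type.Plus (infixr "<+>" 65) and var ("X\<index>")

section \<open>Ideals\<close>

context cring
begin

definition ipow :: "'a set \<Rightarrow> nat \<Rightarrow> 'a set" where
  "ipow A n = ideal_power R A n"

lemma set_add_mem: "x \<in> A <+> B \<longleftrightarrow> (\<exists>a\<in>A. \<exists>b\<in>B. x = a \<oplus> b)"
  by (auto simp: set_add_def')

lemma set_addE:
  assumes "x \<in> A <+> B" obtains a b where "a \<in> A" "b \<in> B" "x = a \<oplus> b"
  using assms set_add_mem[of x A B] by metis

lemma set_addI: "a \<in> A \<Longrightarrow> b \<in> B \<Longrightarrow> a \<oplus> b \<in> A <+> B"
  using set_add_mem[of "a \<oplus> b" A B] by blast

lemma ideal_add_closed: "ideal A R \<Longrightarrow> a \<in> A \<Longrightarrow> b \<in> A \<Longrightarrow> a \<oplus> b \<in> A"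
  by (meson additive_subgroup.a_closed ideal.axioms(1))

lemma ideal_zero: "ideal A R \<Longrightarrow> \<zero> \<in> A"
  by (meson additive_subgroup.zero_closed ideal.axioms(1))

lemma ideal_uminus: "ideal A R \<Longrightarrow> a \<in> A \<Longrightarrow> \<ominus> a \<in> A"
  by (meson additive_subgroup.a_inv_closed ideal.axioms(1))

lemma ideal_minus: "ideal A R \<Longrightarrow> a \<in> A \<Longrightarrow> b \<in> A \<Longrightarrow> a \<ominus> b \<in> A"
  by (simp add: a_minus_def ideal_add_closed ideal_uminus)

lemma ideal_subset: "ideal A R \<Longrightarrow> A \<subseteq> carrier R"
  by (meson ideal.Icarr subsetI)

lemma ideal_eq_carrier: "ideal A R \<Longrightarrow> \<one> \<in> A \<Longrightarrow> A = carrier R"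
  by (rule ideal.one_imp_carrier)

lemma subset_addI1: "ideal A R \<Longrightarrow> ideal B R \<Longrightarrow> A \<subseteq> A <+> B"
  unfolding subset_iff set_add_mem by (metis ideal.Icarr ideal_zero r_zero)

lemma subset_addI2: "ideal A R \<Longrightarrow> ideal B R \<Longrightarrow> B \<subseteq> A <+> B"
  unfolding subset_iff set_add_mem by (metis ideal.Icarr ideal_zero l_zero)

lemma add_subset: "ideal C R \<Longrightarrow> A \<subseteq> C \<Longrightarrow> B \<subseteq> C \<Longrightarrow> A <+> B \<subseteq> C"
  unfolding subset_iff set_add_mem by (metis ideal_add_closed)

lemma set_add_mono: "A \<subseteq> A' \<Longrightarrow> B \<subseteq> B' \<Longrightarrow> A <+> B \<subseteq> A' <+> B'"
  unfolding subset_iff set_add_mem by blast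

lemma ideal_add_comm: "ideal A R \<Longrightarrow> ideal B R \<Longrightarrow> A <+> B = B <+> A"
  by (rule set_add_comm) (auto dest: ideal_subset)

lemma ideal_add_assoc:
  "ideal A R \<Longrightarrow> ideal B R \<Longrightarrow> ideal C R \<Longrightarrow> (A <+> B) <+> C = A <+> (B <+> C)"
  by (intro subset_antisym add_subset add_ideals)
     (meson add_ideals subset_addI1 subset_addI2 subset_trans)+

lemma ideal_add_absorb: "ideal A R \<Longrightarrow> ideal B R \<Longrightarrow> B \<subseteq> A \<Longrightarrow> A <+> B = A"
  by (intro subset_antisym add_subset subset_addI1) auto

lemma ideal_prod_mono: "A \<subseteq> A' \<Longrightarrow> B \<subseteq> B' \<Longrightarrow> A \<cdot> B \<subseteq> A' \<cdot> B'"
proof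
  fix x assume *: "A \<subseteq> A'" "B \<subseteq> B'" and "x \<in> A \<cdot> B"
  from this(3) show "x \<in> A' \<cdot> B'"
    by (induct x rule: ideal_prod.induct) (use * in \<open>auto intro: ideal_prod.intros\<close>)
qed

lemma ideal_prod_subset:
  "ideal C R \<Longrightarrow> (\<And>a b. a \<in> A \<Longrightarrow> b \<in> B \<Longrightarrow> a \<otimes> b \<in> C) \<Longrightarrow> A \<cdot> B \<subseteq> C"
proof
  fix x assume *: "ideal C R" "\<And>a b. a \<in> A \<Longrightarrow> b \<in> B \<Longrightarrow> a \<otimes> b \<in> C" and "x \<in> A \<cdot> B"
  from this(3) show "x \<in> C"
    by (induct x rule: ideal_prod.induct) (use * in \<open>auto intro: ideal_add_closed\<close>)
qed

lemma ideal_prod_subset1: "ideal A R \<Longrightarrow> ideal B R \<Longrightarrow> A \<cdot> B \<subseteq> A"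
  and ideal_prod_subset2: "ideal A R \<Longrightarrow> ideal B R \<Longrightarrow> A \<cdot> B \<subseteq> B"
  using ideal_prod_inter by blast+

lemma one_prod: "ideal A R \<Longrightarrow> carrier R \<cdot> A = A"
  using ideal_prod_one ideal_prod_commute oneideal by metis

lemma ideal_ipow [simp]: "ideal A R \<Longrightarrow> ideal (ipow A n) R"
  and ipow_0 [simp]: "ipow A 0 = carrier R"
  and ipow_Suc: "ideal A R \<Longrightarrow> ipow A (Suc n) = A \<cdot> ipow A n"
proof -
  interpret M: comm_monoid "ideals_set R" by (rule ideals_set_is_comm_monoid)
  have *: "carrier (ideals_set R) = {I. ideal I R}" "mult (ideals_set R) = ideal_prod R"
    "one (ideals_set R) = carrier R"
    by (auto simp: ideals_set_def)
  show "ideal (ipow A n) R" if "ideal A R"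
    using M.nat_pow_closed[of A n] that by (simp add: * ipow_def)
  show "ipow A 0 = carrier R" by (simp add: * ipow_def)
  show "ipow A (Suc n) = A \<cdot> ipow A n" if "ideal A R"
    using M.nat_pow_Suc2[of A n] that by (simp add: * ipow_def)
qed

lemmas ideal_closed = add_ideals ideal_prod_is_ideal ideal_ipow oneideal zeroideal genideal_ideal
  cgenideal_ideal

lemma ipow_1 [simp]: "ideal A R \<Longrightarrow> ipow A (Suc 0) = A"
  by (simp add: ipow_Suc ideal_prod_one)

lemma ipow_add: "ideal A R \<Longrightarrow> ipow A (m + n) = ipow A m \<cdot> ipow A n"
  by (induction m) (simp_all add: one_prod ipow_Suc ideal_prod_assoc)

lemma ipow_mult: "ideal A R \<Longrightarrow> ipow A (m * n) = ipow (ipow A m) n"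
  by (induction n) (simp_all add: ipow_Suc ipow_add)

lemma ipow_mono: "ideal A R \<Longrightarrow> ideal B R \<Longrightarrow> A \<subseteq> B \<Longrightarrow> ipow A n \<subseteq> ipow B n"
  by (induction n) (simp_all add: ipow_Suc ideal_prod_mono)

lemma ipow_antimono: "ideal A R \<Longrightarrow> m \<le> n \<Longrightarrow> ipow A n \<subseteq> ipow A m"
  using ipow_add[of A m "n - m"] ideal_prod_subset1[of "ipow A m" "ipow A (n - m)"] by simp

section \<open>Generators of ideals, binomial expansion of powers, colon ideals\<close>

lemma Idl_subset_iff:
  "A \<subseteq> carrier R \<Longrightarrow> ideal B R \<Longrightarrow> Idl A \<subseteq> B \<longleftrightarrow> A \<subseteq> B"
  using Idl_subset_ideal by blast

lemma Idl_empty: "Idl {} = {\<zero>}"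
  using Idl_subset_iff[of "{}" "{\<zero>}"] genideal_ideal[of "{}"] zeroideal ideal_zero by blast

lemma Idl_mono: "A \<subseteq> B \<Longrightarrow> B \<subseteq> carrier R \<Longrightarrow> Idl A \<subseteq> Idl B"
  by (meson genideal_ideal genideal_self order_trans Idl_subset_iff)

lemma Idl_Un: "A \<subseteq> carrier R \<Longrightarrow> B \<subseteq> carrier R \<Longrightarrow> Idl (A \<union> B) = Idl A <+> Idl B"
proof (intro subset_antisym add_subset)
  assume *: "A \<subseteq> carrier R" "B \<subseteq> carrier R"
  have "A \<subseteq> Idl A <+> Idl B" "B \<subseteq> Idl A <+> Idl B"
    using * subset_addI1[of "Idl A" "Idl B"] subset_addI2[of "Idl A" "Idl B"]
      genideal_self[of A] genideal_self[of B] genideal_ideal by (meson order_trans)+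
  then show "Idl (A \<union> B) \<subseteq> Idl A <+> Idl B"
    using * by (subst Idl_subset_iff) (auto intro!: ideal_closed)
qed (simp_all add: Idl_mono genideal_ideal)

lemma Idl_insert: "a \<in> carrier R \<Longrightarrow> B \<subseteq> carrier R \<Longrightarrow> Idl (insert a B) = PIdl a <+> Idl B"
  using Idl_Un[of "{a}" B] by (simp add: cgenideal_eq_genideal)

lemma PIdl_mem: "x \<in> PIdl r \<longleftrightarrow> (\<exists>s\<in>carrier R. x = s \<otimes> r)"
  by (auto simp: cgenideal_def)

lemma PIdlE:
  assumes "x \<in> PIdl r" obtains s where "s \<in> carrier R" "x = s \<otimes> r"
  using assms by (auto simp: PIdl_mem)

lemma PIdl_subset_iff: "r \<in> carrier R \<Longrightarrow> ideal B R \<Longrightarrow> PIdl r \<subseteq> B \<longleftrightarrow> r \<in> B"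
  by (meson cgenideal_minimal cgenideal_self subsetD)

text \<open>It suffices to test generators: the multipliers sending all of \<open>B\<close> into
  \<open>C\<close> form an ideal, which contains \<open>Idl A\<close>; the argument is then repeated
  in the other factor.\<close>

lemma prod_Idl_subset:
  assumes "A \<subseteq> carrier R" "B \<subseteq> carrier R" "ideal C R"
    and "\<And>a b. a \<in> A \<Longrightarrow> b \<in> B \<Longrightarrow> a \<otimes> b \<in> C"
  shows "(Idl A) \<cdot> (Idl B) \<subseteq> C"
proof -
  have 1: "ideal {x \<in> carrier R. \<forall>b\<in>B. x \<otimes> b \<in> C} R"
  proof (rule idealI[OF ring_axioms])
    show "subgroup {x \<in> carrier R. \<forall>b\<in>B. x \<otimes> b \<in> C} (add_monoid R)"
      using assms by unfold_locales
        (auto simp: l_distr subset_iff ideal_add_closed ideal_zero l_minus ideal_uminus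
          simp flip: a_inv_def)
  next
    fix a x assume *: "a \<in> {x \<in> carrier R. \<forall>b\<in>B. x \<otimes> b \<in> C}" "x \<in> carrier R"
    have "x \<otimes> (a \<otimes> b) \<in> C" if "b \<in> B" for b
      using * that assms(3) by (simp add: ideal.I_l_closed)
    then show "x \<otimes> a \<in> {x \<in> carrier R. \<forall>b\<in>B. x \<otimes> b \<in> C}"
      "a \<otimes> x \<in> {x \<in> carrier R. \<forall>b\<in>B. x \<otimes> b \<in> C}"
      using * assms(2) by (auto simp: subset_iff m_assoc m_comm[of a x])
  qed
  then have A: "Idl A \<subseteq> {x \<in> carrier R. \<forall>b\<in>B. x \<otimes> b \<in> C}"
    using assms by (subst Idl_subset_iff) auto
  have 2: "ideal {y \<in> carrier R. \<forall>a\<in>Idl A. a \<otimes> y \<in> C} R"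
  proof (rule idealI[OF ring_axioms])
    show "subgroup {y \<in> carrier R. \<forall>a\<in>Idl A. a \<otimes> y \<in> C} (add_monoid R)"
      using A assms by unfold_locales
        (auto simp: r_distr subset_iff ideal_add_closed ideal_zero r_minus ideal_uminus
          simp flip: a_inv_def)
  next
    fix a x assume *: "a \<in> {y \<in> carrier R. \<forall>a\<in>Idl A. a \<otimes> y \<in> C}" "x \<in> carrier R"
    have "x \<otimes> (b \<otimes> a) \<in> C" if "b \<in> Idl A" for b
      using * that assms(3) by (simp add: ideal.I_l_closed)
    then have "b \<otimes> (x \<otimes> a) \<in> C" if "b \<in> Idl A" for b
      using that A * by (subst m_lcomm) auto
    then show "x \<otimes> a \<in> {y \<in> carrier R. \<forall>a\<in>Idl A. a \<otimes> y \<in> C}"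
      "a \<otimes> x \<in> {y \<in> carrier R. \<forall>a\<in>Idl A. a \<otimes> y \<in> C}"
      using * by (auto simp: m_comm[of a x])
  qed
  have "Idl B \<subseteq> {y \<in> carrier R. \<forall>a\<in>Idl A. a \<otimes> y \<in> C}"
    using assms A 2 by (subst Idl_subset_iff) auto
  then show ?thesis
    using assms by (intro ideal_prod_subset) auto
qed

lemma prod_PIdl_mem:
  "ideal L R \<Longrightarrow> r \<in> carrier R \<Longrightarrow> x \<in> L \<cdot> (PIdl r) \<longleftrightarrow> (\<exists>l\<in>L. x = l \<otimes> r)"
proof
  assume L: "ideal L R" and r: "r \<in> carrier R"
  show "\<exists>l\<in>L. x = l \<otimes> r" if "x \<in> L \<cdot> (PIdl r)"
    using that
  proof (induct x rule: ideal_prod.induct)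
    case (prod i j)
    then obtain s where s: "s \<in> carrier R" "j = s \<otimes> r" by (auto simp: PIdl_mem)
    then have "i \<otimes> j = (i \<otimes> s) \<otimes> r" using prod r L by (simp add: m_assoc ideal.Icarr)
    then show ?case using prod s L by (meson ideal.I_r_closed)
  next
    case (sum s1 s2)
    then show ?case using L r by (metis ideal.Icarr ideal_add_closed l_distr)
  qed
  show "x \<in> L \<cdot> (PIdl r)" if "\<exists>l\<in>L. x = l \<otimes> r"
    using that r by (auto intro: ideal_prod.prod cgenideal_self)
qed

lemma prod_PIdlE:
  assumes "x \<in> L \<cdot> (PIdl r)" "ideal L R" "r \<in> carrier R"
  obtains l where "l \<in> L" "x = l \<otimes> r"
  using assms prod_PIdl_mem by metis

text \<open>Of \<open>p + q\<close> factors, each from \<open>A\<close> or from \<open>B\<close>, at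
  least \<open>p\<close> come from \<open>A\<close> or at least \<open>q\<close> from
  \<open>B\<close>. The cofactors are kept as powers of \<open>A <+> B\<close>, so that no degree is
  lost; the Ratliff-Rush argument depends on this.\<close>

lemma binomial_ipow_subset:
  assumes A: "ideal A R" and B: "ideal B R"
  shows "ipow (A <+> B) (p + q)
           \<subseteq> (ipow A p \<cdot> ipow (A <+> B) q) <+> (ipow B q \<cdot> ipow (A <+> B) p)"
proof (induction p arbitrary: q)
  case 0
  show ?case
    using A B subset_addI1[of "carrier R \<cdot> ipow (A <+> B) q" "ipow B q \<cdot> carrier R"]
    by (simp add: ideal_closed one_prod)
next
  case (Suc p)
  note IH = Suc.IH
  note ids = A B ideal_closed
  let ?K = "A <+> B"
  show ?case
  proof (induction q)
    case 0
    show ?case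
      using subset_addI2[of "ipow A (Suc p) \<cdot> carrier R" "carrier R \<cdot> ipow ?K (Suc p)"]
      by (simp add: ids one_prod)
  next
    case (Suc q)
    \<comment> \<open>The first factor lies in \<open>A\<close> or in \<open>B\<close>, which lowers
      \<open>p\<close> or \<open>q\<close> respectively; hence the nested induction.\<close>
    have "ipow ?K (Suc p + Suc q) = (A <+> B) \<cdot> ipow ?K (p + Suc q)"
      by (simp add: ipow_Suc ids)
    also have "\<dots> = (A \<cdot> ipow ?K (p + Suc q)) <+> (B \<cdot> ipow ?K (Suc p + q))"
      by (simp add: ideal_prod_distr ids)
    also have "\<dots> \<subseteq> (ipow A (Suc p) \<cdot> ipow ?K (Suc q)) <+> (ipow B (Suc q) \<cdot> ipow ?K (Suc p))"
      (is "_ \<subseteq> ?X <+> ?Y")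
    proof (rule set_add_mono[THEN subset_trans])
      have "A \<cdot> ipow ?K (p + Suc q)
          \<subseteq> A \<cdot> ((ipow A p \<cdot> ipow ?K (Suc q)) <+> (ipow B (Suc q) \<cdot> ipow ?K p))"
        by (intro ideal_prod_mono order_refl IH)
      also have "\<dots> \<subseteq> ?X <+> ?Y"
      proof -
        have "A \<cdot> (ipow A p \<cdot> ipow ?K (Suc q)) = ?X"
          by (simp add: ids ipow_Suc ideal_prod_assoc)
        moreover have "A \<cdot> (ipow B (Suc q) \<cdot> ipow ?K p) = ipow B (Suc q) \<cdot> (A \<cdot> ipow ?K p)"
          by (metis ids(1,2) add_ideals ideal_ipow ideal_prod_assoc ideal_prod_commute)
        moreover have "\<dots> \<subseteq> ?Y"
          using subset_addI1[OF A B] by (simp add: ipow_Suc[of ?K] ids ideal_prod_mono)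
        ultimately show ?thesis
          by (simp add: ideal_prod_distr ids set_add_mono)
      qed
      finally show "A \<cdot> ipow ?K (p + Suc q) \<subseteq> ?X <+> ?Y" .
      have "B \<cdot> ipow ?K (Suc p + q)
          \<subseteq> B \<cdot> ((ipow A (Suc p) \<cdot> ipow ?K q) <+> (ipow B q \<cdot> ipow ?K (Suc p)))"
        by (intro ideal_prod_mono order_refl Suc.IH)
      also have "\<dots> \<subseteq> ?X <+> ?Y"
      proof -
        have "B \<cdot> (ipow B q \<cdot> ipow ?K (Suc p)) = ?Y"
          by (simp add: ids ipow_Suc ideal_prod_assoc)
        moreover have "B \<cdot> (ipow A (Suc p) \<cdot> ipow ?K q) = ipow A (Suc p) \<cdot> (B \<cdot> ipow ?K q)"
          by (metis ids(1,2) add_ideals ideal_ipow ideal_prod_assoc ideal_prod_commute)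
        moreover have "\<dots> \<subseteq> ?X"
          using subset_addI2[OF A B] by (simp add: ipow_Suc[of ?K] ids ideal_prod_mono)
        ultimately show ?thesis
          by (simp add: ideal_prod_distr ids set_add_mono)
      qed
      finally show "B \<cdot> ipow ?K (Suc p + q) \<subseteq> ?X <+> ?Y" .
      show "?X <+> ?Y <+> (?X <+> ?Y) \<subseteq> ?X <+> ?Y"
        by (simp add: ids add_subset)
    qed
    finally show ?case .
  qed
qed

text \<open>The annihilator of \<open>r\<close> modulo \<open>B\<close>, so that
  \<open>R / colon B r\<close> is the cyclic module \<open>(B + (r))/B\<close>.\<close>

definition colon :: "'a set \<Rightarrow> 'a \<Rightarrow> 'a set" where
  "colon B r = {s \<in> carrier R. s \<otimes> r \<in> B}"

lemma ideal_colon: "ideal B R \<Longrightarrow> r \<in> carrier R \<Longrightarrow> ideal (colon B r) R"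
proof (rule idealI[OF ring_axioms])
  assume "ideal B R" "r \<in> carrier R"
  then show "subgroup (colon B r) (add_monoid R)"
    by unfold_locales
       (auto simp: colon_def l_distr ideal_add_closed ideal_zero l_minus ideal_uminus
          simp flip: a_inv_def)
next
  fix a x assume *: "ideal B R" "r \<in> carrier R" "a \<in> colon B r" "x \<in> carrier R"
  then have "x \<otimes> (a \<otimes> r) \<in> B" by (simp add: colon_def ideal.I_l_closed)
  then show "x \<otimes> a \<in> colon B r" "a \<otimes> x \<in> colon B r"
    using * by (auto simp: colon_def m_ac)
qed

lemma subset_colon: "ideal B R \<Longrightarrow> r \<in> carrier R \<Longrightarrow> B \<subseteq> colon B r"
  by (auto simp: colon_def ideal.I_r_closed ideal.Icarr)

lemma colon_mono: "B \<subseteq> B' \<Longrightarrow> colon B r \<subseteq> colon B' r"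
  by (auto simp: colon_def)

lemma colon_eq_carrier: "r \<in> B \<Longrightarrow> ideal B R \<Longrightarrow> colon B r = carrier R"
  by (auto simp: colon_def ideal.I_l_closed)

end

section \<open>Length of ideal intervals\<close>

inductive (in cring) ideal_chain :: "nat \<Rightarrow> 'a set \<Rightarrow> 'a set \<Rightarrow> bool" where
  refl: "ideal A R \<Longrightarrow> ideal_chain 0 A A"
| step: "ideal_chain n C B \<Longrightarrow> ideal A R \<Longrightarrow> B \<subset> A \<Longrightarrow> ideal_chain (Suc n) C A"

text \<open>For ideals \<open>C \<subseteq> A\<close> this is the length of the module \<open>A/C\<close>.\<close>
definition (in cring) ilen :: "'a set \<Rightarrow> 'a set \<Rightarrow> enat" where
  "ilen C A = Sup {enat n | n. ideal_chain n C A}"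

context cring
begin

lemma ideal_chainD: "ideal_chain n C A \<Longrightarrow> ideal C R \<and> ideal A R \<and> C \<subseteq> A"
  by (induction rule: ideal_chain.induct) auto

lemma ideal_chain_trans: "ideal_chain m B A \<Longrightarrow> ideal_chain n C B \<Longrightarrow> ideal_chain (n + m) C A"
  by (induction rule: ideal_chain.induct) (auto intro: ideal_chain.step)

lemma ideal_chain_1: "ideal A R \<Longrightarrow> ideal B R \<Longrightarrow> B \<subset> A \<Longrightarrow> ideal_chain 1 B A"
  using ideal_chain.intros by (metis One_nat_def)

lemma ideal_chain_exists: "ideal A R \<Longrightarrow> ideal B R \<Longrightarrow> B \<subseteq> A \<Longrightarrow> \<exists>n. ideal_chain n B A"
  using ideal_chain.refl ideal_chain_1 by (metis psubsetI)

lemma add_minus_cancel_left: "a \<in> carrier R \<Longrightarrow> b \<in> carrier R \<Longrightarrow> a \<oplus> b \<ominus> a = b"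
  by algebra

lemma ideal_modular:
  assumes "ideal A R" "ideal A' R" "ideal B R" "A' \<subseteq> A" "A \<inter> B = A' \<inter> B" "A <+> B = A' <+> B"
  shows "A = A'"
proof
  show "A \<subseteq> A'"
  proof
    fix a assume a: "a \<in> A"
    then have "a \<in> A' <+> B"
      using assms subset_addI1[of A B] by auto
    then obtain a' b where *: "a' \<in> A'" "b \<in> B" "a = a' \<oplus> b" by (auto simp: set_add_mem)
    have "a' \<in> carrier R" "b \<in> carrier R"
      using * assms by (auto dest: ideal.Icarr)
    then have "b = a \<ominus> a'"
      using * by (simp add: add_minus_cancel_left)
    then have "b \<in> A \<inter> B"
      using * a assms ideal_minus[of A a a'] by auto
    then show "a \<in> A'"
      using assms * ideal_add_closed[of A' a' b] by auto
  qed
qed (fact assms)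

text \<open>By the modular law a strict step cannot become an equality both after intersecting with
  \<open>B\<close> and after adding \<open>B\<close>. So each step survives in at least one of the
  two image chains.\<close>

lemma ideal_chain_split:
  assumes "ideal_chain n C A" "ideal B R"
  shows "\<exists>p q. n \<le> p + q \<and> ideal_chain p (C \<inter> B) (A \<inter> B) \<and> ideal_chain q (C <+> B) (A <+> B)"
  using assms
proof (induction rule: ideal_chain.induct)
  case (refl A)
  then show ?case
    by (intro exI[of _ 0]) (auto intro!: ideal_chain.refl i_intersect ideal_closed)
next
  case (step n C A' A)
  then obtain p q where pq: "n \<le> p + q" "ideal_chain p (C \<inter> B) (A' \<inter> B)"
    "ideal_chain q (C <+> B) (A' <+> B)" by blast
  have A': "ideal A' R" using ideal_chainD step by blast
  have ids: "ideal (A \<inter> B) R" "ideal (A <+> B) R"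
    using step by (auto intro!: i_intersect ideal_closed)
  have sub: "A' \<inter> B \<subseteq> A \<inter> B" "A' <+> B \<subseteq> A <+> B"
    using step(3) set_add_mono[of A' A B B] by auto
  consider "A' \<inter> B \<noteq> A \<inter> B" | "A' <+> B \<noteq> A <+> B" "A' \<inter> B = A \<inter> B"
    using ideal_modular[of A A' B] step A' by blast
  then show ?case
  proof cases
    case 1
    then have *: "ideal_chain (Suc p) (C \<inter> B) (A \<inter> B)"
      using sub pq ids by (auto intro!: ideal_chain.step)
    have "\<exists>q'\<ge>q. ideal_chain q' (C <+> B) (A <+> B)"
    proof (cases "A' <+> B = A <+> B")
      case False
      then have "ideal_chain (Suc q) (C <+> B) (A <+> B)"
        using sub pq ids by (intro ideal_chain.step) auto
      then show ?thesis by (intro exI[of _ "Suc q"]) auto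
    qed (use pq(3) in auto)
    then obtain q' where "q' \<ge> q" "ideal_chain q' (C <+> B) (A <+> B)" by blast
    then show ?thesis using * pq(1) by (intro exI[of _ "Suc p"] exI[of _ q']) auto
  next
    case 2
    then have "ideal_chain (Suc q) (C <+> B) (A <+> B)"
      using sub pq ids by (auto intro!: ideal_chain.step)
    then show ?thesis using 2 pq by (intro exI[of _ p] exI[of _ "Suc q"]) auto
  qed
qed

lemma ilen_ge: "ideal_chain n C A \<Longrightarrow> enat n \<le> ilen C A"
  unfolding ilen_def by (intro Sup_upper) auto

lemma ilen_le: "(\<And>n. ideal_chain n C A \<Longrightarrow> enat n \<le> k) \<Longrightarrow> ilen C A \<le> k"
  unfolding ilen_def by (intro Sup_least) auto

text \<open>A finite bound below a supremum of naturals is reached by an actual chain, also when the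
  supremum is infinite.\<close>

lemma ilen_obtain:
  assumes "ideal A R" "ideal C R" "C \<subseteq> A" "enat m \<le> ilen C A"
  shows "\<exists>n\<ge>m. ideal_chain n C A"
proof (rule ccontr)
  assume "\<not> ?thesis"
  then have *: "n < m" if "ideal_chain n C A" for n using that not_less by blast
  obtain n where "ideal_chain n C A" using assms ideal_chain_exists by blast
  then have "m \<noteq> 0" using * by fastforce
  have "ilen C A \<le> enat (m - 1)"
    using * by (intro ilen_le) fastforce
  with assms(4) have "enat m \<le> enat (m - 1)" by (rule order_trans)
  then show False using \<open>m \<noteq> 0\<close> by simp
qed

lemma ilen_additive:
  assumes "ideal A R" "ideal B R" "ideal C R" "C \<subseteq> B" "B \<subseteq> A"
  shows "ilen C A = ilen C B + ilen B A"
proof (rule antisym)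
  show "ilen C A \<le> ilen C B + ilen B A"
  proof (rule ilen_le)
    fix n assume "ideal_chain n C A"
    from ideal_chain_split[OF this assms(2)] obtain p q where
      pq: "n \<le> p + q" "ideal_chain p (C \<inter> B) (A \<inter> B)" "ideal_chain q (C <+> B) (A <+> B)" by blast
    have "C \<inter> B = C" "A \<inter> B = B" "C <+> B = B" "A <+> B = A"
      using assms ideal_add_absorb[of A B] ideal_add_absorb[of B C] ideal_add_comm[of C B] by auto
    with pq have "enat p \<le> ilen C B" "enat q \<le> ilen B A" by (simp_all add: ilen_ge)
    then have "enat p + enat q \<le> ilen C B + ilen B A" by (rule add_mono)
    then show "enat n \<le> ilen C B + ilen B A"
      using pq(1) by (metis enat_ord_simps(1) order_trans plus_enat_simps(1))
  qed
  \<comment> \<open>Both lengths may be infinite, so concatenation of chains is first applied to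
    finite lower bounds.\<close>
  have *: "enat p + enat q \<le> ilen C A" if pq: "enat p \<le> ilen C B" "enat q \<le> ilen B A" for p q
  proof -
    obtain p' where p': "p \<le> p'" "ideal_chain p' C B"
      using ilen_obtain[OF assms(2,3,4) pq(1)] by blast
    obtain q' where q': "q \<le> q'" "ideal_chain q' B A"
      using ilen_obtain[OF assms(1,2,5) pq(2)] by blast
    have "enat (p' + q') \<le> ilen C A"
      using p' q' by (intro ilen_ge ideal_chain_trans)
    then show ?thesis using p' q' by (metis add_mono enat_ord_simps(1) order_trans plus_enat_simps(1))
  qed
  show "ilen C B + ilen B A \<le> ilen C A"
  proof (cases "ilen C A")
    case (enat n)
    have 1: "ilen C B \<le> enat n"
    proof (rule ccontr)
      assume "\<not> ?thesis"
      then have "enat (Suc n) \<le> ilen C B" by (simp add: Suc_ile_eq)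
      then show False using *[of "Suc n" 0] enat by (auto simp: zero_enat_def[symmetric])
    qed
    have 2: "ilen B A \<le> enat n"
    proof (rule ccontr)
      assume "\<not> ?thesis"
      then have "enat (Suc n) \<le> ilen B A" by (simp add: Suc_ile_eq)
      then show False using *[of 0 "Suc n"] enat by (auto simp: zero_enat_def[symmetric])
    qed
    from 1 2 obtain p q where "ilen C B = enat p" "ilen B A = enat q"
      by (metis enat_ile)
    then show ?thesis using *[of p q] by simp
  qed simp
qed

lemma ilen_self [simp]: "ilen A A = 0"
proof -
  have "n = 0" if "ideal_chain n A A" for n
    using that by (cases rule: ideal_chain.cases) (auto dest: ideal_chainD)
  then have "ilen A A \<le> 0" by (intro ilen_le) (auto simp: zero_enat_def)
  then show ?thesis by simp
qed

lemma ilen_mono: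
  assumes "ideal A R" "ideal B R" "ideal A' R" "ideal B' R" "B' \<subseteq> B" "B \<subseteq> A" "A \<subseteq> A'"
  shows "ilen B A \<le> ilen B' A'"
proof -
  have "ilen B' A' = ilen B' B + (ilen B A + ilen A A')"
    using assms ilen_additive[of A' B B'] ilen_additive[of A' A B] by auto
  then show ?thesis by (metis add_increasing add_increasing2 order_refl zero_le)
qed

lemma ilen_ge_1: "ideal A R \<Longrightarrow> ideal B R \<Longrightarrow> B \<subset> A \<Longrightarrow> 1 \<le> ilen B A"
  using ilen_ge[OF ideal_chain_1] by (simp add: one_enat_def)

lemma ilen_eq_0:
  assumes "ideal A R" "ideal B R" "B \<subseteq> A" "ilen B A = 0" shows "A = B"
  using ilen_ge_1[of A B] assms by (metis not_one_le_zero psubsetI)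

text \<open>An ideal \<open>K\<close> between \<open>B\<close> and \<open>B + (r)\<close> is
  recovered from its colon ideal: if \<open>b + s r\<close> lies in \<open>K\<close>, so does
  \<open>s r\<close>, since \<open>b\<close> is already there.\<close>

lemma cyclic_interval:
  assumes "ideal B R" "r \<in> carrier R" "ideal K R" "B \<subseteq> K" "K \<subseteq> B <+> PIdl r"
  shows "K = B <+> (colon K r) \<cdot> (PIdl r)"
proof
  have c: "ideal (colon K r) R" using assms by (simp add: ideal_colon)
  show "K \<subseteq> B <+> (colon K r) \<cdot> (PIdl r)"
  proof
    fix x assume x: "x \<in> K"
    then have "x \<in> B <+> PIdl r" using assms(5) by blast
    then obtain b s where *: "b \<in> B" "s \<in> carrier R" "x = b \<oplus> s \<otimes> r"
      by (metis set_addE PIdlE)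
    have "b \<in> carrier R" using * assms by (auto dest: ideal.Icarr)
    then have "s \<otimes> r = x \<ominus> b" using * assms(2) by (simp add: add_minus_cancel_left)
    moreover have "x \<ominus> b \<in> K" using ideal_minus[OF assms(3) x, of b] * assms(4) by auto
    ultimately have "s \<otimes> r \<in> K" by simp
    then show "x \<in> B <+> (colon K r) \<cdot> (PIdl r)"
      using * prod_PIdl_mem[OF c assms(2)] by (auto intro!: set_addI simp: colon_def)
  qed
  show "B <+> (colon K r) \<cdot> (PIdl r) \<subseteq> K"
  proof (intro add_subset assms)
    show "(colon K r) \<cdot> (PIdl r) \<subseteq> K"
      using prod_PIdl_mem[OF c assms(2)] by (auto simp: colon_def)
  qed
qed

text \<open>From \<open>s r = b + l r\<close> it follows that \<open>s - l\<close> annihilates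
  \<open>r\<close> modulo \<open>B\<close>, so \<open>s\<close> lies in \<open>L\<close> as soon as
  \<open>L\<close> contains that annihilator.\<close>

lemma colon_cyclic:
  assumes "ideal B R" "r \<in> carrier R" "ideal L R" "colon B r \<subseteq> L"
  shows "colon (B <+> L \<cdot> (PIdl r)) r = L"
proof
  show "colon (B <+> L \<cdot> (PIdl r)) r \<subseteq> L"
  proof
    fix s assume s: "s \<in> colon (B <+> L \<cdot> (PIdl r)) r"
    then have "s \<in> carrier R" "s \<otimes> r \<in> B <+> L \<cdot> (PIdl r)"
      by (auto simp: colon_def)
    then obtain b l where *: "s \<in> carrier R" "b \<in> B" "l \<in> L" "s \<otimes> r = b \<oplus> l \<otimes> r"
      using assms(2,3) by (metis set_addE prod_PIdlE)
    have car: "b \<in> carrier R" "l \<in> carrier R" using * assms by (auto dest: ideal.Icarr)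
    have "(s \<ominus> l) \<otimes> r = s \<otimes> r \<ominus> l \<otimes> r" using * car assms(2) by algebra
    also have "\<dots> = b" using * car assms(2) by algebra
    finally have "s \<ominus> l \<in> colon B r" using * car by (auto simp: colon_def)
    then have "s \<ominus> l \<oplus> l \<in> L" using assms * by (intro ideal_add_closed) auto
    moreover have "s \<ominus> l \<oplus> l = s" using * car by algebra
    ultimately show "s \<in> L" by simp
  qed
  show "L \<subseteq> colon (B <+> L \<cdot> (PIdl r)) r"
  proof
    fix l assume l: "l \<in> L"
    then have "l \<in> carrier R" by (rule ideal.Icarr[OF assms(3)])
    moreover have "l \<otimes> r = \<zero> \<oplus> l \<otimes> r" using calculation assms by simp
    moreover have "l \<otimes> r \<in> L \<cdot> (PIdl r)"
      using l prod_PIdl_mem[OF assms(3,2)] by blast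
    then have "\<zero> \<oplus> l \<otimes> r \<in> B <+> L \<cdot> (PIdl r)"
      by (rule set_addI[OF ideal_zero[OF assms(1)]])
    ultimately show "l \<in> colon (B <+> L \<cdot> (PIdl r)) r"
      by (simp add: colon_def)
  qed
qed

text \<open>By the two previous lemmas \<open>K \<mapsto> (K : r)\<close> and
  \<open>L \<mapsto> B + L r\<close> are mutually inverse on the two intervals, hence carry strict
  chains to strict chains. This replaces the isomorphism of \<open>(B + (r))/B\<close> with
  \<open>R/(B : r)\<close>.\<close>

lemma ilen_cyclic:
  assumes B: "ideal B R" and r: "r \<in> carrier R"
  shows "ilen B (B <+> PIdl r) = ilen (colon B r) (carrier R)"
proof (rule antisym)
  have ids: "ideal (PIdl r) R" "ideal (B <+> PIdl r) R" "ideal (colon B r) R"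
    using assms by (auto intro!: ideal_closed ideal_colon)
  have top: "colon (B <+> PIdl r) r = carrier R"
    using r subset_addI2[OF B ids(1)] cgenideal_self[OF r] by (intro colon_eq_carrier ids) auto
  have "ideal_chain n (colon B r) (colon K r)"
    if "ideal_chain n B K" "K \<subseteq> B <+> PIdl r" for n K
    using that
  proof (induction rule: ideal_chain.induct)
    case (refl B)
    then show ?case using r by (intro ideal_chain.refl ideal_colon)
  next
    case (step n C K' K)
    have K': "ideal K' R" "ideal C R" "C \<subseteq> K'" using step ideal_chainD by auto
    have "K' \<subseteq> C <+> PIdl r" "C \<subseteq> K" using step K' by auto
    then have "colon K' r \<noteq> colon K r"
      using cyclic_interval[of C r K'] cyclic_interval[of C r K] step K' r by auto
    moreover have "colon K' r \<subseteq> colon K r" using step by (intro colon_mono) auto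
    ultimately show ?case using step r by (intro ideal_chain.step ideal_colon) auto
  qed
  from this[of _ "B <+> PIdl r"] show "ilen B (B <+> PIdl r) \<le> ilen (colon B r) (carrier R)"
    unfolding top by (intro ilen_le ilen_ge) auto
  have *: "ideal_chain n (B <+> L \<cdot> (PIdl r)) (B <+> L' \<cdot> (PIdl r))"
    if "ideal_chain n L L'" "colon B r \<subseteq> L" for n L L'
    using that
  proof (induction rule: ideal_chain.induct)
    case (refl L)
    then show ?case using B r by (intro ideal_chain.refl ideal_closed)
  next
    case (step n L L1 L2)
    have L1: "ideal L1 R" "ideal L R" "L \<subseteq> L1" using step ideal_chainD by auto
    have "colon (B <+> L1 \<cdot> (PIdl r)) r = L1" "colon (B <+> L2 \<cdot> (PIdl r)) r = L2"
      using step.hyps step.prems L1 by (auto intro!: colon_cyclic[OF B r])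
    moreover have "L1 \<noteq> L2" using step(3) by blast
    ultimately have "B <+> L1 \<cdot> (PIdl r) \<noteq> B <+> L2 \<cdot> (PIdl r)"
      by metis
    moreover have "B <+> L1 \<cdot> (PIdl r) \<subseteq> B <+> L2 \<cdot> (PIdl r)"
      using step by (intro set_add_mono ideal_prod_mono) auto
    ultimately show ?case
      using step B r by (intro ideal_chain.step ideal_closed) auto
  qed
  have "B <+> colon B r \<cdot> (PIdl r) = B"
    using cyclic_interval[OF B r B order_refl] subset_addI1[OF B ids(1)] by simp
  with *[of _ "colon B r" "carrier R"] show "ilen (colon B r) (carrier R) \<le> ilen B (B <+> PIdl r)"
    by (intro ilen_le ilen_ge) (auto simp: one_prod ids)
qed

text \<open>The generators are adjoined one at a time. Each cyclic step is a quotient of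
  \<open>R/q\<close>, since \<open>q\<close> annihilates the generator already modulo
  \<open>B\<close>.\<close>

lemma ilen_generators_le:
  assumes "finite G" "G \<subseteq> carrier R" "ideal B R" "ideal q R"
    and "\<And>g. g \<in> G \<Longrightarrow> q \<subseteq> colon B g"
  shows "ilen B (B <+> Idl G) \<le> of_nat (card G) * ilen q (carrier R)"
  using assms
proof (induction G rule: finite_induct)
  case empty
  then show ?case by (simp add: Idl_empty ideal_add_absorb zeroideal ideal_zero)
next
  case (insert g G)
  let ?B = "B <+> Idl G"
  have ids: "ideal (Idl G) R" "ideal ?B R" "ideal (PIdl g) R" "g \<in> carrier R"
    using insert by (auto intro!: ideal_closed)
  have eq: "B <+> Idl (insert g G) = ?B <+> PIdl g"
    using insert.prems ids
    by (metis Idl_insert ideal_add_assoc ideal_add_comm insert_subset)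
  have "q \<subseteq> colon B g" using insert.prems(4)[of g] by simp
  also have "\<dots> \<subseteq> colon ?B g"
    using subset_addI1[of B "Idl G"] insert.prems ids by (intro colon_mono) auto
  finally have "q \<subseteq> colon ?B g" .
  then have "ilen (colon ?B g) (carrier R) \<le> ilen q (carrier R)"
    using ids insert.prems
    by (intro ilen_mono ideal_colon oneideal) (auto dest: ideal_subset[OF ideal_colon])
  then have "ilen ?B (?B <+> PIdl g) \<le> ilen q (carrier R)"
    using ids by (simp add: ilen_cyclic)
  moreover have "ilen B (?B <+> PIdl g) = ilen B ?B + ilen ?B (?B <+> PIdl g)"
    using ids insert.prems by (intro ilen_additive) (auto simp: subset_addI1 add_ideals)
  moreover have "ilen B ?B \<le> of_nat (card G) * ilen q (carrier R)"
    using insert by auto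
  ultimately show ?case
    using insert eq by (simp add: distrib_right add.commute[of "ilen q _"] add_mono)
qed

section \<open>Comparison with the length of quotient modules\<close>

lemma ideal_chain_nth:
  "ideal_chain n C A \<Longrightarrow>
    \<exists>f. f 0 = C \<and> f n = A \<and> (\<forall>i\<le>n. ideal (f i) R) \<and> (\<forall>i<n. f i \<subset> f (Suc i))"
proof (induction rule: ideal_chain.induct)
  case (refl A)
  then show ?case by (intro exI[of _ "\<lambda>_. A"]) auto
next
  case (step n C B A)
  then obtain f where f: "f 0 = C" "f n = B" "\<forall>i\<le>n. ideal (f i) R" "\<forall>i<n. f i \<subset> f (Suc i)"
    by blast
  show ?case
    using f step by (intro exI[of _ "f(Suc n := A)"]) (auto simp: less_Suc_eq le_Suc_eq)
qed

lemma ideal_chain_of_nth: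
  "(\<forall>i\<le>n. ideal (f i) R) \<Longrightarrow> (\<forall>i<n. f i \<subset> f (Suc i)) \<Longrightarrow> ideal_chain n (f 0) (f n)"
proof (induction n)
  case 0
  then show ?case by (auto intro: ideal_chain.refl)
next
  case (Suc n)
  then show ?case by (intro ideal_chain.step[of n _ "f n"]) auto
qed

text \<open>Submodules of \<open>R/J\<close> correspond to the ideals containing \<open>J\<close>.
  This is the link between the module length of the definitions and chains of ideals.\<close>

lemma module_length_quot_module:
  assumes J: "ideal J R"
  shows "module_length R (quot_module R J) = ilen J (carrier R)"
proof -
  interpret J: ideal J R by fact
  interpret Q: cring "R Quot J" by (rule J.quotient_is_cring[OF is_cring])
  interpret h: ring_hom_ring R "R Quot J" "(+>) J" by (rule J.rcos_ring_hom_ring)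
  interpret M: module R "quot_module R J" by (rule quot_module_is_module[OF J])
  let ?M = "quot_module R J"
  have sel: "carrier ?M = carrier (R Quot J)" "add ?M = add (R Quot J)" "zero ?M = zero (R Quot J)"
    "\<And>a X. a \<odot>\<^bsub>?M\<^esub> X = (J +> a) \<otimes>\<^bsub>R Quot J\<^esub> X"
    by (simp_all add: quot_module_def)
  have carr: "\<exists>x\<in>carrier R. X = J +> x" if "X \<in> carrier (R Quot J)" for X
    using that by (auto simp: FactRing_def A_RCOSETS_def' a_r_coset_def')
  have mem_coset: "y \<in> J +> x \<longleftrightarrow> (\<exists>j\<in>J. y = j \<oplus> x)" for x y
    by (auto simp: a_r_coset_def')
  \<comment> \<open>Preimage of a submodule under the projection; strict inclusions survive because
    every coset has a representative in \<open>R\<close>.\<close>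
  define K where "K N = {x \<in> carrier R. J +> x \<in> N}" for N
  have K: "ideal (K N) R" "J \<subseteq> K N" if N: "submodule N R ?M" for N
  proof -
    note E = M.submoduleE[OF N]
    have sm: "(J +> a) \<otimes>\<^bsub>R Quot J\<^esub> X \<in> N" if "a \<in> carrier R" "X \<in> N" for a X
      using E(4)[of a X] that by (simp add: sel)
    have ad: "X \<oplus>\<^bsub>R Quot J\<^esub> Y \<in> N" if "X \<in> N" "Y \<in> N" for X Y
      using E(5)[of X Y] that by (simp add: sel)
    have scale: "a \<otimes> x \<in> K N" if "a \<in> carrier R" "x \<in> K N" for a x
      using sm[of a "J +> x"] that by (simp add: K_def)
    have zero: "\<zero>\<^bsub>R Quot J\<^esub> \<in> N"
    proof -
      obtain X where X: "X \<in> N" using E(2) by blast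
      then obtain x where "x \<in> carrier R" "X = J +> x" using carr E(1) by (auto simp: sel)
      then show ?thesis using sm[of \<zero> X] X by simp
    qed
    show "ideal (K N) R"
    proof (rule idealI[OF ring_axioms])
      show "subgroup (K N) (add_monoid R)"
      proof
        show "K N \<subseteq> carrier (add_monoid R)" by (auto simp: K_def)
        show "\<one>\<^bsub>add_monoid R\<^esub> \<in> K N" using zero by (simp add: K_def)
        show "x \<otimes>\<^bsub>add_monoid R\<^esub> y \<in> K N" if "x \<in> K N" "y \<in> K N" for x y
          using that ad[of "J +> x" "J +> y"] by (simp add: K_def)
        show "inv\<^bsub>add_monoid R\<^esub> x \<in> K N" if "x \<in> K N" for x
        proof -
          have "x \<in> carrier R" using that by (simp add: K_def)
          then have "\<ominus> x = (\<ominus> \<one>) \<otimes> x" by (simp add: l_minus)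
          then show ?thesis using scale[of "\<ominus> \<one>" x] that by (simp add: a_inv_def)
        qed
      qed
    next
      fix a x assume "a \<in> K N" "x \<in> carrier R"
      moreover have "a \<in> carrier R" using calculation by (simp add: K_def)
      ultimately show "x \<otimes> a \<in> K N" "a \<otimes> x \<in> K N" using scale[of x a] by (simp_all add: m_comm)
    qed
    have J0: "J +> j = \<zero>\<^bsub>R Quot J\<^esub>" if "j \<in> J" for j
    proof -
      have "\<zero>\<^bsub>R Quot J\<^esub> = J" unfolding FactRing_def by simp
      then show ?thesis using J.a_rcos_const[OF that] by metis
    qed
    show "J \<subseteq> K N"
    proof
      fix j assume "j \<in> J"
      with J0[OF this] J.Icarr[OF this] zero show "j \<in> K N" by (simp add: K_def)
    qed
  qed
  have K_less: "K N \<subset> K N'" if h: "N \<subset> N'" "submodule N' R ?M" for N N'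
  proof -
    obtain X where X: "X \<in> N'" "X \<notin> N" using h by blast
    then obtain x where "x \<in> carrier R" "X = J +> x"
      using carr M.submoduleE(1)[OF h(2)] by (auto simp: sel)
    then have "x \<in> K N'" "x \<notin> K N" using X by (auto simp: K_def)
    moreover have "K N \<subseteq> K N'" using h by (auto simp: K_def)
    ultimately show ?thesis by blast
  qed
  show ?thesis
  proof (rule antisym)
    show "module_length R ?M \<le> ilen J (carrier R)"
      unfolding module_length_def
    proof (rule Sup_least, clarify)
      fix n N assume N: "\<forall>i\<le>n. submodule (N i) R ?M" "\<forall>i<n. N i \<subset> N (Suc i)"
      have "ideal_chain n (K (N 0)) (K (N n))"
        using ideal_chain_of_nth[of n "\<lambda>i. K (N i)"] N K(1) K_less by simp
      then have "enat n \<le> ilen (K (N 0)) (K (N n))" by (rule ilen_ge)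
      also have "\<dots> \<le> ilen J (carrier R)"
        using ideal_chainD[OF \<open>ideal_chain n _ _\<close>] K[of "N 0"] N J ideal_subset
        by (intro ilen_mono oneideal) auto
      finally show "enat n \<le> ilen J (carrier R)" .
    qed
    show "ilen J (carrier R) \<le> module_length R ?M"
    proof (rule ilen_le)
      fix n assume ch: "ideal_chain n J (carrier R)"
      obtain f where f: "f 0 = J" "f n = carrier R" "\<forall>i\<le>n. ideal (f i) R"
        "\<forall>i<n. f i \<subset> f (Suc i)" using ideal_chain_nth[OF ch] by blast
      have J_sub: "J \<subseteq> f i" if "i \<le> n" for i
        using that
      proof (induction i)
        case (Suc i)
        then have "f i \<subset> f (Suc i)" using f(4) by simp
        with Suc show ?case by simp
      qed (simp add: f(1))
      let ?N = "\<lambda>i. (+>) J ` f i"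
      have sub: "submodule (?N i) R ?M" if "i \<le> n" for i
      proof (rule M.module_incl_imp_submodule)
        note fi = f(3)[rule_format, OF that]
        show "?N i \<subseteq> carrier ?M" using fi by (auto simp: sel ideal.Icarr)
        show "module R (?M\<lparr>carrier := ?N i\<rparr>)"
        proof -
          have "submodule (?N i) R ?M"
          proof (rule M.submoduleI)
            show "?N i \<subseteq> carrier ?M" using fi by (auto simp: sel ideal.Icarr)
            show "\<zero>\<^bsub>?M\<^esub> \<in> ?N i"
              by (metis h.hom_zero ideal_zero[OF fi] imageI sel(3))
            show "\<ominus>\<^bsub>?M\<^esub> a \<in> ?N i" if h: "a \<in> ?N i" for a
            proof -
              obtain x where x: "x \<in> f i" "a = J +> x" using h by blast
              have "x \<in> carrier R" using ideal.Icarr[OF fi] x by blast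
              then have "\<ominus>\<^bsub>R Quot J\<^esub> a = J +> (\<ominus> x)" using x by (simp add: h.hom_a_inv)
              moreover have "\<ominus>\<^bsub>?M\<^esub> a = \<ominus>\<^bsub>R Quot J\<^esub> a"
                by (simp add: a_inv_def m_inv_def sel)
              ultimately show ?thesis using x ideal_uminus[OF fi] by auto
            qed
            show "a \<oplus>\<^bsub>?M\<^esub> b \<in> ?N i" if h: "a \<in> ?N i" "b \<in> ?N i" for a b
            proof -
              obtain x y where x: "x \<in> f i" "y \<in> f i" "a = J +> x" "b = J +> y" using h by blast
              have "x \<in> carrier R" "y \<in> carrier R" using ideal.Icarr[OF fi] x by blast+
              then have "a \<oplus>\<^bsub>?M\<^esub> b = J +> (x \<oplus> y)" using x by (simp add: sel)
              then show ?thesis using x ideal_add_closed[OF fi] by auto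
            qed
            show "a \<odot>\<^bsub>?M\<^esub> x \<in> ?N i" if h: "a \<in> carrier R" "x \<in> ?N i" for a x
            proof -
              obtain y where y: "y \<in> f i" "x = J +> y" using h by blast
              have "y \<in> carrier R" using ideal.Icarr[OF fi] y by blast
              then have "a \<odot>\<^bsub>?M\<^esub> x = J +> (a \<otimes> y)" using y h by (simp add: sel)
              then show ?thesis using y h ideal.I_l_closed[OF fi] by auto
            qed
          qed
          then show ?thesis by (rule submodule.submodule_is_module[OF _ M.module_axioms])
        qed
      qed
      have less: "?N i \<subset> ?N (Suc i)" if "i < n" for i
      proof -
        have sub: "f i \<subset> f (Suc i)" and fi: "ideal (f i) R" "ideal (f (Suc i)) R"
          using f that by auto
        then obtain x where x: "x \<in> f (Suc i)" "x \<notin> f i" by blast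
        have "J +> x \<notin> ?N i"
        proof
          assume "J +> x \<in> ?N i"
          then obtain y where y: "y \<in> f i" "J +> x = J +> y" by blast
          have "x \<in> carrier R" using ideal.Icarr[OF fi(2)] x by blast
          then have "x \<in> J +> x" by (rule J.a_rcos_self)
          then obtain j where "j \<in> J" "x = j \<oplus> y" using y mem_coset by auto
          then show False using J_sub[of i] that x(2) y ideal_add_closed[OF fi(1)] by auto
        qed
        then show ?thesis using x sub by blast
      qed
      have ex: "\<exists>N. (\<forall>i\<le>n. submodule (N i) R ?M) \<and> (\<forall>i<n. N i \<subset> N (Suc i))"
        by (rule exI[of _ ?N], intro conjI allI impI, erule sub, erule less)
      show "enat n \<le> module_length R ?M"
        unfolding module_length_def
        by (rule Sup_upper) (use ex in blast)
    qed
  qed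
qed

lemma colength_eq: "ideal J R \<Longrightarrow> colength R J = the_enat (ilen J (carrier R))"
  by (simp add: colength_def module_length_quot_module)

end

section \<open>Noetherian local rings\<close>

lemma enat_le_not_infinity: "(x::enat) \<le> y \<Longrightarrow> y \<noteq> \<infinity> \<Longrightarrow> x \<noteq> \<infinity>"
  by (cases x) auto

text \<open>The ascending chain condition puts the union of a chain of ideals into the chain itself,
  so Zorn's lemma applies to every nonempty set of ideals.\<close>

lemma (in noetherian_ring) ideal_set_maximal:
  assumes "S \<noteq> {}" "\<And>K. K \<in> S \<Longrightarrow> ideal K R"
  shows "\<exists>K\<in>S. \<forall>L\<in>S. K \<subseteq> L \<longrightarrow> L = K"
proof (rule subset_Zorn_nonempty[OF assms(1)])
  fix C assume C: "C \<noteq> {}" "subset.chain S C"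
  then have "subset.chain {I. ideal I R} C"
    using assms(2) by (auto simp: subset.chain_def subset_eq)
  then have "\<Union>C \<in> C" by (rule ideal_chain_is_trivial[OF C(1)])
  then show "\<Union>C \<in> S" using C by (auto simp: subset.chain_def)
qed

context noetherian_local_ring
begin

lemma ideal_mm: "ideal \<mm> R"
  using maximal by (rule maximalideal.axioms)

lemma proper_subset_mm:
  assumes "ideal A R" "A \<noteq> carrier R"
  shows "A \<subseteq> \<mm>"
proof -
  let ?S = "{K. ideal K R \<and> A \<subseteq> K \<and> K \<noteq> carrier R}"
  have ne: "?S \<noteq> {}" using assms by blast
  obtain K where K: "K \<in> ?S" "\<forall>L\<in>?S. K \<subseteq> L \<longrightarrow> L = K"
    using ideal_set_maximal[OF ne] by blast
  have "maximalideal K R"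
  proof (rule maximalidealI)
    show "ideal K R" "carrier R \<noteq> K" using K(1) by auto
    fix L assume L: "ideal L R" "K \<subseteq> L" "L \<subseteq> carrier R"
    show "L = K \<or> L = carrier R"
      using K(1) L by (cases "L = carrier R") (auto dest: K(2)[rule_format, rotated])
  qed
  then show ?thesis using unique_maximal K by blast
qed

lemma one_notin_mm: "\<one> \<notin> \<mm>"
  using maximalideal.I_notcarr[OF maximal] ideal_eq_carrier[OF ideal_mm] by blast

lemma exists_inverse:
  assumes "r \<in> carrier R" "r \<notin> \<mm>"
  shows "\<exists>s\<in>carrier R. s \<otimes> r = \<one>"
proof -
  have "PIdl r = carrier R"
    using proper_subset_mm[of "PIdl r"] assms cgenideal_self[of r] cgenideal_ideal by blast
  then show ?thesis by (metis PIdlE one_closed)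
qed

text \<open>Let \<open>K\<close> be maximal among the ideals that contain \<open>B\<close> but not
  \<open>A\<close>. If \<open>t r\<close> were outside \<open>K\<close> for some \<open>t\<close> in
  \<open>\<mm>\<close> and \<open>r\<close> in \<open>A\<close>, maximality would give
  \<open>r = k + s t r\<close> with \<open>k\<close> in \<open>K\<close>; as \<open>1 - s t\<close>
  is a unit, \<open>r\<close> would lie in \<open>K\<close>. So
  \<open>\<mm> A \<subseteq> K\<close>, and the hypothesis forces
  \<open>A \<subseteq> K\<close>.\<close>

lemma nakayama:
  assumes A: "ideal A R" and B: "ideal B R" and sub: "A \<subseteq> (\<mm> \<cdot> A) <+> B"
  shows "A \<subseteq> B"
proof (rule ccontr)
  assume nsub: "\<not> A \<subseteq> B"
  let ?S = "{K. ideal K R \<and> B \<subseteq> K \<and> \<not> A \<subseteq> K}"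
  have ne: "?S \<noteq> {}" using B nsub by blast
  obtain K where K: "K \<in> ?S" "\<forall>L\<in>?S. K \<subseteq> L \<longrightarrow> L = K"
    using ideal_set_maximal[OF ne] by blast
  have Ki: "ideal K R" using K by blast
  have "\<mm> \<cdot> A \<subseteq> K"
  proof (rule ideal_prod_subset[OF Ki], rule ccontr)
    fix t r assume t: "t \<in> \<mm>" and r: "r \<in> A" and tr: "t \<otimes> r \<notin> K"
    have car: "t \<in> carrier R" "r \<in> carrier R"
      using ideal.Icarr[OF ideal_mm t] ideal.Icarr[OF A r] by auto
    let ?K = "K <+> PIdl (t \<otimes> r)"
    have P: "ideal (PIdl (t \<otimes> r)) R" using car by (simp add: cgenideal_ideal)
    have "t \<otimes> r \<in> ?K"
      using subset_addI2[OF Ki P] cgenideal_self[of "t \<otimes> r"] car by auto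
    moreover have "ideal ?K R" "K \<subseteq> ?K" using Ki P by (auto intro: add_ideals dest: subset_addI1[OF Ki])
    ultimately have "A \<subseteq> ?K" using K tr by blast
    then obtain k s where k: "k \<in> K" "s \<in> carrier R" "r = k \<oplus> s \<otimes> (t \<otimes> r)"
      using r by (metis PIdlE set_addE subsetD)
    have kc: "k \<in> carrier R" using ideal.Icarr[OF Ki k(1)] .
    have "(\<one> \<ominus> s \<otimes> t) \<otimes> r = r \<ominus> s \<otimes> (t \<otimes> r)" using car k(2) by algebra
    also have "\<dots> = k \<oplus> s \<otimes> (t \<otimes> r) \<ominus> s \<otimes> (t \<otimes> r)" using k(3) by simp
    also have "\<dots> = k" using car k(2) kc by algebra
    finally have eq: "(\<one> \<ominus> s \<otimes> t) \<otimes> r = k" .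
    have "\<one> \<ominus> s \<otimes> t \<notin> \<mm>"
    proof
      assume "\<one> \<ominus> s \<otimes> t \<in> \<mm>"
      then have "\<one> \<ominus> s \<otimes> t \<oplus> s \<otimes> t \<in> \<mm>"
        using ideal_mm ideal.I_l_closed[OF ideal_mm t k(2)] by (intro ideal_add_closed)
      moreover have "\<one> \<ominus> s \<otimes> t \<oplus> s \<otimes> t = \<one>" using car k(2) by algebra
      ultimately show False using one_notin_mm by simp
    qed
    then obtain u where u: "u \<in> carrier R" "u \<otimes> (\<one> \<ominus> s \<otimes> t) = \<one>"
      using exists_inverse[of "\<one> \<ominus> s \<otimes> t"] car k(2) by auto
    have "r = u \<otimes> (\<one> \<ominus> s \<otimes> t) \<otimes> r" using u car by simp
    also have "\<dots> = u \<otimes> k" using u(1) car k(2) by (simp add: m_assoc flip: eq)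
    also have "\<dots> \<in> K" using ideal.I_l_closed[OF Ki k(1) u(1)] .
    finally show False using tr ideal.I_l_closed[OF Ki _ car(1)] by blast
  qed
  then have "(\<mm> \<cdot> A) <+> B \<subseteq> K" using K Ki by (intro add_subset) auto
  then show False using sub K by blast
qed

lemma ilen_mm: "ilen \<mm> (carrier R) = 1"
proof (rule antisym)
  have "n = 0 \<and> A = \<mm> \<or> n = 1 \<and> A = carrier R" if "ideal_chain n C A" "C = \<mm>" for n C A
    using that
  proof (induction rule: ideal_chain.induct)
    case (step n C B A)
    then show ?case
      using maximalideal.I_maximal[OF maximal, of A] ideal_subset[of A] by auto
  qed auto
  then show "ilen \<mm> (carrier R) \<le> 1" by (intro ilen_le) (fastforce simp: one_enat_def)
  show "1 \<le> ilen \<mm> (carrier R)"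
    using ideal_mm maximalideal.I_notcarr[OF maximal] ideal_subset[OF ideal_mm]
    by (intro ilen_ge_1 oneideal) auto
qed

lemma ilen_generators_mm_le:
  assumes "finite G" "G \<subseteq> carrier R" "ideal B R" "\<And>g t. g \<in> G \<Longrightarrow> t \<in> \<mm> \<Longrightarrow> t \<otimes> g \<in> B"
  shows "ilen B (B <+> Idl G) \<le> enat (card G)"
  using ilen_generators_le[OF assms(1-3) ideal_mm] assms ideal_subset[OF ideal_mm]
  by (auto simp: ilen_mm colon_def of_nat_eq_enat)

lemma ilen_finite_of_mm_prod:
  assumes "ideal A R" "ideal B R" "B \<subseteq> A" "\<mm> \<cdot> A \<subseteq> B"
  shows "ilen B A \<noteq> \<infinity>"
proof -
  obtain G where G: "G \<subseteq> carrier R" "finite G" "A = Idl G" using finetely_gen[OF assms(1)] by blast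
  have "t \<otimes> g \<in> B" if "g \<in> G" "t \<in> \<mm>" for g t
    using assms(4) that G genideal_self[OF G(1)] by (auto intro: ideal_prod.prod)
  then have "ilen B (B <+> Idl G) \<le> enat (card G)"
    using G assms by (intro ilen_generators_mm_le) auto
  moreover have "B <+> Idl G = A" using assms G ideal_add_absorb[of A B] ideal_add_comm[of A B] by simp
  ultimately show ?thesis using enat_le_not_infinity by (metis enat.distinct(2))
qed

text \<open>Expressed by powers of \<open>\<mm>\<close> because this form passes directly to powers
  and products; that \<open>R/X\<close> then has finite length is
  \<open>ilen_finite_colength\<close>.\<close>

definition finite_colength :: "'a set \<Rightarrow> bool" where
  "finite_colength X \<longleftrightarrow> ideal X R \<and> (\<exists>k. ipow \<mm> k \<subseteq> X)"

lemma finite_colength_ideal: "finite_colength X \<Longrightarrow> ideal X R"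
  by (simp add: finite_colength_def)

lemma finite_colength_mono: "finite_colength X \<Longrightarrow> ideal Y R \<Longrightarrow> X \<subseteq> Y \<Longrightarrow> finite_colength Y"
  unfolding finite_colength_def by (meson order_trans)

lemma finite_colength_ipow: "finite_colength X \<Longrightarrow> finite_colength (ipow X n)"
  unfolding finite_colength_def using ipow_mult[OF ideal_mm] ipow_mono[of "ipow \<mm> _" X n] ideal_mm
  by (metis ideal_ipow)

lemma finite_colength_prod:
  assumes "finite_colength X" "finite_colength Y"
  shows "finite_colength (X \<cdot> Y)"
proof -
  obtain k l where "ipow \<mm> k \<subseteq> X" "ipow \<mm> l \<subseteq> Y" using assms by (auto simp: finite_colength_def)
  then have "ipow \<mm> (k + l) \<subseteq> X \<cdot> Y" by (simp add: ipow_add ideal_mm ideal_prod_mono)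
  then show ?thesis using assms by (auto simp: finite_colength_def intro: ideal_prod_is_ideal)
qed

text \<open>In the filtration by powers of \<open>\<mm>\<close> each quotient is finitely generated
  and annihilated by \<open>\<mm>\<close>, hence of finite length.\<close>

lemma ilen_finite_colength:
  assumes "finite_colength X"
  shows "ilen X (carrier R) \<noteq> \<infinity>"
proof -
  have fin: "ilen (ipow \<mm> k) (carrier R) \<noteq> \<infinity>" for k
  proof (induction k)
    case (Suc k)
    note ids = ideal_mm ideal_ipow[OF ideal_mm] oneideal
    have "ilen (ipow \<mm> (Suc k)) (carrier R)
        = ilen (ipow \<mm> (Suc k)) (ipow \<mm> k) + ilen (ipow \<mm> k) (carrier R)"
      using ids ideal_subset ipow_antimono[OF ideal_mm, of k "Suc k"] by (intro ilen_additive) auto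
    moreover have "ilen (ipow \<mm> (Suc k)) (ipow \<mm> k) \<noteq> \<infinity>"
      using ids ipow_antimono[OF ideal_mm, of k "Suc k"]
      by (intro ilen_finite_of_mm_prod) (simp_all add: ipow_Suc ideal_prod_is_ideal)
    ultimately show ?case using Suc by (simp add: plus_eq_infty_iff_enat)
  qed simp
  obtain k where k: "ipow \<mm> k \<subseteq> X" "ideal X R" using assms by (auto simp: finite_colength_def)
  then have "ilen X (carrier R) \<le> ilen (ipow \<mm> k) (carrier R)"
    using ideal_subset by (intro ilen_mono) (auto intro: oneideal ideal_ipow ideal_mm)
  then show ?thesis using fin[of k] by (rule enat_le_not_infinity)
qed

text \<open>A generator outside the ideal reached so far uses up at least one unit of length, so
  \<open>n\<close> of them suffice. For \<open>K = \<mm> \<cdot> A\<close> this replaces the choice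
  of a vector space basis.\<close>

lemma generators_of_interval:
  assumes "ideal A R" "ideal K R" "K \<subseteq> A" "ilen K A = enat n"
  shows "\<exists>S. finite S \<and> S \<subseteq> A \<and> card S \<le> n \<and> A = K <+> Idl S"
  using assms
proof (induction n arbitrary: K rule: less_induct)
  case (less n)
  show ?case
  proof (cases "K = A")
    case True
    then show ?thesis
      using less.prems ideal_zero by (intro exI[of _ "{}"]) (simp add: Idl_empty ideal_add_absorb zeroideal)
  next
    case False
    then obtain r where r: "r \<in> A" "r \<notin> K" using less.prems by blast
    have rc: "r \<in> carrier R" using ideal.Icarr[OF less.prems(1) r(1)] .
    let ?K = "K <+> PIdl r"
    have P: "ideal (PIdl r) R" using rc by (rule cgenideal_ideal)
    have K': "ideal ?K R" by (rule add_ideals[OF less.prems(2) P])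
    have K'1: "K \<subseteq> ?K" by (rule subset_addI1[OF less.prems(2) P])
    have K'2: "?K \<subseteq> A"
      by (rule add_subset[OF less.prems(1,3)]) (simp add: PIdl_subset_iff[OF rc less.prems(1)] r)
    have K'3: "r \<in> ?K"
      using subset_addI2[OF less.prems(2) P] cgenideal_self[OF rc] by blast
    have sum: "ilen K A = ilen K ?K + ilen ?K A"
      by (rule ilen_additive[OF less.prems(1) K' less.prems(2) K'1 K'2])
    have "1 \<le> ilen K ?K" using less.prems(2) K' K'1 K'3 r(2) by (intro ilen_ge_1) auto
    obtain p q where pq: "ilen K ?K = enat p" "ilen ?K A = enat q" "p + q = n"
    proof (cases "ilen K ?K"; cases "ilen ?K A")
      fix p q assume "ilen K ?K = enat p" "ilen ?K A = enat q"
      then show thesis using sum less.prems(4) that by simp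
    qed (use sum less.prems(4) in simp_all)
    then have "p \<ge> 1" using \<open>1 \<le> ilen K ?K\<close> by (simp add: one_enat_def)
    then obtain S where S: "finite S" "S \<subseteq> A" "card S \<le> q" "A = ?K <+> Idl S"
      using less.IH[OF _ less.prems(1) K' K'2 pq(2)] pq(3) by auto
    have Sc: "S \<subseteq> carrier R" using S(2) ideal_subset[OF less.prems(1)] by blast
    have "K <+> Idl (insert r S) = ?K <+> Idl S"
      using Idl_insert[OF rc Sc] ideal_add_assoc[OF less.prems(2) P genideal_ideal[OF Sc]] by simp
    moreover have "card (insert r S) \<le> n"
      using S(1,3) pq(3) \<open>p \<ge> 1\<close> card_insert_le_m1[of n S r] by (simp add: card_insert_if)
    ultimately show ?thesis using S r by (intro exI[of _ "insert r S"]) auto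
  qed
qed

lemma Idl_of_nakayama:
  assumes "ideal A R" "S \<subseteq> A" "A = (\<mm> \<cdot> A) <+> Idl S"
  shows "A = Idl S"
proof
  have Sc: "S \<subseteq> carrier R" using assms(2) ideal_subset[OF assms(1)] by blast
  show "A \<subseteq> Idl S" by (rule nakayama[OF assms(1) genideal_ideal[OF Sc] equalityD1[OF assms(3)]])
  show "Idl S \<subseteq> A" using Idl_subset_iff[OF Sc assms(1)] assms(2) by blast
qed

lemma ilen_mm_prod_le_card:
  assumes "finite G" "G \<subseteq> carrier R"
  shows "ilen (\<mm> \<cdot> (Idl G)) (Idl G) \<le> enat (card G)"
proof -
  let ?A = "Idl G"
  have A: "ideal ?A R" "ideal (\<mm> \<cdot> ?A) R" using assms by (auto intro!: ideal_closed ideal_mm)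
  have "(\<mm> \<cdot> ?A) <+> ?A = ?A"
    using A ideal_prod_subset2[OF ideal_mm A(1)] ideal_add_absorb ideal_add_comm by metis
  then show ?thesis
    using ilen_generators_mm_le[OF assms A(2)] genideal_self[OF assms(2)]
    by (metis ideal_prod.prod subsetD)
qed

text \<open>Nakayama lifts generators of \<open>A/\<mm>A\<close> to \<open>A\<close>; conversely
  generators of \<open>A\<close> span \<open>A/\<mm>A\<close>, whose length is therefore at most
  their number.\<close>

lemma min_gens_eq:
  assumes A: "ideal A R"
  shows "enat (min_gens R A) = ilen (\<mm> \<cdot> A) A"
proof -
  have mA: "ideal (\<mm> \<cdot> A) R" "\<mm> \<cdot> A \<subseteq> A"
    by (rule ideal_prod_is_ideal[OF ideal_mm A], rule ideal_prod_subset2[OF ideal_mm A])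
  then obtain n where n: "ilen (\<mm> \<cdot> A) A = enat n"
    using ilen_finite_of_mm_prod[OF A mA] by auto
  obtain S where S: "finite S" "S \<subseteq> A" "card S \<le> n" "A = (\<mm> \<cdot> A) <+> Idl S"
    using generators_of_interval[OF A mA n] by blast
  have AS: "A = Idl S" using Idl_of_nakayama[OF A S(2,4)] .
  have Sc: "S \<subseteq> carrier R" using S ideal_subset[OF A] by blast
  have ge: "n \<le> card T" if "finite T" "T \<subseteq> carrier R" "A = Idl T" for T
    using ilen_mm_prod_le_card[OF that(1,2)] n that(3) by simp
  have "card S = n" using ge[OF S(1) Sc AS] S(3) by simp
  have "min_gens R A = n"
    unfolding min_gens_def
  proof (rule Least_equality)
    show "\<exists>T\<subseteq>carrier R. finite T \<and> card T = n \<and> A = Idl T"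
      using S AS Sc \<open>card S = n\<close> by blast
    show "n \<le> m" if "\<exists>T\<subseteq>carrier R. finite T \<and> card T = m \<and> A = Idl T" for m
      using that ge by blast
  qed
  then show ?thesis using n by simp
qed

end

section \<open>Numerical polynomials\<close>

definition eventually_poly :: "(nat \<Rightarrow> rat) \<Rightarrow> bool" where
  "eventually_poly g \<longleftrightarrow> (\<exists>p. \<forall>\<^sub>F n in sequentially. g n = poly p (of_nat n))"

lemma poly_eqI_eventually:
  assumes "\<forall>\<^sub>F n in sequentially. poly p (of_nat n) = poly q (of_nat n :: rat)"
  shows "p = q"
proof (rule ccontr)
  assume "p \<noteq> q"
  then have "finite {x. poly (p - q) x = 0}" by (intro poly_roots_finite) simp
  moreover obtain N where "\<And>n. n \<ge> N \<Longrightarrow> poly p (of_nat n) = poly q (of_nat n :: rat)"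
    using assms by (auto simp: eventually_sequentially)
  then have "of_nat ` {N..} \<subseteq> {x. poly (p - q) x = 0}" by auto
  ultimately have "finite (of_nat ` {N..} :: rat set)" by (rule finite_subset[rotated])
  then have "finite {N..}" by (rule finite_imageD) (auto simp: inj_on_def)
  then show False using infinite_Ici by blast
qed

lemma eventual_poly_eqI:
  assumes "\<forall>\<^sub>F n in sequentially. of_nat (h n) = poly p (of_nat n)"
  shows "eventual_poly h = p"
  unfolding eventual_poly_def
proof (rule the_equality)
  show "\<forall>\<^sub>F n in sequentially. of_nat (h n) = poly p (of_nat n)" by (fact assms)
  fix q :: "rat poly" assume "\<forall>\<^sub>F n in sequentially. of_nat (h n) = poly q (of_nat n)"
  with assms have "\<forall>\<^sub>F n in sequentially. poly q (of_nat n) = poly p (of_nat n)"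
    by eventually_elim simp
  then show "q = p" by (rule poly_eqI_eventually)
qed

lemma eventual_poly_cong:
  assumes "\<forall>\<^sub>F n in sequentially. h n = k n"
  shows "eventual_poly h = eventual_poly k"
proof -
  have "(\<forall>\<^sub>F n in sequentially. of_nat (h n) = poly p (of_nat n :: rat)) \<longleftrightarrow>
    (\<forall>\<^sub>F n in sequentially. of_nat (k n) = poly p (of_nat n))" for p
    by (rule eventually_cong[OF assms]) simp
  then show ?thesis by (simp add: eventual_poly_def)
qed

text \<open>This is \<open>x(x+1)...(x+j-1)/j!\<close>, the binomial coefficient of
  \<open>x + j - 1\<close> over \<open>j\<close>. For \<open>j = d - i\<close> it is the basis
  element that belongs to the \<open>i\<close>-th Hilbert coefficient.\<close>

primrec binom_poly :: "nat \<Rightarrow> rat poly" where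
  "binom_poly 0 = 1"
| "binom_poly (Suc j) = Polynomial.smult (1 / of_nat (Suc j)) ([:of_nat j, 1:] * binom_poly j)"

lemma poly_binom_poly: "poly (binom_poly j) x = pochhammer x j / fact j"
proof (induction j)
  case (Suc j)
  have "poly (binom_poly (Suc j)) x = ((x + of_nat j) * poly (binom_poly j) x) / of_nat (Suc j)"
    by (simp add: algebra_simps add_divide_distrib)
  also have "\<dots> = pochhammer x (Suc j) / fact (Suc j)"
    unfolding Suc.IH pochhammer_Suc fact_Suc by (simp add: mult.commute)
  finally show ?case .
qed simp

lemma poly_binom_poly_gchoose: "poly (binom_poly j) x = (x + of_nat j - 1) gchoose j"
  by (simp add: poly_binom_poly gbinomial_pochhammer')

lemma poly_binom_poly_Suc: "poly (binom_poly j) (of_nat (Suc n)) = of_nat ((n + j) choose j)"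
proof -
  have "poly (binom_poly j) (of_nat (Suc n)) = (of_nat (n + j) gchoose j)"
    unfolding poly_binom_poly_gchoose by (rule arg_cong[where f = "\<lambda>x. x gchoose j"]) simp
  then show ?thesis by (simp only: binomial_gbinomial)
qed

text \<open>Pascal's rule as a backward difference. It lowers the index by one and drives the
  inductions on polynomials in this basis.\<close>

lemma poly_binom_poly_diff:
  "poly (binom_poly (Suc j)) x - poly (binom_poly (Suc j)) (x - 1) = poly (binom_poly j) x"
proof -
  have "pochhammer x (Suc j) - pochhammer (x - 1) (Suc j) = of_nat (Suc j) * pochhammer x j"
    by (subst (2) pochhammer_rec) (simp add: pochhammer_Suc algebra_simps)
  then show ?thesis
    unfolding poly_binom_poly diff_divide_distrib[symmetric] by (simp del: of_nat_Suc)
qed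

lemma poly_binom_poly_Ints: "poly (binom_poly j) (of_nat n) \<in> \<int>"
proof (cases n)
  case 0
  then show ?thesis by (cases j) (simp_all add: poly_binom_poly pochhammer_0_left)
next
  case (Suc m)
  then show ?thesis using poly_binom_poly_Suc[of j m] by simp
qed

lemma degree_binom_poly: "Polynomial.degree (binom_poly j) = j"
  and coeff_binom_poly: "Polynomial.coeff (binom_poly j) j = 1 / fact j"
proof -
  have "Polynomial.degree (binom_poly j) = j \<and> Polynomial.coeff (binom_poly j) j = 1 / fact j"
  proof (induction j)
    case (Suc j)
    then have nz: "binom_poly j \<noteq> 0" by auto
    have "Polynomial.degree ([:of_nat j, 1:] * binom_poly j) = Suc j"
      using Suc nz by (subst degree_mult_eq) auto
    moreover have "Polynomial.coeff ([:of_nat j, 1:] * binom_poly j) (Suc j) = 1 / fact j"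
      using Suc by (simp add: mult_pCons_left coeff_eq_0)
    ultimately show ?case by simp
  qed simp
  then show "Polynomial.degree (binom_poly j) = j"
    and "Polynomial.coeff (binom_poly j) j = 1 / fact j" by auto
qed

lemma coeff_binom_poly_less: "j < k \<Longrightarrow> Polynomial.coeff (binom_poly j) k = 0"
  by (rule coeff_eq_0) (simp add: degree_binom_poly)

lemma binom_poly_basis:
  "Polynomial.degree p \<le> k \<Longrightarrow> \<exists>c. p = (\<Sum>j\<le>k. Polynomial.smult (c j) (binom_poly j))"
proof (induction k arbitrary: p)
  case 0
  then obtain a where "p = [:a:]" by (metis degree_eq_zeroE le_zero_eq)
  then show ?case by (intro exI[of _ "\<lambda>_. a"]) simp
next
  case (Suc k)
  \<comment> \<open>The factorial inverts the leading coefficient of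
    \<open>binom_poly (Suc k)\<close>.\<close>
  define a where "a = Polynomial.coeff p (Suc k) * fact (Suc k)"
  let ?q = "p - Polynomial.smult a (binom_poly (Suc k))"
  have "Polynomial.degree ?q \<le> k"
  proof (rule degree_le, safe)
    fix i assume "k < i"
    then consider "i = Suc k" | "i > Suc k" by linarith
    then show "Polynomial.coeff ?q i = 0"
    proof cases
      case 1
      show ?thesis unfolding 1 coeff_diff coeff_smult coeff_binom_poly a_def by simp
    next
      case 2
      then have "Polynomial.coeff p i = 0" "Polynomial.coeff (binom_poly (Suc k)) i = 0"
        using Suc.prems by (auto intro: coeff_eq_0 coeff_binom_poly_less simp del: binom_poly.simps)
      then show ?thesis by (simp only: coeff_diff coeff_smult mult_zero_right diff_zero)
    qed
  qed
  from Suc.IH[OF this] obtain c where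
    c: "?q = (\<Sum>j\<le>k. Polynomial.smult (c j) (binom_poly j))" by blast
  have "p = ?q + Polynomial.smult a (binom_poly (Suc k))" by simp
  also have "\<dots> = (\<Sum>j\<le>Suc k. Polynomial.smult ((c(Suc k := a)) j) (binom_poly j))"
    unfolding c by (simp del: binom_poly.simps)
  finally show ?case by blast
qed

lemma sum_binom_poly_shift:
  "(\<Sum>j\<le>Suc k. c j * poly (binom_poly j) x)
     = c 0 + (\<Sum>j\<le>k. c (Suc j) * poly (binom_poly (Suc j)) x)"
  by (subst sum.atMost_Suc_shift) (simp del: binom_poly.simps(2))

lemma sum_binom_poly_diff:
  "(\<Sum>j\<le>Suc k. c j * poly (binom_poly j) x) - (\<Sum>j\<le>Suc k. c j * poly (binom_poly j) (x - 1))
     = (\<Sum>j\<le>k. c (Suc j) * poly (binom_poly j) x)"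
proof -
  have "(\<Sum>j\<le>Suc k. c j * poly (binom_poly j) x) - (\<Sum>j\<le>Suc k. c j * poly (binom_poly j) (x - 1))
      = (\<Sum>j\<le>Suc k. c j * (poly (binom_poly j) x - poly (binom_poly j) (x - 1)))"
    by (simp add: sum_subtractf right_diff_distrib del: binom_poly.simps sum.atMost_Suc)
  also have "\<dots> = (\<Sum>j\<le>k. c (Suc j) *
      (poly (binom_poly (Suc j)) x - poly (binom_poly (Suc j)) (x - 1)))"
    by (subst sum.atMost_Suc_shift) (simp del: binom_poly.simps(2))
  finally show ?thesis by (simp only: poly_binom_poly_diff)
qed

text \<open>Backward differences preserve integer values and shift the coefficients down by one, so
  induction reaches all but the constant coefficient; that one is then a difference of integers.
  This makes the Hilbert coefficients integers.\<close>

lemma binom_poly_coeffs_Ints: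
  assumes "\<And>n. n \<ge> N \<Longrightarrow> (\<Sum>j\<le>k. c j * poly (binom_poly j) (of_nat n)) \<in> \<int>" "j \<le> k"
  shows "c j \<in> \<int>"
  using assms
proof (induction k arbitrary: c j N)
  case 0
  then show ?case using 0(1)[of N] by simp
next
  case (Suc k)
  have step: "c (Suc i) \<in> \<int>" if "i \<le> k" for i
  proof (rule Suc.IH[of "Suc N" "\<lambda>j. c (Suc j)"])
    fix n assume "n \<ge> Suc N"
    then obtain m where m: "n = Suc m" "m \<ge> N" by (cases n) auto
    have nm: "(of_nat n :: rat) - 1 = of_nat m" using m by simp
    have eq: "(\<Sum>j\<le>k. c (Suc j) * poly (binom_poly j) (of_nat n))
        = (\<Sum>j\<le>Suc k. c j * poly (binom_poly j) (of_nat n))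
          - (\<Sum>j\<le>Suc k. c j * poly (binom_poly j) (of_nat m))"
      using sum_binom_poly_diff[where k = k and c = c and x = "of_nat n"] unfolding nm by (rule sym)
    show "(\<Sum>j\<le>k. c (Suc j) * poly (binom_poly j) (of_nat n)) \<in> \<int>"
      unfolding eq by (intro Ints_diff Suc.prems(1)) (use m in auto)
  qed (fact that)
  show ?case
  proof (cases j)
    case 0
    have "c 0 + (\<Sum>j\<le>k. c (Suc j) * poly (binom_poly (Suc j)) (of_nat N)) \<in> \<int>"
      using Suc.prems(1)[OF order_refl] unfolding sum_binom_poly_shift .
    moreover have "(\<Sum>j\<le>k. c (Suc j) * poly (binom_poly (Suc j)) (of_nat N)) \<in> \<int>"
      using step by (intro Ints_sum Ints_mult poly_binom_poly_Ints) auto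
    ultimately show ?thesis using Ints_diff 0 by fastforce
  next
    case (Suc i)
    then show ?thesis using step Suc.prems by simp
  qed
qed

lemma binom_poly_coeffs_unique:
  assumes "\<And>x. (\<Sum>j\<le>k. c j * poly (binom_poly j) x) = 0" "j \<le> k"
  shows "c j = 0"
  using assms
proof (induction k arbitrary: c j)
  case (Suc k)
  have step: "c (Suc i) = 0" if "i \<le> k" for i
    using Suc.IH[of "\<lambda>j. c (Suc j)" i] that sum_binom_poly_diff[where k = k and c = c] Suc.prems(1) by simp
  show ?case
  proof (cases j)
    case 0
    have "c 0 + (\<Sum>j\<le>k. c (Suc j) * poly (binom_poly (Suc j)) 0) = 0"
      using Suc.prems(1)[of 0] unfolding sum_binom_poly_shift .
    then show ?thesis using 0 step by simp
  qed (use step Suc.prems in simp)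
qed simp

section \<open>Functions that are eventually polynomial\<close>

lemma eventually_poly_const: "eventually_poly (\<lambda>_. c)"
  unfolding eventually_poly_def by (intro exI[of _ "[:c:]"]) simp

lemma eventually_poly_add:
  assumes "eventually_poly f" "eventually_poly g"
  shows "eventually_poly (\<lambda>n. f n + g n)"
proof -
  obtain p q where "\<forall>\<^sub>F n in sequentially. f n = poly p (of_nat n)"
    "\<forall>\<^sub>F n in sequentially. g n = poly q (of_nat n)"
    using assms by (auto simp: eventually_poly_def)
  then have "\<forall>\<^sub>F n in sequentially. f n + g n = poly (p + q) (of_nat n)"
    by eventually_elim simp
  then show ?thesis unfolding eventually_poly_def by (rule exI[of _ "p + q"])
qed

lemma eventually_poly_sum:
  "finite A \<Longrightarrow> (\<And>a. a \<in> A \<Longrightarrow> eventually_poly (f a)) \<Longrightarrow> eventually_poly (\<lambda>n. \<Sum>a\<in>A. f a n)"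
  by (induction rule: finite_induct) (auto intro: eventually_poly_const eventually_poly_add)

lemma eventually_poly_shift:
  assumes "eventually_poly f" shows "eventually_poly (\<lambda>n. f (n - k))"
proof -
  obtain p N where p: "\<And>n. n \<ge> N \<Longrightarrow> f n = poly p (of_nat n)"
    using assms by (auto simp: eventually_poly_def eventually_sequentially)
  have "f (n - k) = poly (pcompose p [:- of_nat k, 1:]) (of_nat n)" if "n \<ge> N + k" for n
    using p[of "n - k"] that by (simp add: poly_pcompose of_nat_diff)
  then show ?thesis unfolding eventually_poly_def eventually_sequentially by blast
qed

lemma eventually_poly_cong:
  assumes "eventually_poly f" "\<And>n. n \<ge> N \<Longrightarrow> f n = g n" shows "eventually_poly g"
proof -
  obtain p M where p: "\<And>n. n \<ge> M \<Longrightarrow> f n = poly p (of_nat n)"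
    using assms(1) by (auto simp: eventually_poly_def eventually_sequentially)
  have "g n = poly p (of_nat n)" if "n \<ge> max M N" for n
    using p[of n] assms(2)[of n] that by simp
  then show ?thesis unfolding eventually_poly_def eventually_sequentially by blast
qed

text \<open>In the binomial basis, summation raises each index by one.\<close>

lemma exists_antidifference:
  "\<exists>P :: rat poly. \<forall>x. poly P x - poly P (x - 1) = poly p x"
proof -
  obtain k c where c: "p = (\<Sum>j\<le>k. Polynomial.smult (c j) (binom_poly j))"
    using binom_poly_basis[OF order_refl] by blast
  let ?P = "\<Sum>j\<le>k. Polynomial.smult (c j) (binom_poly (Suc j))"
  have "poly ?P x - poly ?P (x - 1) = poly p x" for x
  proof -
    have "poly ?P x - poly ?P (x - 1) = (\<Sum>j\<le>k. c j *
        (poly (binom_poly (Suc j)) x - poly (binom_poly (Suc j)) (x - 1)))"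
      by (simp add: poly_sum sum_subtractf right_diff_distrib del: binom_poly.simps)
    also have "\<dots> = poly p x"
      unfolding c by (simp only: poly_binom_poly_diff poly_sum poly_smult)
    finally show ?thesis .
  qed
  then show ?thesis by blast
qed

lemma eventually_poly_cumulative:
  assumes "eventually_poly f" shows "eventually_poly (\<lambda>n. \<Sum>k\<le>n. f k)"
proof -
  obtain p N where p: "\<And>n. n \<ge> N \<Longrightarrow> f n = poly p (of_nat n)"
    using assms by (auto simp: eventually_poly_def eventually_sequentially)
  obtain P :: "rat poly" where P: "\<And>x. poly P x - poly P (x - 1) = poly p x"
    using exists_antidifference[of p] by blast
  \<comment> \<open>The constant adjusts the antidifference to the partial sum at \<open>N\<close>;
    from there on both sides satisfy the same recurrence.\<close>
  let ?c = "(\<Sum>k\<le>N. f k) - poly P (of_nat N)"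
  have "(\<Sum>k\<le>n. f k) = poly ([:?c:] + P) (of_nat n)" if "n \<ge> N" for n
    using that
  proof (induction n rule: dec_induct)
    case (step n)
    then show ?case using p[of "Suc n"] P[of "of_nat (Suc n)"] by simp
  qed simp
  then show ?thesis unfolding eventually_poly_def eventually_sequentially by blast
qed

text \<open>For \<open>x \<ge> 1\<close> all lower powers are at most \<open>x ^ (k - 1)\<close>.
  For \<open>k = 0\<close> there are none, so the truncated exponent does no harm.\<close>

lemma poly_le_coeff_sum:
  fixes p :: "rat poly"
  assumes "Polynomial.degree p \<le> k" "x \<ge> 1"
  shows "poly p x \<le> Polynomial.coeff p k * x ^ k + (\<Sum>i<k. \<bar>Polynomial.coeff p i\<bar>) * x ^ (k - 1)"
proof -
  have "poly p x = (\<Sum>i\<le>k. Polynomial.coeff p i * x ^ i)"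
    using assms(1) by (subst poly_altdef) (auto intro!: sum.mono_neutral_left le_degree)
  also have "\<dots> = Polynomial.coeff p k * x ^ k + (\<Sum>i<k. Polynomial.coeff p i * x ^ i)"
    by (simp add: lessThan_Suc_atMost[symmetric])
  also have "(\<Sum>i<k. Polynomial.coeff p i * x ^ i) \<le> (\<Sum>i<k. \<bar>Polynomial.coeff p i\<bar> * x ^ (k - 1))"
  proof (rule sum_mono)
    fix i assume "i \<in> {..<k}"
    then have "x ^ i \<le> x ^ (k - 1)" using assms(2) by (intro power_increasing) auto
    moreover have "x ^ i \<ge> 0" using assms(2) by simp
    ultimately show "Polynomial.coeff p i * x ^ i \<le> \<bar>Polynomial.coeff p i\<bar> * x ^ (k - 1)"
      by (intro mult_mono) auto
  qed
  finally show ?thesis by (simp add: sum_distrib_right)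
qed

text \<open>A negative coefficient at \<open>k\<close> would outweigh the lower terms as soon as the
  argument exceeds \<open>C\<close> divided by its absolute value. Letting \<open>k\<close> exceed
  the degree permits comparing polynomials whose top terms may cancel.\<close>

lemma coeff_nonneg_of_eventually_nonneg:
  fixes p :: "rat poly"
  assumes "Polynomial.degree p \<le> k" "\<forall>\<^sub>F n in sequentially. poly p (of_nat n) \<ge> 0"
  shows "Polynomial.coeff p k \<ge> 0"
proof (rule ccontr)
  assume "\<not> ?thesis"
  then have neg: "Polynomial.coeff p k < 0" by simp
  define C where "C = (\<Sum>i<k. \<bar>Polynomial.coeff p i\<bar>)"
  obtain N where N: "\<And>n. n \<ge> N \<Longrightarrow> poly p (of_nat n) \<ge> 0"
    using assms(2) by (auto simp: eventually_sequentially)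
  obtain m :: nat where m: "of_nat m > C / - Polynomial.coeff p k"
    using reals_Archimedean2 by blast
  define n where "n = max m (max N 1)"
  have n: "n \<ge> 1" "n \<ge> N" "n \<ge> m" by (auto simp: n_def)
  have "of_nat n > C / - Polynomial.coeff p k"
    using m n(3) by (meson less_le_trans of_nat_le_iff)
  then have lt: "Polynomial.coeff p k * of_nat n + C < 0"
    using neg by (simp add: field_simps)
  have le: "poly p (of_nat n) \<le> Polynomial.coeff p k * of_nat n ^ k + C * of_nat n ^ (k - 1)"
    using poly_le_coeff_sum[OF assms(1), of "of_nat n"] n by (simp add: C_def)
  have "poly p (of_nat n) < 0"
  proof (cases k)
    case 0
    then show ?thesis using le neg by (simp add: C_def)
  next
    case (Suc l)
    have "Polynomial.coeff p k * of_nat n ^ k + C * of_nat n ^ (k - 1)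
        = (Polynomial.coeff p k * of_nat n + C) * of_nat n ^ l"
      using Suc by (simp add: algebra_simps)
    also have "\<dots> < 0" using lt n(1) by (intro mult_neg_pos) auto
    finally show ?thesis using le by simp
  qed
  then show False using N[OF n(2)] by simp
qed

text \<open>If \<open>p\<close> had larger degree than \<open>k\<close>, its leading coefficient
  would be nonnegative by the first assumption and nonpositive by the second, where
  \<open>q - p\<close> has its negative at the same degree.\<close>

lemma degree_le_of_eventually_le:
  fixes p :: "rat poly"
  assumes "\<forall>\<^sub>F n in sequentially. poly p (of_nat n) \<ge> 0"
    and "\<forall>\<^sub>F n in sequentially. poly p (of_nat n) \<le> poly q (of_nat n)" "Polynomial.degree q \<le> k"
  shows "Polynomial.degree p \<le> k"
proof (rule ccontr)
  assume "\<not> ?thesis"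
  then have less: "k < Polynomial.degree p" by simp
  let ?D = "Polynomial.degree p"
  have "Polynomial.coeff p ?D \<ge> 0"
    using assms(1) by (intro coeff_nonneg_of_eventually_nonneg) auto
  moreover have "\<forall>\<^sub>F n in sequentially. poly (q - p) (of_nat n) \<ge> 0"
    using assms(2) by eventually_elim simp
  then have "Polynomial.coeff (q - p) ?D \<ge> 0"
    using assms(3) less by (intro coeff_nonneg_of_eventually_nonneg degree_diff_le) auto
  then have "Polynomial.coeff p ?D \<le> 0"
    using assms(3) less by (simp add: coeff_eq_0)
  ultimately have "Polynomial.coeff p ?D = 0" by simp
  then show False using less by simp
qed

section \<open>Multi-indices\<close>

text \<open>Exponents are functions on all of \<open>nat\<close>; vanishing from \<open>s\<close> on
  makes them unique, so that cardinalities count monomials.\<close>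

definition multi_indices :: "nat \<Rightarrow> nat \<Rightarrow> (nat \<Rightarrow> nat) set" where
  "multi_indices s n = {\<alpha>. (\<forall>i\<ge>s. \<alpha> i = 0) \<and> (\<Sum>i<s. \<alpha> i) = n}"

lemma multi_indices_0: "multi_indices 0 n = (if n = 0 then {\<lambda>_. 0} else {})"
  by (auto simp: multi_indices_def)

lemma multi_indices_Suc:
  "multi_indices (Suc s) n = (\<Union>k\<le>n. (\<lambda>\<alpha>. \<alpha>(s := k)) ` multi_indices s (n - k))"
proof (intro Set.set_eqI iffI)
  fix \<alpha> assume \<alpha>: "\<alpha> \<in> multi_indices (Suc s) n"
  then have "\<alpha>(s := 0) \<in> multi_indices s (n - \<alpha> s)" "\<alpha> s \<le> n"
    by (auto simp: multi_indices_def)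
  moreover have "\<alpha> = (\<alpha>(s := 0))(s := \<alpha> s)" by simp
  ultimately show "\<alpha> \<in> (\<Union>k\<le>n. (\<lambda>\<alpha>. \<alpha>(s := k)) ` multi_indices s (n - k))"
    by (metis (no_types, lifting) UN_I atMost_iff imageI)
qed (auto simp: multi_indices_def)

lemma finite_multi_indices: "finite (multi_indices s n)"
  by (induction s arbitrary: n) (auto simp: multi_indices_0 multi_indices_Suc)

lemma sum_multi_indices_Suc:
  "(\<Sum>\<alpha>\<in>multi_indices (Suc s) n. f \<alpha>) = (\<Sum>k\<le>n. \<Sum>\<alpha>\<in>multi_indices s (n - k). f (\<alpha>(s := k)))"
proof -
  have inj: "inj_on (\<lambda>\<alpha>. \<alpha>(s := k)) (multi_indices s m)" for k m
  proof (rule inj_onI)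
    fix \<alpha> \<beta> :: "nat \<Rightarrow> nat" assume *: "\<alpha> \<in> multi_indices s m" "\<beta> \<in> multi_indices s m" "\<alpha>(s := k) = \<beta>(s := k)"
    have "\<alpha> i = \<beta> i" for i
    proof (cases "i = s")
      case False
      then show ?thesis using fun_cong[OF *(3), of i] by simp
    qed (use *(1,2) in \<open>simp add: multi_indices_def\<close>)
    then show "\<alpha> = \<beta>" by blast
  qed
  have "(\<Sum>\<alpha>\<in>multi_indices (Suc s) n. f \<alpha>)
      = (\<Sum>k\<le>n. \<Sum>\<alpha>\<in>(\<lambda>\<alpha>. \<alpha>(s := k)) ` multi_indices s (n - k). f \<alpha>)"
    unfolding multi_indices_Suc
    by (rule sum.UNION_disjoint) (auto simp: finite_multi_indices dest: fun_cong[where x = s])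
  also have "\<dots> = (\<Sum>k\<le>n. \<Sum>\<alpha>\<in>multi_indices s (n - k). f (\<alpha>(s := k)))"
    by (simp add: sum.reindex[OF inj])
  finally show ?thesis .
qed

lemma card_multi_indices_Suc: "card (multi_indices (Suc s) n) = (\<Sum>k\<le>n. card (multi_indices s k))"
proof -
  have "card (multi_indices (Suc s) n) = (\<Sum>k\<le>n. card (multi_indices s (n - k)))"
    using sum_multi_indices_Suc[of "\<lambda>_. 1 :: nat" s n] by simp
  also have "\<dots> = (\<Sum>k\<le>n. card (multi_indices s k))"
    by (rule sum.reindex_bij_witness[of _ "\<lambda>k. n - k" "\<lambda>k. n - k"]) auto
  finally show ?thesis .
qed

lemma card_multi_indices: "card (multi_indices (Suc s) n) = (n + s) choose s"
proof (induction s arbitrary: n)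
  case 0
  have "card (multi_indices (Suc 0) n) = (\<Sum>k\<le>n. if k = 0 then 1 else 0)"
    unfolding card_multi_indices_Suc by (intro sum.cong) (auto simp: multi_indices_0)
  then show ?case by simp
next
  case (Suc s)
  show ?case
    using choose_rising_sum(1)[of s n] by (simp add: card_multi_indices_Suc[of "Suc s"] Suc add.commute)
qed

lemma of_nat_card_multi_indices:
  "of_nat (card (multi_indices (Suc s) n)) = poly (binom_poly s) (of_nat n + 1)"
  using poly_binom_poly_Suc[of s n] by (simp add: card_multi_indices add.commute del: binom_poly.simps)

text \<open>Monomials of degree below \<open>n\<close> in \<open>s\<close> variables become
  monomials of degree \<open>n - 1\<close> with one variable more. At \<open>n = 0\<close> and
  \<open>s = 0\<close> the two sides would be 0 and 1.\<close>

lemma sum_card_multi_indices: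
  assumes "n \<ge> 1"
  shows "of_nat (\<Sum>k<n. card (multi_indices s k)) = poly (binom_poly s) (of_nat n)"
proof -
  obtain m where "n = Suc m" using assms by (cases n) auto
  then show ?thesis
    using card_multi_indices_Suc[of s m] of_nat_card_multi_indices[of s m]
    by (simp add: lessThan_Suc_atMost add.commute del: binom_poly.simps)
qed

lemma bounded_multi_indices:
  assumes "k < n" shows "{\<alpha> \<in> multi_indices s k. \<forall>i<s. \<alpha> i < n} = multi_indices s k"
proof -
  have "\<alpha> i < n" if h: "\<alpha> \<in> multi_indices s k" "i < s" for \<alpha> i
  proof -
    have "\<alpha> i \<le> (\<Sum>i<s. \<alpha> i)" using h(2) by (intro member_le_sum) auto
    then show ?thesis using h(1) assms by (simp add: multi_indices_def)
  qed
  then show ?thesis by blast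
qed

text \<open>The box of exponents below \<open>n\<close> is cut into slices by total degree, which
  never exceeds \<open>s * n\<close>.\<close>

lemma sum_card_bounded_multi_indices:
  "(\<Sum>k\<le>s * n. card {\<alpha> \<in> multi_indices s k. \<forall>i<s. \<alpha> i < n}) = n ^ s"
proof -
  define Q where "Q s = {\<alpha>. (\<forall>i\<ge>s. \<alpha> i = 0) \<and> (\<forall>i<s. \<alpha> i < n)}" for s :: nat
  have Q: "finite (Q s) \<and> card (Q s) = n ^ s" for s :: nat
  proof (induction s)
    case 0
    have "Q 0 = {\<lambda>_. 0}" by (auto simp: Q_def)
    then show ?case by simp
  next
    case (Suc s)
    have b: "bij_betw (\<lambda>(\<alpha>, k). \<alpha>(s := k)) (Q s \<times> {..<n}) (Q (Suc s))"
      by (rule bij_betw_byWitness[where f' = "\<lambda>\<alpha>. (\<alpha>(s := 0), \<alpha> s)"])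
         (auto simp: Q_def less_Suc_eq fun_eq_iff)
    show ?case
      using Suc bij_betw_finite[OF b] bij_betw_same_card[OF b]
      by (simp add: card_cartesian_product finite_cartesian_product mult.commute)
  qed
  have "Q s = (\<Union>k\<le>s * n. {\<alpha> \<in> multi_indices s k. \<forall>i<s. \<alpha> i < n})"
  proof (intro Set.set_eqI iffI)
    fix \<alpha> assume \<alpha>: "\<alpha> \<in> Q s"
    have "(\<Sum>i<s. \<alpha> i) \<le> (\<Sum>i<s. n)" using \<alpha> by (intro sum_mono) (auto simp: Q_def intro: less_imp_le)
    then show "\<alpha> \<in> (\<Union>k\<le>s * n. {\<alpha> \<in> multi_indices s k. \<forall>i<s. \<alpha> i < n})"
      using \<alpha> by (auto simp: Q_def multi_indices_def)
  qed (auto simp: Q_def multi_indices_def)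
  moreover have "card (\<Union>k\<le>s * n. {\<alpha> \<in> multi_indices s k. \<forall>i<s. \<alpha> i < n})
      = (\<Sum>k\<le>s * n. card {\<alpha> \<in> multi_indices s k. \<forall>i<s. \<alpha> i < n})"
    by (rule card_UN_disjoint) (auto simp: finite_multi_indices, auto simp: multi_indices_def)
  ultimately show ?thesis using Q[of s] by simp
qed

text \<open>\<open>S\<close> is the set of free coordinates and \<open>\<rho>\<close> fixes the
  others. Let \<open>\<alpha>0\<close> minimize \<open>f\<close>. Above \<open>\<alpha>0\<close> the
  function is constant; anywhere else some coordinate \<open>i\<close> takes one of the finitely
  many values below \<open>\<alpha>0 i\<close>, and fixing it leaves fewer free coordinates.\<close>

lemma antitone_truncation:
  fixes f :: "(nat \<Rightarrow> nat) \<Rightarrow> nat"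
  assumes anti: "\<And>\<alpha> \<beta>. \<alpha> \<le> \<beta> \<Longrightarrow> f \<beta> \<le> f \<alpha>" and "finite S"
  shows "\<exists>N. \<forall>\<alpha>. (\<forall>i. i \<notin> S \<longrightarrow> \<alpha> i = \<rho> i) \<longrightarrow>
           f (\<lambda>i. if i \<in> S then min (\<alpha> i) N else \<alpha> i) = f \<alpha>"
  using assms(2)
proof (induction S arbitrary: \<rho> rule: finite_psubset_induct)
  case (psubset S)
  let ?tr = "\<lambda>S N \<alpha> i. if i \<in> S then min (\<alpha> i) N else \<alpha> i :: nat"
  have "\<exists>\<alpha>0. (\<forall>i. i \<notin> S \<longrightarrow> \<alpha>0 i = \<rho> i) \<and>
      (\<forall>\<alpha>. (\<forall>i. i \<notin> S \<longrightarrow> \<alpha> i = \<rho> i) \<longrightarrow> f \<alpha>0 \<le> f \<alpha>)"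
    by (rule ex_has_least_nat[of _ \<rho>]) simp
  then obtain \<alpha>0 where \<alpha>0: "\<forall>i. i \<notin> S \<longrightarrow> \<alpha>0 i = \<rho> i"
    "\<And>\<alpha>. (\<forall>i. i \<notin> S \<longrightarrow> \<alpha> i = \<rho> i) \<Longrightarrow> f \<alpha>0 \<le> f \<alpha>" by metis
  have "\<forall>i c. \<exists>N. i \<in> S \<longrightarrow> (\<forall>\<alpha>. (\<forall>j. j \<notin> S - {i} \<longrightarrow> \<alpha> j = (\<rho>(i := c)) j) \<longrightarrow>
      f (?tr (S - {i}) N \<alpha>) = f \<alpha>)"
  proof (intro allI)
    fix i c
    show "\<exists>N. i \<in> S \<longrightarrow> (\<forall>\<alpha>. (\<forall>j. j \<notin> S - {i} \<longrightarrow> \<alpha> j = (\<rho>(i := c)) j) \<longrightarrow>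
        f (?tr (S - {i}) N \<alpha>) = f \<alpha>)"
    proof (cases "i \<in> S")
      case True
      then have "S - {i} \<subset> S" by blast
      from psubset.IH[OF this, of "\<rho>(i := c)"] show ?thesis by blast
    qed simp
  qed
  then obtain M where M: "\<And>i c \<alpha>. i \<in> S \<Longrightarrow> (\<forall>j. j \<notin> S - {i} \<longrightarrow> \<alpha> j = (\<rho>(i := c)) j) \<Longrightarrow>
      f (?tr (S - {i}) (M i c) \<alpha>) = f \<alpha>" by metis
  \<comment> \<open>Large enough for \<open>\<alpha>0\<close> and for every bound
    \<open>M i c\<close> that arises from fixing coordinate \<open>i\<close> at some
    \<open>c < \<alpha>0 i\<close>.\<close>
  define N where "N = (\<Sum>i\<in>S. \<alpha>0 i + (\<Sum>c<\<alpha>0 i. M i c))"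
  have N1: "\<alpha>0 i + (\<Sum>c<\<alpha>0 i. M i c) \<le> N" if "i \<in> S" for i
    unfolding N_def using psubset.hyps that by (intro member_le_sum) auto
  have N: "\<alpha>0 i \<le> N" if "i \<in> S" for i using N1[OF that] by simp
  have N2: "M i c \<le> N" if "i \<in> S" "c < \<alpha>0 i" for i c
  proof -
    have "M i c \<le> (\<Sum>c<\<alpha>0 i. M i c)" using that by (intro member_le_sum) auto
    then show ?thesis using N1[OF that(1)] by simp
  qed
  show ?case
  proof (intro exI[of _ N] allI impI)
    fix \<alpha> assume \<alpha>: "\<forall>i. i \<notin> S \<longrightarrow> \<alpha> i = \<rho> i"
    show "f (?tr S N \<alpha>) = f \<alpha>"
    proof (cases "\<alpha>0 \<le> \<alpha>")
      case True
      have "\<alpha>0 \<le> ?tr S N \<alpha>"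
        using True N by (auto simp: le_fun_def)
      then have "f (?tr S N \<alpha>) = f \<alpha>0" "f \<alpha> = f \<alpha>0"
        using True anti \<alpha>0(2)[of \<alpha>] \<alpha>0(2)[of "?tr S N \<alpha>"] \<alpha> by (auto intro!: antisym)
      then show ?thesis by simp
    next
      case False
      then obtain i where "\<alpha> i < \<alpha>0 i" by (auto simp: le_fun_def not_le)
      then have i: "\<alpha> i < \<alpha>0 i" "i \<in> S" using \<alpha> \<alpha>0(1) by force+
      have *: "\<forall>j. j \<notin> S - {i} \<longrightarrow> \<alpha> j = (\<rho>(i := \<alpha> i)) j" using \<alpha> by auto
      have **: "\<forall>j. j \<notin> S - {i} \<longrightarrow> ?tr S N \<alpha> j = (\<rho>(i := \<alpha> i)) j"
        using \<alpha> N[OF i(2)] i by auto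
      \<comment> \<open>Cutting at \<open>N\<close> first changes nothing: coordinate
        \<open>i\<close> is below \<open>N\<close>, and the others are cut at the smaller
        \<open>M i (\<alpha> i)\<close> anyway.\<close>
      have "?tr (S - {i}) (M i (\<alpha> i)) (?tr S N \<alpha>) = ?tr (S - {i}) (M i (\<alpha> i)) \<alpha>"
        using N2[OF i(2,1)] N[OF i(2)] i by (auto simp: fun_eq_iff)
      then show ?thesis using M[OF i(2) *] M[OF i(2) **] by simp
    qed
  qed
qed

text \<open>Slice by the last exponent \<open>k\<close>. From some \<open>N\<close> on the slices no
  longer depend on \<open>k\<close>, so they add up to a cumulative sum of one eventually polynomial
  function; the finitely many slices below \<open>N\<close> are shifts of such functions.\<close>

lemma eventually_poly_sum_antitone:
  fixes f :: "(nat \<Rightarrow> nat) \<Rightarrow> nat"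
  assumes anti: "\<And>\<alpha> \<beta>. \<alpha> \<le> \<beta> \<Longrightarrow> f \<beta> \<le> f \<alpha>"
  shows "eventually_poly (\<lambda>n. \<Sum>\<alpha>\<in>multi_indices s n. of_nat (f \<alpha>))"
  using assms
proof (induction s arbitrary: f)
  case 0
  show ?case by (rule eventually_poly_cong[OF eventually_poly_const[of 0], of 1]) (simp add: multi_indices_0)
next
  case (Suc s)
  define T where "T k m = (\<Sum>\<alpha>\<in>multi_indices s m. of_nat (f (\<alpha>(s := k))) :: rat)" for k m
  have T: "eventually_poly (T k)" for k
    unfolding T_def using Suc.prems by (intro Suc.IH) (simp add: le_fun_def)
  obtain N where N: "\<And>\<alpha>. (\<forall>i. i \<notin> {..s} \<longrightarrow> \<alpha> i = 0) \<Longrightarrow>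
      f (\<lambda>i. if i \<in> {..s} then min (\<alpha> i) N else \<alpha> i) = f \<alpha>"
    using antitone_truncation[of f "{..s}" "\<lambda>_. 0"] Suc.prems by auto
  have T_eq: "T k = T N" if "k \<ge> N" for k
  proof (rule ext)
    fix m
    have "f (\<alpha>(s := k)) = f (\<alpha>(s := N))" if "\<alpha> \<in> multi_indices s m" for \<alpha>
    proof -
      have \<alpha>: "\<forall>i. i \<notin> {..s} \<longrightarrow> (\<alpha>(s := c)) i = 0" for c
        using that by (auto simp: multi_indices_def)
      have "(\<lambda>i. if i \<in> {..s} then min ((\<alpha>(s := k)) i) N else (\<alpha>(s := k)) i)
          = (\<lambda>i. if i \<in> {..s} then min ((\<alpha>(s := N)) i) N else (\<alpha>(s := N)) i)"
        using \<open>k \<ge> N\<close> by auto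
      then show ?thesis using N[OF \<alpha>[of k]] N[OF \<alpha>[of N]] by metis
    qed
    then show "T k m = T N m" unfolding T_def by (intro sum.cong) auto
  qed
  have "eventually_poly (\<lambda>n. (\<Sum>k<N. T k (n - k)) + (\<Sum>j\<le>n - N. T N j))"
    using T by (intro eventually_poly_add eventually_poly_sum eventually_poly_shift
        eventually_poly_shift[of "\<lambda>n. \<Sum>j\<le>n. T N j"] eventually_poly_cumulative) auto
  then show ?case
  proof (rule eventually_poly_cong[where N = N])
    fix n assume n: "n \<ge> N"
    have "(\<Sum>\<alpha>\<in>multi_indices (Suc s) n. of_nat (f \<alpha>)) = (\<Sum>k\<le>n. T k (n - k))"
      unfolding sum_multi_indices_Suc T_def ..
    also have "{..n} = {..<N} \<union> {N..n}" using n by auto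
    also have "(\<Sum>k\<in>{..<N} \<union> {N..n}. T k (n - k)) = (\<Sum>k<N. T k (n - k)) + (\<Sum>k=N..n. T k (n - k))"
      by (rule sum.union_disjoint) auto
    also have "(\<Sum>k=N..n. T k (n - k)) = (\<Sum>k=N..n. T N (n - k))"
      by (intro sum.cong HOL.refl) (metis T_eq atLeastAtMost_iff)
    also have "\<dots> = (\<Sum>j\<le>n - N. T N j)"
      by (rule sum.reindex_bij_witness[of _ "\<lambda>k. n - k" "\<lambda>k. n - k"]) (use n in auto)
    finally show "(\<Sum>k<N. T k (n - k)) + (\<Sum>j\<le>n - N. T N j) = (\<Sum>\<alpha>\<in>multi_indices (Suc s) n. of_nat (f \<alpha>))"
      by simp
  qed
qed

section \<open>Hilbert functions\<close>

primrec (in cring) power_prod :: "(nat \<Rightarrow> 'a) \<Rightarrow> nat \<Rightarrow> (nat \<Rightarrow> nat) \<Rightarrow> 'a" where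
  "power_prod a 0 \<alpha> = \<one>"
| "power_prod a (Suc s) \<alpha> = power_prod a s \<alpha> \<otimes> a s [^] \<alpha> s"

definition lex_less :: "nat \<Rightarrow> (nat \<Rightarrow> nat) \<Rightarrow> (nat \<Rightarrow> nat) \<Rightarrow> bool" where
  "lex_less s \<alpha> \<beta> \<longleftrightarrow> (\<exists>i<s. \<alpha> i < \<beta> i \<and> (\<forall>j<i. \<alpha> j = \<beta> j))"

lemma lex_less_irrefl: "\<not> lex_less s \<alpha> \<alpha>"
  by (auto simp: lex_less_def)

lemma lex_less_trans: "lex_less s \<alpha> \<beta> \<Longrightarrow> lex_less s \<beta> \<gamma> \<Longrightarrow> lex_less s \<alpha> \<gamma>"
  unfolding lex_less_def
proof (elim exE conjE)
  fix i j assume *: "i < s" "\<alpha> i < \<beta> i" "\<forall>j<i. \<alpha> j = \<beta> j" "j < s" "\<beta> j < \<gamma> j" "\<forall>i<j. \<beta> i = \<gamma> i"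
  show "\<exists>i<s. \<alpha> i < \<gamma> i \<and> (\<forall>j<i. \<alpha> j = \<gamma> j)"
    by (rule exI[of _ "min i j"]) (use * in \<open>cases i j rule: linorder_cases; simp add: min_def\<close>)
qed

lemma lex_less_total:
  assumes "\<alpha> \<in> multi_indices s n" "\<beta> \<in> multi_indices s n" "\<alpha> \<noteq> \<beta>"
  shows "lex_less s \<alpha> \<beta> \<or> lex_less s \<beta> \<alpha>"
proof -
  obtain k where "\<alpha> k \<noteq> \<beta> k" using assms(3) by auto
  then obtain i where i: "\<alpha> i \<noteq> \<beta> i" "\<forall>j<i. \<alpha> j = \<beta> j"
    using exists_least_iff[of "\<lambda>i. \<alpha> i \<noteq> \<beta> i"] by metis
  have "i < s" using i(1) assms(1,2) by (force simp: multi_indices_def not_less[symmetric])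
  then show ?thesis using i unfolding lex_less_def by (metis linorder_neqE_nat)
qed

lemma lex_less_cong:
  "(\<And>i. i < s \<Longrightarrow> \<alpha> i = \<alpha>' i) \<Longrightarrow> (\<And>i. i < s \<Longrightarrow> \<beta> i = \<beta>' i) \<Longrightarrow>
    lex_less s \<alpha> \<beta> \<longleftrightarrow> lex_less s \<alpha>' \<beta>'"
  unfolding lex_less_def by (rule ex_cong1) auto

lemma lex_less_add: "lex_less s \<alpha> \<beta> \<Longrightarrow> lex_less s (\<lambda>i. \<alpha> i + \<gamma> i) (\<lambda>i. \<beta> i + \<gamma> i)"
  unfolding lex_less_def by auto

context cring
begin

lemma power_prod_closed:
  "(\<And>i. i < s \<Longrightarrow> a i \<in> carrier R) \<Longrightarrow> power_prod a s \<alpha> \<in> carrier R"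
  by (induction s) auto

lemma power_prod_cong: "(\<And>i. i < s \<Longrightarrow> \<alpha> i = \<beta> i) \<Longrightarrow> power_prod a s \<alpha> = power_prod a s \<beta>"
  by (induction s) auto

lemma power_prod_zero: "power_prod a s (\<lambda>_. 0) = \<one>"
  by (induction s) auto

lemma power_prod_add:
  "(\<And>i. i < s \<Longrightarrow> a i \<in> carrier R) \<Longrightarrow>
    power_prod a s (\<lambda>i. \<alpha> i + \<beta> i) = power_prod a s \<alpha> \<otimes> power_prod a s \<beta>"
proof (induction s)
  case (Suc s)
  then have "power_prod a s \<alpha> \<in> carrier R" "power_prod a s \<beta> \<in> carrier R" "a s \<in> carrier R"
    by (auto intro: power_prod_closed)
  then show ?case using Suc by (simp add: nat_pow_mult[symmetric] m_ac)
qed simp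

lemma power_prod_unit:
  assumes "\<And>i. i < s \<Longrightarrow> a i \<in> carrier R" "i < s"
  shows "power_prod a s (\<lambda>j. if j = i then 1 else 0) = a i"
  using assms
proof (induction s)
  case (Suc s)
  show ?case
  proof (cases "i = s")
    case True
    have "power_prod a s (\<lambda>j. if j = i then 1 else 0) = power_prod a s (\<lambda>_. 0)"
      using True by (intro power_prod_cong) auto
    then show ?thesis using True Suc.prems by (simp add: power_prod_zero)
  qed (use Suc in auto)
qed simp

lemma power_prod_mult_gen:
  assumes "\<And>i. i < s \<Longrightarrow> a i \<in> carrier R" "i < s"
  shows "power_prod a s (\<alpha>(i := Suc (\<alpha> i))) = a i \<otimes> power_prod a s \<alpha>"
proof -
  have "power_prod a s (\<alpha>(i := Suc (\<alpha> i))) = power_prod a s (\<lambda>j. (if j = i then 1 else 0) + \<alpha> j)"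
    by (rule power_prod_cong) auto
  then show ?thesis using assms by (simp add: power_prod_add power_prod_unit)
qed

lemma pow_in_ipow: "ideal J R \<Longrightarrow> x \<in> J \<Longrightarrow> x [^] (n::nat) \<in> ipow J n"
proof (induction n)
  case (Suc n)
  then have "x \<otimes> x [^] n \<in> J \<cdot> ipow J n" by (intro ideal_prod.prod) auto
  moreover have "x \<in> carrier R" using Suc.prems by (rule ideal.Icarr)
  ultimately show ?case using Suc.prems by (simp add: ipow_Suc m_comm)
qed simp

lemma power_prod_in_ipow:
  "ideal J R \<Longrightarrow> (\<And>i. i < s \<Longrightarrow> a i \<in> J) \<Longrightarrow> power_prod a s \<alpha> \<in> ipow J (\<Sum>i<s. \<alpha> i)"
proof (induction s)
  case (Suc s)
  then have "power_prod a s \<alpha> \<otimes> a s [^] \<alpha> s \<in> ipow J (\<Sum>i<s. \<alpha> i) \<cdot> ipow J (\<alpha> s)"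
    by (intro ideal_prod.prod pow_in_ipow) auto
  then show ?case using Suc.prems by (simp add: ipow_add)
qed simp

lemma ipow_Idl:
  assumes a: "\<And>i. i < s \<Longrightarrow> a i \<in> carrier R"
  shows "ipow (Idl (a ` {..<s})) n = Idl (power_prod a s ` multi_indices s n)"
proof
  let ?J = "Idl (a ` {..<s})" and ?M = "\<lambda>n. power_prod a s ` multi_indices s n"
  have J: "ideal ?J R" and M: "\<And>n. ?M n \<subseteq> carrier R" and A: "a ` {..<s} \<subseteq> carrier R"
    using a by (auto intro!: genideal_ideal power_prod_closed)
  have aJ: "a i \<in> ?J" if "i < s" for i
    using genideal_self[OF A] that by blast
  show "Idl (?M n) \<subseteq> ipow ?J n"
    unfolding Idl_subset_iff[OF M ideal_ipow[OF J]]
  proof safe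
    fix \<alpha> assume "\<alpha> \<in> multi_indices s n"
    then show "power_prod a s \<alpha> \<in> ipow ?J n"
      using power_prod_in_ipow[OF J, of s a \<alpha>] aJ by (auto simp: multi_indices_def)
  qed
  show "ipow ?J n \<subseteq> Idl (?M n)"
  proof (induction n)
    case 0
    have "(\<lambda>_. 0) \<in> multi_indices s 0" by (simp add: multi_indices_def)
    then have "\<one> \<in> ?M 0" by (metis imageI power_prod_zero)
    then have "\<one> \<in> Idl (?M 0)" using genideal_self[OF M] by blast
    then show ?case using ideal_eq_carrier[OF genideal_ideal[OF M]] by simp
  next
    case (Suc n)
    have "ipow ?J (Suc n) \<subseteq> ?J \<cdot> (Idl (?M n))"
      using Suc J by (simp add: ipow_Suc ideal_prod_mono)
    also have "\<dots> \<subseteq> Idl (?M (Suc n))"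
    proof (rule prod_Idl_subset[OF A M genideal_ideal[OF M]])
      fix x y assume "x \<in> a ` {..<s}" "y \<in> ?M n"
      then obtain i \<alpha> where *: "i < s" "x = a i" "\<alpha> \<in> multi_indices s n" "y = power_prod a s \<alpha>"
        by auto
      have "\<alpha>(i := Suc (\<alpha> i)) \<in> multi_indices s (Suc n)"
      proof -
        have "(\<Sum>j<s. (\<alpha>(i := Suc (\<alpha> i))) j) = (\<Sum>j<s. \<alpha> j + (if j = i then 1 else 0))"
          by (rule sum.cong) auto
        also have "\<dots> = Suc n"
          using * by (simp add: sum.distrib multi_indices_def)
        finally show ?thesis using * by (auto simp: multi_indices_def)
      qed
      then have "x \<otimes> y \<in> ?M (Suc n)"
        using power_prod_mult_gen[where a = a and s = s and \<alpha> = \<alpha>, OF a *(1)] * by (metis imageI)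
      then show "x \<otimes> y \<in> Idl (?M (Suc n))" using genideal_self[OF M] by blast
    qed
    finally show ?case .
  qed
qed

lemma add_ipow_Idl:
  assumes "\<And>i. i < s \<Longrightarrow> a i \<in> carrier R" "ideal q R"
  defines "J \<equiv> Idl (a ` {..<s})"
  shows "(q \<cdot> ipow J n) <+> Idl (power_prod a s ` multi_indices s n) = ipow J n"
proof -
  have J: "ideal J R" unfolding J_def using assms(1) by (intro genideal_ideal) auto
  note ids = ideal_ipow[OF J, of n] ideal_prod_is_ideal[OF assms(2) ideal_ipow[OF J, of n]]
  have "(q \<cdot> ipow J n) <+> ipow J n = ipow J n"
    using ideal_add_comm[OF ids(2,1)] ideal_add_absorb[OF ids]
      ideal_prod_subset2[OF assms(2) ids(1)] by metis
  then show ?thesis using ipow_Idl[where a = a and s = s and n = n, OF assms(1)] unfolding J_def by simp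
qed

text \<open>\<open>J^n\<close> is generated by the monomials of degree \<open>n\<close>, and each of
  them is annihilated by \<open>q\<close> modulo \<open>q J^n\<close>.\<close>

lemma ilen_prod_ipow_le:
  assumes a: "\<And>i. i < s \<Longrightarrow> a i \<in> carrier R" and q: "ideal q R"
  defines "J \<equiv> Idl (a ` {..<s})"
  shows "ilen (q \<cdot> ipow J n) (ipow J n) \<le> of_nat (card (multi_indices s n)) * ilen q (carrier R)"
proof -
  let ?G = "power_prod a s ` multi_indices s n"
  have J: "ideal J R" unfolding J_def using a by (intro genideal_ideal) auto
  have G: "finite ?G" "?G \<subseteq> carrier R"
    using a by (auto simp: finite_multi_indices intro!: power_prod_closed)
  have "ilen (q \<cdot> ipow J n) ((q \<cdot> ipow J n) <+> Idl ?G) \<le> of_nat (card ?G) * ilen q (carrier R)"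
  proof (rule ilen_generators_le[OF G ideal_prod_is_ideal[OF q ideal_ipow[OF J]] q])
    fix g assume "g \<in> ?G"
    then have "g \<in> ipow J n"
      using genideal_self[OF G(2)] ipow_Idl[where a = a and s = s and n = n, OF a] unfolding J_def by auto
    then show "q \<subseteq> colon (q \<cdot> ipow J n) g"
      using ideal_subset[OF q] by (auto simp: colon_def intro: ideal_prod.prod)
  qed
  also have "\<dots> \<le> of_nat (card (multi_indices s n)) * ilen q (carrier R)"
    by (intro mult_right_mono) (simp_all add: card_image_le finite_multi_indices)
  finally show ?thesis using add_ipow_Idl[where a = a and s = s and n = n, OF a q] unfolding J_def by simp
qed

text \<open>Adding the generators one after the other, in increasing order, gives cyclic successive
  quotients.\<close>
lemma ilen_ordered_generators:
  fixes X :: "'i set"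
  assumes "finite X" "\<And>x. x \<in> X \<Longrightarrow> g x \<in> carrier R" "ideal B R"
    and irrefl: "\<And>x. \<not> r x x" and trans: "\<And>x y z. r x y \<Longrightarrow> r y z \<Longrightarrow> r x z"
    and total: "\<And>x y. x \<in> X \<Longrightarrow> y \<in> X \<Longrightarrow> x \<noteq> y \<Longrightarrow> r x y \<or> r y x"
  shows "ilen B (B <+> Idl (g ` X))
    = (\<Sum>x\<in>X. ilen (colon (B <+> Idl (g ` {y \<in> X. r y x})) (g x)) (carrier R))"
  using assms(1,2,6)
proof (induction "card X" arbitrary: X)
  case 0
  then show ?case using assms(3) ideal_zero[OF assms(3)] by (simp add: Idl_empty ideal_add_absorb zeroideal)
next
  case (Suc k)
  have "X \<noteq> {}" using Suc.hyps(2) by auto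
  \<comment> \<open>The rank counts predecessors in \<open>X\<close>; an element of largest rank
    comes last in the order and is adjoined last.\<close>
  define rk where "rk x = card {y \<in> X. r y x}" for x
  have "Max (rk ` X) \<in> rk ` X" using \<open>X \<noteq> {}\<close> Suc.prems(1) by (intro Max_in) auto
  then obtain m where m: "m \<in> X" "rk m = Max (rk ` X)" by auto
  have le: "rk y \<le> rk m" if "y \<in> X" for y
    using m(2) that Suc.prems(1) by simp
  have max: "\<not> r m y" if "y \<in> X" for y
  proof
    assume r: "r m y"
    have "{z \<in> X. r z m} \<subset> {z \<in> X. r z y}"
      using r m(1) irrefl[of m] trans[OF _ r] by auto
    then have "rk m < rk y"
      unfolding rk_def by (intro psubset_card_mono) (use Suc.prems(1) in auto)
    then show False using le[OF that] by simp
  qed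
  let ?X = "X - {m}"
  have IH: "ilen B (B <+> Idl (g ` ?X))
      = (\<Sum>x\<in>?X. ilen (colon (B <+> Idl (g ` {y \<in> ?X. r y x})) (g x)) (carrier R))"
    using Suc.hyps(2) Suc.prems m(1) by (intro Suc.hyps(1)) auto
  have eq: "{y \<in> ?X. r y x} = {y \<in> X. r y x}" if "x \<in> ?X" for x
    using max that by auto
  have eqm: "{y \<in> X. r y m} = ?X"
    using irrefl Suc.prems(3)[OF m(1)] max by blast
  have gm: "g m \<in> carrier R" and gX: "g ` ?X \<subseteq> carrier R" using Suc.prems(2) m(1) by auto
  let ?B = "B <+> Idl (g ` ?X)"
  have ids: "ideal ?B R" "ideal (Idl (g ` ?X)) R" "ideal (PIdl (g m)) R" "ideal (?B <+> PIdl (g m)) R"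
    using gm gX assms(3) by (auto intro!: ideal_closed)
  have X: "g ` X = insert (g m) (g ` ?X)" using m(1) by blast
  have "B <+> Idl (g ` X) = ?B <+> PIdl (g m)"
    unfolding X Idl_insert[OF gm gX]
    using ideal_add_comm[OF ids(3,2)] ideal_add_assoc[OF assms(3) ids(2,3)] by simp
  then have "ilen B (B <+> Idl (g ` X)) = ilen B ?B + ilen ?B (?B <+> PIdl (g m))"
    using ilen_additive[OF ids(4,1) assms(3) subset_addI1[OF assms(3) ids(2)] subset_addI1[OF ids(1,3)]]
    by simp
  also have "ilen ?B (?B <+> PIdl (g m)) = ilen (colon (B <+> Idl (g ` {y \<in> X. r y m})) (g m)) (carrier R)"
    unfolding eqm by (rule ilen_cyclic[OF ids(1) gm])
  also have "ilen B ?B = (\<Sum>x\<in>?X. ilen (colon (B <+> Idl (g ` {y \<in> X. r y x})) (g x)) (carrier R))"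
    unfolding IH by (rule sum.cong[OF HOL.refl]) (simp only: eq)
  finally show ?case
    using sum.remove[OF Suc.prems(1) m(1),
        of "\<lambda>x. ilen (colon (B <+> Idl (g ` {y \<in> X. r y x})) (g x)) (carrier R)"]
    by (simp only: add.commute)
qed

text \<open>The possible leading coefficients at exponent \<open>\<alpha>\<close> of relations among
  the monomials of its degree modulo \<open>q J^n\<close>, the largest monomial being the leading
  one. In Groebner terms this is a coefficient ideal of the initial module of relations.\<close>

definition leading_colon :: "(nat \<Rightarrow> 'a) \<Rightarrow> nat \<Rightarrow> 'a set \<Rightarrow> (nat \<Rightarrow> nat) \<Rightarrow> 'a set" where
  "leading_colon a s q \<alpha> =
     (let n = \<Sum>i<s. \<alpha> i in
      colon ((q \<cdot> ipow (Idl (a ` {..<s})) n)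
        <+> Idl (power_prod a s ` {\<beta> \<in> multi_indices s n. lex_less s \<beta> \<alpha>})) (power_prod a s \<alpha>))"

lemma ilen_prod_ipow_eq:
  assumes a: "\<And>i. i < s \<Longrightarrow> a i \<in> carrier R" and q: "ideal q R"
  defines "J \<equiv> Idl (a ` {..<s})"
  shows "ilen (q \<cdot> ipow J n) (ipow J n)
    = (\<Sum>\<alpha>\<in>multi_indices s n. ilen (leading_colon a s q \<alpha>) (carrier R))"
proof -
  have J: "ideal J R" unfolding J_def using a by (intro genideal_ideal) auto
  have "ilen (q \<cdot> ipow J n) ((q \<cdot> ipow J n) <+> Idl (power_prod a s ` multi_indices s n))
    = (\<Sum>\<alpha>\<in>multi_indices s n. ilen (colon ((q \<cdot> ipow J n)
        <+> Idl (power_prod a s ` {\<beta> \<in> multi_indices s n. lex_less s \<beta> \<alpha>})) (power_prod a s \<alpha>)) (carrier R))"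
    by (rule ilen_ordered_generators)
       (use a in \<open>auto intro: finite_multi_indices power_prod_closed ideal_prod_is_ideal q ideal_ipow J
          lex_less_trans dest: lex_less_total simp: lex_less_irrefl\<close>)
  also have "\<dots> = (\<Sum>\<alpha>\<in>multi_indices s n. ilen (leading_colon a s q \<alpha>) (carrier R))"
    by (rule sum.cong[OF HOL.refl]) (simp add: leading_colon_def multi_indices_def J_def)
  finally show ?thesis using add_ipow_Idl[where a = a and s = s and n = n, OF a q] unfolding J_def by simp
qed

text \<open>A relation with leading exponent \<open>\<alpha>\<close> multiplied by the monomial of
  exponent \<open>\<beta> - \<alpha>\<close> is a relation with leading exponent
  \<open>\<beta>\<close> and the same leading coefficient, as the order is compatible with
  addition.\<close>

lemma leading_colon_mono:
  assumes a: "\<And>i. i < s \<Longrightarrow> a i \<in> carrier R" and q: "ideal q R" and le: "\<alpha> \<le> \<beta>"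
  shows "leading_colon a s q \<alpha> \<subseteq> leading_colon a s q \<beta>"
proof -
  define J where "J = Idl (a ` {..<s})"
  define n where "n = (\<Sum>i<s. \<alpha> i)"
  define m where "m = (\<Sum>i<s. \<beta> i)"
  \<comment> \<open>Vanishing from \<open>s\<close> on keeps sums with multi-indices inside the
    multi-indices.\<close>
  define \<gamma> where "\<gamma> i = (if i < s then \<beta> i - \<alpha> i else 0)" for i
  define g where "g = power_prod a s \<gamma>"
  have A: "a ` {..<s} \<subseteq> carrier R" using a by auto
  have J: "ideal J R" unfolding J_def using A by (rule genideal_ideal)
  have le': "\<alpha> i \<le> \<beta> i" for i using le by (simp add: le_fun_def)
  have \<beta>: "\<beta> i = \<alpha> i + \<gamma> i" if "i < s" for i using le'[of i] that by (simp add: \<gamma>_def)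
  have \<gamma>: "(\<Sum>i<s. \<gamma> i) = m - n" "n \<le> m"
  proof -
    have "m = (\<Sum>i<s. \<alpha> i + \<gamma> i)" unfolding m_def by (rule sum.cong) (auto simp: \<beta>)
    then show "(\<Sum>i<s. \<gamma> i) = m - n" "n \<le> m" by (simp_all add: n_def sum.distrib)
  qed
  have g: "g \<in> ipow J (m - n)" "g \<in> carrier R"
    using power_prod_in_ipow[OF J, of s a \<gamma>] genideal_self[OF A] a \<gamma>(1)
    by (auto simp: g_def J_def intro!: power_prod_closed)
  have pp: "power_prod a s \<beta> = power_prod a s \<alpha> \<otimes> g"
    using power_prod_add[where a = a and s = s and \<alpha> = \<alpha> and \<beta> = \<gamma>, OF a] power_prod_cong[of s \<beta> "\<lambda>i. \<alpha> i + \<gamma> i" a] \<beta>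
    by (simp add: g_def)
  let ?M = "\<lambda>n \<alpha>. power_prod a s ` {\<beta> \<in> multi_indices s n. lex_less s \<beta> \<alpha>}"
  let ?B = "(q \<cdot> ipow J n) <+> Idl (?M n \<alpha>)" and ?C = "(q \<cdot> ipow J m) <+> Idl (?M m \<beta>)"
  have M: "?M n \<alpha> \<subseteq> carrier R" "?M m \<beta> \<subseteq> carrier R" using a by (auto intro!: power_prod_closed)
  have ids: "ideal (q \<cdot> ipow J n) R" "ideal (q \<cdot> ipow J m) R" "ideal (Idl (?M n \<alpha>)) R"
    "ideal (Idl (?M m \<beta>)) R" "ideal ?C R" "ideal (colon ?C g) R"
    using q J M g(2) by (auto intro!: ideal_closed ideal_colon)
  have "?B \<subseteq> colon ?C g"
  proof (rule add_subset[OF ids(6)])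
    show "q \<cdot> ipow J n \<subseteq> colon ?C g"
    proof
      fix x assume x: "x \<in> q \<cdot> ipow J n"
      then have "x \<otimes> g \<in> (q \<cdot> ipow J n) \<cdot> ipow J (m - n)"
        using g(1) by (rule ideal_prod.prod)
      also have "\<dots> = q \<cdot> ipow J m"
        using ideal_prod_assoc[OF q ideal_ipow[OF J] ideal_ipow[OF J]] ipow_add[OF J, of n "m - n"] \<gamma>(2)
        by simp
      finally have "x \<otimes> g \<in> ?C" using subset_addI1[OF ids(2,4)] by blast
      then show "x \<in> colon ?C g" using ideal.Icarr[OF ids(1) x] by (simp add: colon_def)
    qed
    have "?M n \<alpha> \<subseteq> colon ?C g"
    proof clarify
      fix \<beta>' assume *: "\<beta>' \<in> multi_indices s n" "lex_less s \<beta>' \<alpha>"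
      have eq: "power_prod a s (\<lambda>i. \<beta>' i + \<gamma> i) = power_prod a s \<beta>' \<otimes> g"
        using power_prod_add[where a = a and s = s and \<alpha> = \<beta>' and \<beta> = \<gamma>, OF a] by (simp add: g_def)
      have "(\<lambda>i. \<beta>' i + \<gamma> i) \<in> multi_indices s m"
        using * \<gamma> by (auto simp: multi_indices_def sum.distrib) (simp add: \<gamma>_def)
      moreover have "lex_less s (\<lambda>i. \<beta>' i + \<gamma> i) \<beta>"
        using lex_less_add[OF *(2), of \<gamma>] lex_less_cong[of s "\<lambda>i. \<beta>' i + \<gamma> i" "\<lambda>i. \<beta>' i + \<gamma> i" \<beta> "\<lambda>i. \<alpha> i + \<gamma> i"] \<beta>
        by simp
      ultimately have "power_prod a s \<beta>' \<otimes> g \<in> ?M m \<beta>" unfolding eq[symmetric] by blast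
      then have "power_prod a s \<beta>' \<otimes> g \<in> ?C"
        using genideal_self[OF M(2)] subset_addI2[OF ids(2,4)] by blast
      then show "power_prod a s \<beta>' \<in> colon ?C g"
        using power_prod_closed[where a = a and s = s, OF a] by (simp add: colon_def)
    qed
    then show "Idl (?M n \<alpha>) \<subseteq> colon ?C g" using Idl_subset_iff[OF M(1) ids(6)] by blast
  qed
  then have "x \<in> colon ?C (power_prod a s \<beta>)" if x: "x \<in> colon ?B (power_prod a s \<alpha>)" for x
  proof -
    have c: "x \<in> carrier R" "power_prod a s \<alpha> \<in> carrier R"
      using x power_prod_closed[where a = a and s = s, OF a] by (auto simp: colon_def)
    have "x \<otimes> power_prod a s \<alpha> \<in> colon ?C g" using x \<open>?B \<subseteq> colon ?C g\<close> by (auto simp: colon_def)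
    then show ?thesis using c g(2) unfolding pp by (simp add: colon_def m_assoc)
  qed
  then show ?thesis unfolding leading_colon_def Let_def J_def[symmetric] n_def[symmetric] m_def[symmetric]
    by blast
qed

lemma subset_leading_colon:
  assumes a: "\<And>i. i < s \<Longrightarrow> a i \<in> carrier R" and q: "ideal q R"
  shows "q \<subseteq> leading_colon a s q \<alpha>" "ideal (leading_colon a s q \<alpha>) R"
proof -
  define J where "J = Idl (a ` {..<s})"
  define n where "n = (\<Sum>i<s. \<alpha> i)"
  let ?M = "power_prod a s ` {\<beta> \<in> multi_indices s n. lex_less s \<beta> \<alpha>}"
  have A: "a ` {..<s} \<subseteq> carrier R" and M: "?M \<subseteq> carrier R" using a by (auto intro!: power_prod_closed)
  have J: "ideal J R" unfolding J_def using A by (rule genideal_ideal)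
  have ids: "ideal (q \<cdot> ipow J n) R" "ideal (Idl ?M) R" using q J M by (auto intro!: ideal_closed)
  have g: "power_prod a s \<alpha> \<in> ipow J n" "power_prod a s \<alpha> \<in> carrier R"
    using power_prod_in_ipow[OF J, of s a \<alpha>] genideal_self[OF A] a
    by (auto simp: J_def n_def intro!: power_prod_closed)
  have "q \<subseteq> colon ((q \<cdot> ipow J n) <+> Idl ?M) (power_prod a s \<alpha>)"
  proof
    fix x assume x: "x \<in> q"
    have "x \<otimes> power_prod a s \<alpha> \<in> q \<cdot> ipow J n" using x g(1) by (rule ideal_prod.prod)
    then have "x \<otimes> power_prod a s \<alpha> \<in> (q \<cdot> ipow J n) <+> Idl ?M" using subset_addI1[OF ids] by blast
    then show "x \<in> colon ((q \<cdot> ipow J n) <+> Idl ?M) (power_prod a s \<alpha>)"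
      using ideal.Icarr[OF q x] by (simp add: colon_def)
  qed
  then show "q \<subseteq> leading_colon a s q \<alpha>"
    unfolding leading_colon_def Let_def J_def[symmetric] n_def[symmetric] .
  show "ideal (leading_colon a s q \<alpha>) R"
    unfolding leading_colon_def Let_def J_def[symmetric] n_def[symmetric]
    by (rule ideal_colon[OF add_ideals[OF ids] g(2)])
qed

text \<open>The length is the sum of the colengths of the leading coefficient ideals. These ideals
  contain \<open>q\<close>, so the colengths are finite, and they grow with the exponent, so the
  colengths are antitone.\<close>

lemma eventually_poly_ilen_prod_ipow:
  fixes s :: nat
  assumes a: "\<And>i. i < s \<Longrightarrow> a i \<in> carrier R" and q: "ideal q R" "ilen q (carrier R) \<noteq> \<infinity>"
  defines "J \<equiv> Idl (a ` {..<s})"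
  shows "eventually_poly (\<lambda>n. of_nat (the_enat (ilen (q \<cdot> ipow J n) (ipow J n))))"
proof -
  define f where "f \<alpha> = the_enat (ilen (leading_colon a s q \<alpha>) (carrier R))" for \<alpha>
  have fin: "ilen (leading_colon a s q \<alpha>) (carrier R) = enat (f \<alpha>)" for \<alpha>
  proof -
    have "ilen (leading_colon a s q \<alpha>) (carrier R) \<le> ilen q (carrier R)"
      using subset_leading_colon[where a = a and s = s and \<alpha> = \<alpha>, OF a q(1)] ideal_subset q(1)
      by (intro ilen_mono oneideal) auto
    then show ?thesis using enat_le_not_infinity[OF _ q(2)] by (force simp: f_def)
  qed
  have "f \<beta> \<le> f \<alpha>" if "\<alpha> \<le> \<beta>" for \<alpha> \<beta>
  proof -
    have "ilen (leading_colon a s q \<beta>) (carrier R) \<le> ilen (leading_colon a s q \<alpha>) (carrier R)"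
      using leading_colon_mono[where a = a and s = s, OF a q(1) that] subset_leading_colon(2)[where a = a and s = s, OF a q(1)] ideal_subset
      by (intro ilen_mono oneideal) auto
    then show ?thesis unfolding fin by simp
  qed
  then have "eventually_poly (\<lambda>n. \<Sum>\<alpha>\<in>multi_indices s n. of_nat (f \<alpha>))"
    by (rule eventually_poly_sum_antitone)
  moreover have "the_enat (ilen (q \<cdot> ipow J n) (ipow J n)) = (\<Sum>\<alpha>\<in>multi_indices s n. f \<alpha>)" for n
  proof -
    have *: "(\<Sum>\<alpha>\<in>A. enat (f \<alpha>)) = enat (\<Sum>\<alpha>\<in>A. f \<alpha>)" for A
      by (induction A rule: infinite_finite_induct) (auto simp: zero_enat_def)
    show ?thesis
      using ilen_prod_ipow_eq[where a = a and s = s and n = n, OF a q(1)]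
      unfolding fin * J_def by simp
  qed
  ultimately show ?thesis by (simp add: of_nat_sum)
qed

end

section \<open>Hilbert functions of ideals in a local ring\<close>

context noetherian_local_ring
begin

lemma obtain_indexed_generators:
  assumes "ideal J R"
  obtains a :: "nat \<Rightarrow> 'a" and s where "\<And>i. i < s \<Longrightarrow> a i \<in> carrier R" "J = Idl (a ` {..<s})"
proof -
  obtain A where A: "A \<subseteq> carrier R" "finite A" "J = Idl A" using finetely_gen[OF assms] by blast
  obtain a and s :: nat where "A = a ` {i. i < s}"
    using finite_imp_nat_seg_image_inj_on[OF A(2)] by metis
  then show thesis using that[of s a] A by (auto simp: lessThan_def)
qed

lemma colength_ilen:
  assumes "finite_colength X"
  shows "ilen X (carrier R) = enat (colength R X)"
  using ilen_finite_colength[OF assms] colength_eq[OF finite_colength_ideal[OF assms]] by auto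

lemma colength_additive:
  assumes "finite_colength B" "ideal A R" "B \<subseteq> A"
  shows "ilen B A = enat (colength R B - colength R A)" "colength R A \<le> colength R B"
proof -
  have A: "finite_colength A" using finite_colength_mono[OF assms] .
  have "ilen B (carrier R) = ilen B A + ilen A (carrier R)"
    by (rule ilen_additive[OF oneideal assms(2) finite_colength_ideal[OF assms(1)] assms(3)
          ideal_subset[OF assms(2)]])
  then have eq: "enat (colength R B) = ilen B A + enat (colength R A)"
    by (simp add: colength_ilen assms(1) A)
  then obtain k where k: "ilen B A = enat k" by (cases "ilen B A") auto
  with eq show "ilen B A = enat (colength R B - colength R A)" "colength R A \<le> colength R B" by auto
qed

lemma colength_carrier [simp]: "colength R (carrier R) = 0"
  by (simp add: colength_eq oneideal zero_enat_def)

lemma eventually_poly_min_gens: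
  assumes "ideal J R"
  shows "eventually_poly (\<lambda>n. of_nat (min_gens R (ipow J n)))"
proof -
  obtain a and s :: nat where a: "\<And>i. i < s \<Longrightarrow> a i \<in> carrier R" "J = Idl (a ` {..<s})"
    using obtain_indexed_generators[OF assms] by metis
  have "min_gens R (ipow J n) = the_enat (ilen (\<mm> \<cdot> ipow J n) (ipow J n))" for n
    using min_gens_eq[OF ideal_ipow[OF assms], of n] by (metis the_enat.simps)
  then show ?thesis
    using eventually_poly_ilen_prod_ipow[where a = a and s = s, OF a(1) ideal_mm] a(2) by (simp add: ilen_mm)
qed

lemma colength_ipow_Suc:
  assumes "finite_colength J"
  shows "colength R (ipow J (Suc n)) = colength R (ipow J n) + the_enat (ilen (J \<cdot> ipow J n) (ipow J n))"
proof -
  have J: "ideal J R" using assms by (rule finite_colength_ideal)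
  have *: "finite_colength (J \<cdot> ipow J n)"
    using finite_colength_ipow[OF assms, of "Suc n"] by (simp add: ipow_Suc J)
  show ?thesis
    using colength_additive[OF * ideal_ipow[OF J] ideal_prod_subset2[OF J ideal_ipow[OF J]]]
    by (simp add: ipow_Suc J)
qed

text \<open>With \<open>q = J\<close>, \<open>eventually_poly_ilen_prod_ipow\<close> describes the
  lengths of \<open>J^n/J^(n+1)\<close>, and the colengths are their partial sums.\<close>

lemma eventually_poly_colength:
  assumes "finite_colength J"
  shows "eventually_poly (\<lambda>n. of_nat (colength R (ipow J n)))"
proof -
  let ?h = "\<lambda>n. the_enat (ilen (J \<cdot> ipow J n) (ipow J n))"
  have J: "ideal J R" using assms by (rule finite_colength_ideal)
  obtain a and s :: nat where a: "\<And>i. i < s \<Longrightarrow> a i \<in> carrier R" "J = Idl (a ` {..<s})"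
    using obtain_indexed_generators[OF J] by metis
  have "eventually_poly (\<lambda>n. of_nat (?h n))"
    using eventually_poly_ilen_prod_ipow[where a = a and s = s, OF a(1) J ilen_finite_colength[OF assms]] a(2) by simp
  \<comment> \<open>The subtraction is truncated at \<open>n = 0\<close>, so the sum agrees with the
    colength only from \<open>n = 1\<close> on.\<close>
  then have "eventually_poly (\<lambda>n. \<Sum>k\<le>n - 1. of_nat (?h k))"
    by (intro eventually_poly_shift[of "\<lambda>n. \<Sum>k\<le>n. of_nat (?h k)"] eventually_poly_cumulative)
  moreover have "colength R (ipow J (Suc n)) = (\<Sum>k\<le>n. ?h k)" for n
    by (induction n) (simp_all add: colength_ipow_Suc[OF assms])
  then have "(\<Sum>k\<le>n - 1. of_nat (?h k)) = (of_nat (colength R (ipow J n)) :: rat)" if "n \<ge> 1" for n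
    using that by (cases n) (auto simp: of_nat_sum)
  ultimately show ?thesis
    by (rule eventually_poly_cong[where N = 1])
qed

text \<open>In the filtration by powers, \<open>J^k/J^(k+1)\<close> is generated over
  \<open>R/J\<close> by the monomials of degree \<open>k\<close>.\<close>

lemma colength_ipow_le:
  assumes a: "\<And>i. i < s \<Longrightarrow> a i \<in> carrier R" and J: "finite_colength (Idl (a ` {..<s}))"
  defines "J \<equiv> Idl (a ` {..<s})"
  shows "colength R (ipow J n) \<le> (\<Sum>k<n. card (multi_indices s k)) * colength R J"
proof (induction n)
  case (Suc n)
  have Ji: "ideal J R" using J finite_colength_ideal unfolding J_def by blast
  have "ilen (J \<cdot> ipow J n) (ipow J n) \<le> of_nat (card (multi_indices s n)) * ilen J (carrier R)"
    using ilen_prod_ipow_le[where a = a and s = s and n = n, OF a Ji] unfolding J_def .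
  also have "\<dots> = enat (card (multi_indices s n) * colength R J)"
    using colength_ilen[OF J] by (simp add: J_def of_nat_eq_enat)
  finally have "the_enat (ilen (J \<cdot> ipow J n) (ipow J n)) \<le> card (multi_indices s n) * colength R J"
    by (cases "ilen (J \<cdot> ipow J n) (ipow J n)") auto
  then show ?case
    using Suc colength_ipow_Suc[OF J, of n] by (simp add: J_def algebra_simps)
qed simp

end

section \<open>Regular sequences\<close>

text \<open>Regularity modulo \<open>c\<close>, where \<open>c\<close> absorbs the elements already
  passed; this lets inductions vary the base ideal. That the quotient is nonzero is expressed
  separately, by \<open>set xs \<subseteq> \<mm>\<close>.\<close>

primrec (in cring) reg_seq :: "'a set \<Rightarrow> 'a list \<Rightarrow> bool" where
  "reg_seq c [] \<longleftrightarrow> True"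
| "reg_seq c (x # xs) \<longleftrightarrow> colon c x \<subseteq> c \<and> reg_seq (c <+> PIdl x) xs"

context cring
begin

lemma colonD: "s \<in> colon B r \<Longrightarrow> s \<in> carrier R \<and> s \<otimes> r \<in> B"
  by (simp add: colon_def)

lemma colonI: "s \<in> carrier R \<Longrightarrow> s \<otimes> r \<in> B \<Longrightarrow> s \<in> colon B r"
  by (simp add: colon_def)

lemma PIdlI: "s \<in> carrier R \<Longrightarrow> s \<otimes> r \<in> PIdl r"
  by (auto simp: PIdl_mem)

lemma add_Idl_insert:
  assumes "ideal c R" "x \<in> carrier R" "A \<subseteq> carrier R"
  shows "c <+> Idl (insert x A) = (c <+> PIdl x) <+> Idl A"
  unfolding Idl_insert[OF assms(2,3)]
  by (rule ideal_add_assoc[symmetric, OF assms(1) cgenideal_ideal[OF assms(2)] genideal_ideal[OF assms(3)]])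

lemma add_Idl_empty: "ideal c R \<Longrightarrow> c <+> Idl {} = c"
  by (simp add: Idl_empty ideal_add_absorb zeroideal ideal_zero)

lemma zero_add_ideal: "ideal c R \<Longrightarrow> {\<zero>} <+> c = c"
  by (metis ideal_add_comm ideal_add_absorb zeroideal empty_subsetI ideal_zero insert_subset)

lemma reg_seq_append:
  "ideal c R \<Longrightarrow> set xs \<subseteq> carrier R \<Longrightarrow>
    reg_seq c (xs @ ys) \<longleftrightarrow> reg_seq c xs \<and> reg_seq (c <+> Idl (set xs)) ys"
proof (induction xs arbitrary: c)
  case Nil
  then show ?case by (simp add: add_Idl_empty)
next
  case (Cons x xs)
  have "ideal (c <+> PIdl x) R" using Cons.prems by (auto intro!: ideal_closed)
  with Cons.IH[OF this] Cons.prems add_Idl_insert[of c x "set xs"] show ?case by simp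
qed

lemma PIdl_pow_Suc_subset: "x \<in> carrier R \<Longrightarrow> PIdl (x [^] Suc n) \<subseteq> PIdl (x [^] n)"
  using PIdlI[of x "x [^] n"] by (subst PIdl_subset_iff) (auto simp: m_comm cgenideal_ideal)

lemma colon_pow_subset:
  assumes "colon c x \<subseteq> c" "x \<in> carrier R" "ideal c R"
  shows "colon c (x [^] (n::nat)) \<subseteq> c"
proof (induction n)
  case 0
  then show ?case by (auto simp: colon_def)
next
  case (Suc n)
  show ?case
  proof
    fix s assume s: "s \<in> colon c (x [^] Suc n)"
    then have "s \<in> carrier R" "(s \<otimes> x [^] n) \<otimes> x \<in> c" using assms by (auto simp: colon_def m_assoc)
    then have "s \<otimes> x [^] n \<in> colon c x" using assms by (auto simp: colon_def)
    then have "s \<otimes> x [^] n \<in> c" using assms(1) by blast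
    then have "s \<in> colon c (x [^] n)" using \<open>s \<in> carrier R\<close> by (simp add: colon_def)
    then show "s \<in> c" using Suc by blast
  qed
qed

text \<open>From \<open>r x = s + t y\<close> regularity of \<open>y\<close> gives
  \<open>t = s' + u x\<close>, so \<open>(r - u y) x\<close> lies in \<open>c\<close>, and
  regularity of \<open>x\<close> puts \<open>r - u y\<close> into \<open>c\<close>.\<close>

lemma colon_swap_right:
  assumes c: "ideal c R" and x: "x \<in> carrier R" and y: "y \<in> carrier R"
    and 1: "colon c x \<subseteq> c" and 2: "colon (c <+> PIdl x) y \<subseteq> c <+> PIdl x"
  shows "colon (c <+> PIdl y) x \<subseteq> c <+> PIdl y"
proof
  fix r assume r: "r \<in> colon (c <+> PIdl y) x"
  then obtain s t where st: "r \<in> carrier R" "s \<in> c" "t \<in> carrier R" "r \<otimes> x = s \<oplus> t \<otimes> y"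
    by (metis colonD set_addE PIdlE)
  have sc: "s \<in> carrier R" using ideal.Icarr[OF c st(2)] .
  have "t \<otimes> y = (\<ominus> s) \<oplus> r \<otimes> x" using st sc y x by algebra
  moreover have "\<dots> \<in> c <+> PIdl x"
    by (rule set_addI[OF ideal_uminus[OF c st(2)] PIdlI[OF st(1)]])
  ultimately have "t \<in> c <+> PIdl x" using 2 st(3) by (auto simp: colon_def)
  then obtain s' u where su: "s' \<in> c" "u \<in> carrier R" "t = s' \<oplus> u \<otimes> x" by (metis set_addE PIdlE)
  have sc': "s' \<in> carrier R" using ideal.Icarr[OF c su(1)] .
  have "(r \<ominus> u \<otimes> y) \<otimes> x = r \<otimes> x \<ominus> u \<otimes> x \<otimes> y" using st(1) su(2) x y by algebra
  also have "\<dots> = s \<oplus> (s' \<oplus> u \<otimes> x) \<otimes> y \<ominus> u \<otimes> x \<otimes> y" using st(4) su(3) by simp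
  also have "\<dots> = s \<oplus> s' \<otimes> y" using sc sc' su(2) x y by algebra
  also have "\<dots> \<in> c" using c st(2) su(1) y by (simp add: ideal_add_closed ideal.I_r_closed)
  finally have "r \<ominus> u \<otimes> y \<in> c" using 1 st(1) su(2) y by (auto simp: colon_def)
  then have "(r \<ominus> u \<otimes> y) \<oplus> u \<otimes> y \<in> c <+> PIdl y"
    using su(2) PIdl_mem[of "u \<otimes> y" y] by (intro set_addI) auto
  moreover have "(r \<ominus> u \<otimes> y) \<oplus> u \<otimes> y = r" using st(1) su(2) y by algebra
  ultimately show "r \<in> c <+> PIdl y" by simp
qed

text \<open>Each of the \<open>n\<close> steps from \<open>c + (x^(k+1))\<close> to
  \<open>c + (x^k)\<close> is cyclic with annihilator inside \<open>c + (x)\<close>, because powers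
  of \<open>x\<close> can be cancelled modulo \<open>c\<close>.\<close>

lemma ilen_pow_ge:
  assumes c: "ideal c R" and x: "x \<in> carrier R" and nz: "colon c x \<subseteq> c"
  shows "of_nat n * ilen (c <+> PIdl x) (carrier R) \<le> ilen (c <+> PIdl (x [^] n)) (carrier R)"
proof (induction n)
  case (Suc n)
  let ?C = "\<lambda>n::nat. c <+> PIdl (x [^] n)"
  have P: "ideal (PIdl (x [^] n)) R" for n :: nat using x by (simp add: cgenideal_ideal)
  have C: "ideal (?C n) R" for n using c P by (rule add_ideals)
  have Cx: "ideal (c <+> PIdl x) R" using c x by (intro ideal_closed)
  have sub: "PIdl (x [^] Suc n) \<subseteq> PIdl (x [^] n)" using x by (rule PIdl_pow_Suc_subset)
  have eq: "?C (Suc n) <+> PIdl (x [^] n) = ?C n"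
    using ideal_add_assoc[OF c P P] ideal_add_comm[OF P P] ideal_add_absorb[OF P P sub] by metis
  have le: "?C (Suc n) \<subseteq> ?C n" using sub by (rule set_add_mono[OF order_refl])
  have "colon (?C (Suc n)) (x [^] n) \<subseteq> c <+> PIdl x"
  proof
    fix s assume s: "s \<in> colon (?C (Suc n)) (x [^] n)"
    then obtain k t where kt: "s \<in> carrier R" "k \<in> c" "t \<in> carrier R" "s \<otimes> x [^] n = k \<oplus> t \<otimes> x [^] Suc n"
      by (metis colonD set_addE PIdlE)
    have kc: "k \<in> carrier R" using ideal.Icarr[OF c kt(2)] .
    have xn: "x [^] n \<in> carrier R" using x by simp
    have "(s \<ominus> t \<otimes> x) \<otimes> x [^] n = s \<otimes> x [^] n \<ominus> t \<otimes> (x [^] n \<otimes> x)"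
      using kt(1,3) x xn by algebra
    also have "\<dots> = k \<oplus> t \<otimes> (x [^] n \<otimes> x) \<ominus> t \<otimes> (x [^] n \<otimes> x)" using kt(4) by simp
    also have "\<dots> = k" using kc kt(3) x xn by algebra
    finally have "s \<ominus> t \<otimes> x \<in> colon c (x [^] n)" using kt x by (simp add: colon_def)
    then have "s \<ominus> t \<otimes> x \<in> c" using colon_pow_subset[OF nz x c] by blast
    then have "(s \<ominus> t \<otimes> x) \<oplus> t \<otimes> x \<in> c <+> PIdl x"
      using kt(3) PIdl_mem[of "t \<otimes> x" x] by (intro set_addI) auto
    moreover have "(s \<ominus> t \<otimes> x) \<oplus> t \<otimes> x = s" using kt(1,3) x by algebra
    ultimately show "s \<in> c <+> PIdl x" by simp
  qed
  then have "ilen (c <+> PIdl x) (carrier R) \<le> ilen (colon (?C (Suc n)) (x [^] n)) (carrier R)"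
    using x by (intro ilen_mono oneideal Cx ideal_colon C) (auto dest: ideal_subset[OF Cx, THEN subsetD])
  also have "\<dots> = ilen (?C (Suc n)) (?C n)"
    using ilen_cyclic[OF C, of "x [^] n" "Suc n"] x unfolding eq by simp
  finally have "of_nat (Suc n) * ilen (c <+> PIdl x) (carrier R)
      \<le> ilen (?C (Suc n)) (?C n) + ilen (?C n) (carrier R)"
    using Suc by (simp add: distrib_right add_mono)
  also have "\<dots> = ilen (?C (Suc n)) (carrier R)"
    by (rule ilen_additive[symmetric, OF oneideal C C le ideal_subset[OF C]])
  finally show ?case .
qed simp

text \<open>An ideal \<open>K\<close> maximal among those that contain \<open>c\<close> and miss
  \<open>T\<close> is prime: for \<open>a\<close>, \<open>b\<close> outside \<open>K\<close> both
  \<open>K + (a)\<close> and \<open>K + (b)\<close> meet \<open>T\<close>, and if \<open>a b\<close>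
  were in \<open>K\<close>, the product of the two elements found would lie in \<open>K\<close> and
  in \<open>T\<close>.\<close>

lemma prime_avoiding:
  assumes noeth: "noetherian_ring R" and c: "ideal c R" and T: "T \<subseteq> carrier R" "\<one> \<in> T"
    and mult: "\<And>s t. s \<in> T \<Longrightarrow> t \<in> T \<Longrightarrow> s \<otimes> t \<in> T" and disj: "c \<inter> T = {}"
  shows "\<exists>p. primeideal p R \<and> c \<subseteq> p \<and> p \<inter> T = {}"
proof -
  let ?S = "{K. ideal K R \<and> c \<subseteq> K \<and> K \<inter> T = {}}"
  have ne: "?S \<noteq> {}" using c disj by blast
  obtain K where K: "K \<in> ?S" "\<forall>L\<in>?S. K \<subseteq> L \<longrightarrow> L = K"
    using noetherian_ring.ideal_set_maximal[OF noeth ne] by blast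
  have Ki: "ideal K R" "K \<inter> T = {}" "c \<subseteq> K" using K(1) by auto
  have meet: "\<exists>k\<in>K. \<exists>s\<in>carrier R. k \<oplus> s \<otimes> a \<in> T" if a: "a \<in> carrier R" "a \<notin> K" for a
  proof -
    let ?L = "K <+> PIdl a"
    have P: "ideal (PIdl a) R" using a(1) by (rule cgenideal_ideal)
    have L: "ideal ?L R" "K \<subseteq> ?L" "a \<in> ?L"
      using add_ideals[OF Ki(1) P] subset_addI1[OF Ki(1) P] subset_addI2[OF Ki(1) P]
        cgenideal_self[OF a(1)] by auto
    have "?L \<notin> ?S"
    proof
      assume "?L \<in> ?S"
      then have "?L = K" using K(2) L(2) by blast
      then show False using L(3) a(2) by simp
    qed
    then obtain t where t: "t \<in> ?L" "t \<in> T" using L Ki(3) by blast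
    then show ?thesis by (metis set_addE PIdlE)
  qed
  have "primeideal K R"
  proof (rule primeidealI[OF Ki(1) is_cring])
    show "carrier R \<noteq> K" using Ki(2) T by auto
    fix a b assume ab: "a \<in> carrier R" "b \<in> carrier R" "a \<otimes> b \<in> K"
    show "a \<in> K \<or> b \<in> K"
    proof (rule ccontr)
      assume "\<not> (a \<in> K \<or> b \<in> K)"
      then obtain k s l t where *: "k \<in> K" "s \<in> carrier R" "k \<oplus> s \<otimes> a \<in> T"
        "l \<in> K" "t \<in> carrier R" "l \<oplus> t \<otimes> b \<in> T"
        using meet[OF ab(1)] meet[OF ab(2)] by blast
      have kl: "k \<in> carrier R" "l \<in> carrier R"
        using ideal.Icarr[OF Ki(1)] * by auto
      have "(k \<oplus> s \<otimes> a) \<otimes> (l \<oplus> t \<otimes> b) = (k \<otimes> (l \<oplus> t \<otimes> b) \<oplus> (s \<otimes> a) \<otimes> l) \<oplus> (s \<otimes> t) \<otimes> (a \<otimes> b)"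
        using kl * ab by algebra
      also have "\<dots> \<in> K"
        by (rule ideal_add_closed[OF Ki(1) ideal_add_closed[OF Ki(1)
                ideal.I_r_closed[OF Ki(1) *(1)] ideal.I_l_closed[OF Ki(1) *(4)]]
              ideal.I_l_closed[OF Ki(1) ab(3)]]) (use kl * ab in auto)
      finally have "(k \<oplus> s \<otimes> a) \<otimes> (l \<oplus> t \<otimes> b) \<in> K" .
      then show False using mult[OF *(3,6)] Ki(2) by blast
    qed
  qed
  then show ?thesis using Ki by blast
qed

lemma ipow_PIdl_subset:
  assumes "x \<in> carrier R" shows "ipow (PIdl x) n \<subseteq> PIdl (x [^] n)"
proof (induction n)
  case 0
  then show ?case using assms by (auto simp: PIdl_mem)
next
  case (Suc n)
  have P: "ideal (PIdl x) R" "ideal (PIdl (x [^] n)) R" "ideal (PIdl (x [^] Suc n)) R"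
    using assms by (auto intro!: cgenideal_ideal)
  have "ipow (PIdl x) (Suc n) \<subseteq> (PIdl x) \<cdot> (PIdl (x [^] n))"
    using Suc P by (simp add: ipow_Suc ideal_prod_mono)
  also have "\<dots> \<subseteq> PIdl (x [^] Suc n)"
  proof (rule ideal_prod_subset[OF P(3)])
    fix u v assume "u \<in> PIdl x" "v \<in> PIdl (x [^] n)"
    then obtain s t where st: "s \<in> carrier R" "t \<in> carrier R" "u = s \<otimes> x" "v = t \<otimes> x [^] n"
      by (metis PIdlE)
    have "x [^] n \<in> carrier R" using assms by simp
    then have "u \<otimes> v = (s \<otimes> t) \<otimes> (x [^] n \<otimes> x)" using st assms by (simp add: m_ac)
    then show "u \<otimes> v \<in> PIdl (x [^] Suc n)" using st by (auto simp: PIdl_mem)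
  qed
  finally show ?case .
qed

text \<open>Generators are added one at a time; by \<open>binomial_ipow_subset\<close> the required
  exponents add up.\<close>

lemma ipow_Idl_subset_of_powers:
  assumes "finite A" "A \<subseteq> carrier R" "ideal X R" "\<And>a. a \<in> A \<Longrightarrow> \<exists>n::nat. a [^] n \<in> X"
  shows "\<exists>k. ipow (Idl A) k \<subseteq> X"
  using assms
proof (induction A rule: finite_induct)
  case empty
  then show ?case
    using ideal_zero[of X] by (intro exI[of _ "Suc 0"]) (simp add: Idl_empty zeroideal)
next
  case (insert a A)
  obtain k where k: "ipow (Idl A) k \<subseteq> X" using insert.IH insert.prems by auto
  obtain n :: nat where n: "a [^] n \<in> X" using insert.prems by blast
  have ac: "a \<in> carrier R" and Ac: "A \<subseteq> carrier R" using insert.prems by auto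
  let ?P = "PIdl a" and ?Q = "Idl A"
  have ids: "ideal ?P R" "ideal ?Q R" "ideal (?P <+> ?Q) R"
    using ac Ac by (auto intro!: ideal_closed)
  have "ipow ?P n \<subseteq> X"
    using ipow_PIdl_subset[OF ac, of n] n ac PIdl_subset_iff[of "a [^] n" X] insert.prems(2) by auto
  then have "(ipow ?P n \<cdot> ipow (?P <+> ?Q) k) <+> (ipow ?Q k \<cdot> ipow (?P <+> ?Q) n) \<subseteq> X"
    using ideal_prod_subset1[OF ideal_ipow[OF ids(1)] ideal_ipow[OF ids(3)], of n k]
      ideal_prod_subset1[OF ideal_ipow[OF ids(2)] ideal_ipow[OF ids(3)], of k n] k insert.prems(2)
    by (intro add_subset) auto
  then have "ipow (?P <+> ?Q) (n + k) \<subseteq> X"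
    using binomial_ipow_subset[OF ids(1,2), of n k] by blast
  then show ?case unfolding Idl_insert[OF ac Ac] by blast
qed

end

section \<open>Regular sequences in local rings: permutation, powers, dimension\<close>

context noetherian_local_ring
begin

text \<open>If \<open>r y\<close> lies in \<open>c\<close>, then \<open>r = s + t x\<close> with
  \<open>s\<close> in \<open>c\<close>, and cancelling \<open>x\<close> shows that \<open>t\<close>
  again annihilates \<open>y\<close> modulo \<open>c\<close>. So \<open>(c : y)\<close> is contained
  in \<open>\<mm> (c : y) + c\<close>, and Nakayama applies.\<close>

lemma colon_swap_left:
  assumes c: "ideal c R" and x: "x \<in> \<mm>" and y: "y \<in> carrier R"
    and 1: "colon c x \<subseteq> c" and 2: "colon (c <+> PIdl x) y \<subseteq> c <+> PIdl x"
  shows "colon c y \<subseteq> c"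
proof -
  have xc: "x \<in> carrier R" using ideal.Icarr[OF ideal_mm x] .
  have K: "ideal (colon c y) R" using c y by (rule ideal_colon)
  have "colon c y \<subseteq> (\<mm> \<cdot> colon c y) <+> c"
  proof
    fix r assume r: "r \<in> colon c y"
    then have rc: "r \<in> carrier R" "r \<otimes> y \<in> c" by (auto simp: colon_def)
    then have "r \<otimes> y \<in> c <+> PIdl x"
      using subset_addI1[OF c cgenideal_ideal[OF xc]] by blast
    then have "r \<in> c <+> PIdl x" using 2 rc by (auto simp: colon_def)
    then obtain s t where st: "s \<in> c" "t \<in> carrier R" "r = s \<oplus> t \<otimes> x" by (metis set_addE PIdlE)
    have sc: "s \<in> carrier R" using ideal.Icarr[OF c st(1)] .
    have "(t \<otimes> y) \<otimes> x = r \<otimes> y \<ominus> s \<otimes> y" unfolding st(3) using sc st(2) xc y by algebra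
    also have "\<dots> \<in> c" by (rule ideal_minus[OF c rc(2) ideal.I_r_closed[OF c st(1) y]])
    finally have "t \<otimes> y \<in> c" using 1 st(2) y by (auto simp: colon_def)
    then have "t \<in> colon c y" using st(2) by (simp add: colon_def)
    then have "x \<otimes> t \<oplus> s \<in> (\<mm> \<cdot> colon c y) <+> c"
      using st(1) x by (intro set_addI ideal_prod.prod)
    moreover have "x \<otimes> t \<oplus> s = r" unfolding st(3) using sc st(2) xc by algebra
    ultimately show "r \<in> (\<mm> \<cdot> colon c y) <+> c" by simp
  qed
  then show ?thesis by (rule nakayama[OF K c])
qed

text \<open>The last element moves to the front by successive transpositions, each given by
  \<open>colon_swap_left\<close> and \<open>colon_swap_right\<close>.\<close>

lemma reg_seq_rotate:
  "ideal c R \<Longrightarrow> set xs \<subseteq> \<mm> \<Longrightarrow> b \<in> carrier R \<Longrightarrow> reg_seq c (xs @ [b]) \<Longrightarrow> reg_seq c (b # xs)"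
proof (induction xs arbitrary: c)
  case (Cons x xs)
  have x: "x \<in> \<mm>" and xc: "x \<in> carrier R" using Cons.prems(2) ideal.Icarr[OF ideal_mm] by auto
  have P: "ideal (PIdl x) R" "ideal (PIdl b) R" using xc Cons.prems(3) by (auto intro: cgenideal_ideal)
  have cx: "ideal (c <+> PIdl x) R" using Cons.prems(1) P(1) by (rule add_ideals)
  have "reg_seq (c <+> PIdl x) (b # xs)" using Cons.prems cx by (intro Cons.IH) auto
  then have 2: "colon (c <+> PIdl x) b \<subseteq> c <+> PIdl x" and 3: "reg_seq (c <+> PIdl x <+> PIdl b) xs"
    by auto
  have 1: "colon c x \<subseteq> c" using Cons.prems(4) by simp
  have "c <+> PIdl x <+> PIdl b = c <+> PIdl b <+> PIdl x"
    using ideal_add_assoc[OF Cons.prems(1) P] ideal_add_assoc[OF Cons.prems(1) P(2,1)]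
      ideal_add_comm[OF P] by simp
  then show ?case
    using colon_swap_left[OF Cons.prems(1) x Cons.prems(3) 1 2]
      colon_swap_right[OF Cons.prems(1) xc Cons.prems(3) 1 2] 3 by simp
qed simp

text \<open>Replacing the last element by its \<open>n\<close>-th power multiplies the length by at
  least \<open>n\<close>. After a rotation this power joins the base ideal \<open>c\<close>, and the
  remaining elements are treated modulo it.\<close>

lemma reg_seq_pow_ilen:
  assumes "n \<ge> 1"
  shows "ideal c R \<Longrightarrow> set xs \<subseteq> \<mm> \<Longrightarrow> reg_seq c xs \<Longrightarrow>
    of_nat (n ^ length xs) * ilen (c <+> Idl (set xs)) (carrier R)
      \<le> ilen (c <+> Idl ((\<lambda>x. x [^] n) ` set xs)) (carrier R)"
proof (induction xs arbitrary: c rule: rev_induct)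
  case (snoc b xs)
  have b: "b \<in> \<mm>" and bc: "b \<in> carrier R" and xs: "set xs \<subseteq> \<mm>" and xsc: "set xs \<subseteq> carrier R"
    using snoc.prems(2) ideal_subset[OF ideal_mm] by auto
  let ?bn = "b [^] n"
  have bnc: "?bn \<in> carrier R" using bc by simp
  let ?D = "c <+> Idl (set xs)"
  have ids: "ideal (Idl (set xs)) R" "ideal (PIdl ?bn) R" "ideal ?D R" "ideal (c <+> PIdl ?bn) R"
    using xsc bnc snoc.prems(1) by (auto intro!: ideal_closed)
  have reg: "reg_seq c xs" "colon ?D b \<subseteq> ?D"
    using snoc.prems(3) reg_seq_append[OF snoc.prems(1) xsc, of "[b]"] by auto
  have "reg_seq c (xs @ [?bn])"
    using reg reg_seq_append[OF snoc.prems(1) xsc, of "[?bn]"] colon_pow_subset[OF reg(2) bc ids(3)] by simp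
  then have "reg_seq c (?bn # xs)" by (rule reg_seq_rotate[OF snoc.prems(1) xs bnc])
  then have reg': "reg_seq (c <+> PIdl ?bn) xs" by simp
  have D_eq: "?D <+> PIdl ?bn = (c <+> PIdl ?bn) <+> Idl (set xs)"
    using ideal_add_assoc[OF snoc.prems(1) ids(1,2)] ideal_add_assoc[OF snoc.prems(1) ids(2,1)]
      ideal_add_comm[OF ids(1,2)] by simp
  have D_eq': "c <+> Idl (set (xs @ [b])) = ?D <+> PIdl b"
    using add_Idl_insert[OF snoc.prems(1) bc xsc]
      ideal_add_assoc[OF snoc.prems(1) ids(1) cgenideal_ideal[OF bc]]
      ideal_add_assoc[OF snoc.prems(1) cgenideal_ideal[OF bc] ids(1)]
      ideal_add_comm[OF ids(1) cgenideal_ideal[OF bc]] by simp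
  have "of_nat (n ^ length (xs @ [b])) * ilen (c <+> Idl (set (xs @ [b]))) (carrier R)
      = of_nat (n ^ length xs) * (of_nat n * ilen (?D <+> PIdl b) (carrier R))"
    unfolding D_eq' by (simp add: mult_ac)
  also have "\<dots> \<le> of_nat (n ^ length xs) * ilen (?D <+> PIdl ?bn) (carrier R)"
    by (intro mult_left_mono ilen_pow_ge[OF ids(3) bc reg(2)]) simp
  also have "\<dots> \<le> ilen (c <+> PIdl ?bn <+> Idl ((\<lambda>x. x [^] n) ` set xs)) (carrier R)"
    unfolding D_eq by (rule snoc.IH[OF ids(4) xs reg'])
  also have "c <+> PIdl ?bn <+> Idl ((\<lambda>x. x [^] n) ` set xs) = c <+> Idl ((\<lambda>x. x [^] n) ` set (xs @ [b]))"
    using add_Idl_insert[OF snoc.prems(1) bnc, of "(\<lambda>x. x [^] n) ` set xs"] xsc by auto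
  finally show ?case .
qed simp

text \<open>\<open>R/(b\<^sub>1\<^sup>n, \<dots>, b\<^sub>d\<^sup>n)\<close> has length \<open>n\<^sup>d \<lambda>(R/J)\<close>, and the kernel of its projection onto \<open>R/J\<^sup>n\<close>
  is spanned by the monomials of degree at least \<open>n\<close> with all exponents below \<open>n\<close>.\<close>
lemma colength_ipow_reg_seq_ge:
  assumes reg: "reg_seq {\<zero>} xs" and xs: "set xs \<subseteq> \<mm>" "xs \<noteq> []" and fin: "finite_colength (Idl (set xs))"
  shows "(\<Sum>k<n. card (multi_indices (length xs) k)) * colength R (Idl (set xs))
    \<le> colength R (ipow (Idl (set xs)) n)"
proof (cases "n = 0")
  case False
  then have n1: "n \<ge> 1" by simp
  let ?d = "length xs"
  define J where "J = Idl (set xs)"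
  define a where "a i = xs ! i" for i
  define B where "B = Idl ((\<lambda>x. x [^] n) ` set xs)"
  have d: "?d \<ge> 1" using xs(2) by (cases xs) auto
  have xsc: "set xs \<subseteq> carrier R" using xs(1) ideal_subset[OF ideal_mm] by blast
  have set_xs: "set xs = a ` {..<?d}" by (auto simp: a_def set_conv_nth)
  have ac: "a i \<in> carrier R" if "i < ?d" for i using that xsc by (auto simp: a_def)
  have Bg: "(\<lambda>x. x [^] n) ` set xs \<subseteq> carrier R" using xsc by auto
  have J: "ideal J R" "finite_colength J" and B: "ideal B R"
    using fin finite_colength_ideal genideal_ideal[OF Bg] unfolding J_def B_def by auto
  \<comment> \<open>A filtration from \<open>J^n + B\<close> down to \<open>B\<close>: the quotient
    of \<open>E k\<close> by \<open>E (Suc k)\<close> is generated over \<open>R/J\<close> by the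
    monomials in \<open>Q k\<close>, the others being in \<open>B\<close>.\<close>
  define E where "E k = ipow J k <+> B" for k
  have E: "ideal (E k) R" for k unfolding E_def using J B by (intro ideal_closed)
  have E_mono: "E (Suc k) \<subseteq> E k" for k
    unfolding E_def by (intro set_add_mono ipow_antimono[OF J(1)]) auto
  define Q where "Q k = {\<alpha> \<in> multi_indices ?d k. \<forall>i<?d. \<alpha> i < n}" for k
  have in_B: "power_prod a ?d \<alpha> \<in> B" if h: "i < ?d" "n \<le> \<alpha> i" for \<alpha> i
  proof -
    let ?u = "\<lambda>j. if j = i then n else 0" and ?v = "\<lambda>j. if j = i then \<alpha> i - n else \<alpha> j"
    have "power_prod a ?d \<alpha> = power_prod a ?d (\<lambda>j. ?u j + ?v j)"
      using h(2) by (intro power_prod_cong) auto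
    also have "\<dots> = power_prod a ?d ?u \<otimes> power_prod a ?d ?v"
      by (rule power_prod_add) (rule ac)
    also have "power_prod a ?d ?u = a i [^] n"
    proof -
      have "power_prod a s ?u = (if i < s then a i [^] n else \<one>)" if "s \<le> ?d" for s
        using that by (induction s) (auto simp: less_Suc_eq ac)
      then show ?thesis using h(1) by simp
    qed
    also have "a i [^] n \<otimes> power_prod a ?d ?v \<in> B"
    proof (rule ideal.I_r_closed[OF B])
      show "a i [^] n \<in> B" using genideal_self[OF Bg] h(1) unfolding set_xs B_def by auto
      show "power_prod a ?d ?v \<in> carrier R" by (rule power_prod_closed) (rule ac)
    qed
    finally show ?thesis .
  qed
  have mon: "ipow J k = Idl (power_prod a ?d ` multi_indices ?d k)" for k
    unfolding J_def set_xs by (rule ipow_Idl) (rule ac)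
  have pc: "power_prod a ?d ` Z \<subseteq> carrier R" for Z
    using power_prod_closed[of ?d a] ac by auto
  have gen: "E k = E (Suc k) <+> Idl (power_prod a ?d ` Q k)" for k
  proof
    have I: "ideal (Idl (power_prod a ?d ` Q k)) R" using pc by (rule genideal_ideal)
    have sub: "ipow J k \<subseteq> B <+> Idl (power_prod a ?d ` Q k)"
      unfolding mon Idl_subset_iff[OF pc add_ideals[OF B I]]
    proof clarify
      fix \<alpha> assume \<alpha>: "\<alpha> \<in> multi_indices ?d k"
      show "power_prod a ?d \<alpha> \<in> B <+> Idl (power_prod a ?d ` Q k)"
      proof (cases "\<alpha> \<in> Q k")
        case True
        then show ?thesis using genideal_self[OF pc] subset_addI2[OF B I] by blast
      next
        case False
        then obtain i where "i < ?d" "n \<le> \<alpha> i" using \<alpha> by (auto simp: Q_def not_less)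
        then show ?thesis using in_B subset_addI1[OF B I] by blast
      qed
    qed
    have BE: "B \<subseteq> E (Suc k)" unfolding E_def by (rule subset_addI2[OF ideal_ipow[OF J(1)] B])
    then have "B <+> Idl (power_prod a ?d ` Q k) \<subseteq> E (Suc k) <+> Idl (power_prod a ?d ` Q k)"
      by (rule set_add_mono) simp
    with sub BE subset_addI1[OF E I, of "Suc k"]
    show "E k \<subseteq> E (Suc k) <+> Idl (power_prod a ?d ` Q k)"
      unfolding E_def[of k] by (intro add_subset add_ideals[OF E I]) auto
    have "Idl (power_prod a ?d ` Q k) \<subseteq> ipow J k"
      unfolding mon by (rule Idl_mono) (auto simp: Q_def intro: pc[THEN subsetD])
    also have "\<dots> \<subseteq> E k" unfolding E_def by (rule subset_addI1[OF ideal_ipow[OF J(1)] B])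
    finally show "E (Suc k) <+> Idl (power_prod a ?d ` Q k) \<subseteq> E k"
      using E_mono by (intro add_subset E)
  qed
  have finQ: "finite (Q k)" for k unfolding Q_def by (simp add: finite_multi_indices)
  have step: "ilen (E (Suc k)) (E k) \<le> of_nat (card (Q k)) * ilen J (carrier R)" for k
  proof -
    have "ilen (E (Suc k)) (E (Suc k) <+> Idl (power_prod a ?d ` Q k))
        \<le> of_nat (card (power_prod a ?d ` Q k)) * ilen J (carrier R)"
    proof (rule ilen_generators_le[OF finite_imageI[OF finQ] pc E J(1)])
      fix g assume "g \<in> power_prod a ?d ` Q k"
      then have g: "g \<in> ipow J k" unfolding mon using genideal_self[OF pc] by (auto simp: Q_def)
      show "J \<subseteq> colon (E (Suc k)) g"
      proof
        fix x assume x: "x \<in> J"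
        then have "x \<otimes> g \<in> ipow J (Suc k)" using g by (simp add: ipow_Suc J(1) ideal_prod.prod)
        then have "x \<otimes> g \<in> E (Suc k)"
          unfolding E_def using subset_addI1[OF ideal_ipow[OF J(1)] B] by blast
        then show "x \<in> colon (E (Suc k)) g" using ideal.Icarr[OF J(1) x] by (simp add: colon_def)
      qed
    qed
    also have "\<dots> \<le> of_nat (card (Q k)) * ilen J (carrier R)"
      by (intro mult_right_mono) (simp_all add: card_image_le finQ)
    finally show ?thesis using gen[of k] by simp
  qed
  \<comment> \<open>Pigeonhole: in degree above \<open>d n\<close> some exponent is at least
    \<open>n\<close>.\<close>
  have "ipow J (Suc (?d * n)) \<subseteq> B"
    unfolding mon Idl_subset_iff[OF pc B]
  proof clarify
    fix \<alpha> assume \<alpha>: "\<alpha> \<in> multi_indices ?d (Suc (?d * n))"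
    have "\<exists>i<?d. n \<le> \<alpha> i"
    proof (rule ccontr)
      assume "\<not> ?thesis"
      then have "(\<Sum>i<?d. \<alpha> i) \<le> (\<Sum>i<?d. n)" by (intro sum_mono) auto
      then show False using \<alpha> by (simp add: multi_indices_def)
    qed
    then show "power_prod a ?d \<alpha> \<in> B" using in_B by blast
  qed
  then have EB: "E (Suc (?d * n)) = B"
    unfolding E_def using ideal_add_comm[OF ideal_ipow[OF J(1)] B] ideal_add_absorb[OF B ideal_ipow[OF J(1)]]
    by simp
  have finE: "finite_colength (E k)" for k
    using finite_colength_mono[OF finite_colength_ipow[OF J(2)] E subset_addI1[OF ideal_ipow[OF J(1)] B, folded E_def]] .
  have stepE: "colength R (E (Suc k)) \<le> card (Q k) * colength R J + colength R (E k)" for k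
    using step[of k] colength_additive[OF finE E E_mono, of k]
    by (simp add: colength_ilen[OF J(2)] of_nat_eq_enat)
  have chain: "colength R (E (n + m)) \<le> (\<Sum>k\<in>{n..<n+m}. card (Q k)) * colength R J + colength R (E n)" for m
  proof (induction m)
    case (Suc m)
    then show ?case using stepE[of "n + m"] by (simp add: distrib_right)
  qed simp
  have nle: "n \<le> Suc (?d * n)" using d by (simp add: le_SucI)
  then obtain m where m: "Suc (?d * n) = n + m" using le_Suc_ex by blast
  have "of_nat (n ^ ?d) * ilen J (carrier R) \<le> ilen B (carrier R)"
    using reg_seq_pow_ilen[OF n1 zeroideal xs(1) reg] zero_add_ideal[OF J(1)] zero_add_ideal[OF B]
    unfolding J_def B_def by simp
  then have "n ^ ?d * colength R J \<le> colength R B"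
    using finE[of "Suc (?d * n)"] by (simp add: colength_ilen J(2) EB of_nat_eq_enat)
  also have "\<dots> \<le> (\<Sum>k\<in>{n..<n+m}. card (Q k)) * colength R J + colength R (E n)"
    using chain[of m] EB m by simp
  \<comment> \<open>Written as the number of all monomials in the box, \<open>n^d\<close> lets those
    of degree at least \<open>n\<close> cancel against the bound for \<open>E n / B\<close>.\<close>
  also have "n ^ ?d = (\<Sum>k\<le>?d * n. card (Q k))"
    unfolding Q_def by (rule sum_card_bounded_multi_indices[symmetric])
  also have "{..?d * n} = {..<n} \<union> {n..<n+m}" using m by auto
  also have "(\<Sum>k\<in>{..<n} \<union> {n..<n+m}. card (Q k)) = (\<Sum>k<n. card (Q k)) + (\<Sum>k\<in>{n..<n+m}. card (Q k))"
    by (rule sum.union_disjoint) auto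
  finally have "(\<Sum>k<n. card (Q k)) * colength R J \<le> colength R (E n)"
    by (simp add: distrib_right)
  also have "(\<Sum>k<n. card (Q k)) = (\<Sum>k<n. card (multi_indices ?d k))"
    by (rule sum.cong) (simp_all add: Q_def bounded_multi_indices)
  also have "colength R (E n) \<le> colength R (ipow J n)"
    using colength_additive(2)[OF finite_colength_ipow[OF J(2)] E
        subset_addI1[OF ideal_ipow[OF J(1)] B, folded E_def]] .
  finally show ?thesis unfolding J_def .
qed simp

text \<open>The last element \<open>x\<close> is regular modulo the ideal of the previous ones,
  which lies in \<open>p\<close>. This yields a prime strictly below \<open>p\<close> that still
  contains the previous elements, and induction continues there.\<close>

lemma reg_seq_prime_chain:
  "reg_seq {\<zero>} xs \<Longrightarrow> primeideal p R \<Longrightarrow> set xs \<subseteq> p \<Longrightarrow>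
    \<exists>P. P (length xs) = p \<and> (\<forall>i\<le>length xs. primeideal (P i) R) \<and> (\<forall>i<length xs. P i \<subset> P (Suc i))"
proof (induction xs arbitrary: p rule: rev_induct)
  case Nil
  then show ?case by (intro exI[of _ "\<lambda>_. p"]) simp
next
  case (snoc x xs)
  have pi: "ideal p R" using snoc.prems(2) by (rule primeideal.axioms)
  have x: "x \<in> p" and xc: "x \<in> carrier R" and xs: "set xs \<subseteq> p" and xsc: "set xs \<subseteq> carrier R"
    using snoc.prems(3) ideal_subset[OF pi] by auto
  let ?c = "Idl (set xs)"
  have c: "ideal ?c R" "?c \<subseteq> p" using genideal_ideal[OF xsc] Idl_subset_iff[OF xsc pi] xs by auto
  have reg: "reg_seq {\<zero>} xs" "colon ?c x \<subseteq> ?c"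
    using snoc.prems(1) reg_seq_append[OF zeroideal xsc, of "[x]"] zero_add_ideal[OF c(1)] by auto
  \<comment> \<open>Multiplicatively generated by \<open>x\<close> and the complement of
    \<open>p\<close>: a prime disjoint from it lies inside \<open>p\<close> and misses
    \<open>x\<close>.\<close>
  let ?T = "{x [^] (k::nat) \<otimes> u | k u. u \<in> carrier R - p}"
  have "\<exists>q. primeideal q R \<and> ?c \<subseteq> q \<and> q \<inter> ?T = {}"
  proof (rule prime_avoiding[OF noetherian_ring_axioms c(1)])
    show "?T \<subseteq> carrier R" using xc by auto
    have "\<one> \<notin> p" using primeideal.I_notcarr[OF snoc.prems(2)] ideal_eq_carrier[OF pi] by blast
    then have "x [^] (0::nat) \<otimes> \<one> \<in> ?T" by blast
    then show "\<one> \<in> ?T" using xc by simp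
    show "s \<otimes> t \<in> ?T" if h: "s \<in> ?T" "t \<in> ?T" for s t
    proof -
      obtain k l :: nat and u v where *: "s = x [^] k \<otimes> u" "t = x [^] l \<otimes> v"
        "u \<in> carrier R - p" "v \<in> carrier R - p" using h by blast
      have uv: "u \<in> carrier R" "v \<in> carrier R" "x [^] k \<in> carrier R" "x [^] l \<in> carrier R" using * xc by auto
      have "s \<otimes> t = (x [^] k \<otimes> x [^] l) \<otimes> (u \<otimes> v)" unfolding * using uv by (simp add: m_ac)
      also have "x [^] k \<otimes> x [^] l = x [^] (k + l)" using xc by (simp add: nat_pow_mult)
      finally have "s \<otimes> t = x [^] (k + l) \<otimes> (u \<otimes> v)" .
      moreover have "u \<otimes> v \<in> carrier R - p"
        using * primeideal.I_prime[OF snoc.prems(2), of u v] by auto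
      ultimately show ?thesis by blast
    qed
    show "?c \<inter> ?T = {}"
    proof (rule ccontr)
      assume "?c \<inter> ?T \<noteq> {}"
      then obtain k :: nat and u where *: "x [^] k \<otimes> u \<in> ?c" "u \<in> carrier R" "u \<notin> p" by blast
      then have "u \<in> colon ?c (x [^] k)" using xc by (simp add: colon_def m_comm)
      then show False using colon_pow_subset[OF reg(2) xc c(1)] c(2) * by blast
    qed
  qed
  then obtain q where q: "primeideal q R" "?c \<subseteq> q" "q \<inter> ?T = {}" by blast
  have qi: "ideal q R" using q(1) by (rule primeideal.axioms)
  have "q \<subset> p"
  proof
    show "q \<subseteq> p"
    proof (rule ccontr)
      assume "\<not> q \<subseteq> p"
      then obtain u where u: "u \<in> q" "u \<notin> p" by blast
      have uc: "u \<in> carrier R" using ideal.Icarr[OF qi u(1)] .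
      then have "x [^] (0::nat) \<otimes> u \<in> ?T" using u by blast
      then show False using u uc q(3) by auto
    qed
    have "\<one> \<notin> p" using primeideal.I_notcarr[OF snoc.prems(2)] ideal_eq_carrier[OF pi] by blast
    then have "x [^] (1::nat) \<otimes> \<one> \<in> ?T" by blast
    then have "x \<notin> q" using xc q(3) by auto
    then show "q \<noteq> p" using x by blast
  qed
  have "set xs \<subseteq> q" using q(2) genideal_self[OF xsc] by blast
  from snoc.IH[OF reg(1) q(1) this] obtain P where P: "P (length xs) = q"
    "\<forall>i\<le>length xs. primeideal (P i) R" "\<forall>i<length xs. P i \<subset> P (Suc i)" by blast
  show ?case
    using P \<open>q \<subset> p\<close> snoc.prems(2)
    by (intro exI[of _ "P(Suc (length xs) := p)"]) (auto simp: less_Suc_eq le_Suc_eq)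
qed

text \<open>A prime other than \<open>\<mm>\<close> that contains the sequence would end a chain of
  \<open>length xs\<close> steps, and \<open>\<mm>\<close> would extend it beyond the dimension.
  With \<open>\<mm>\<close> as the only prime above, every generator of \<open>\<mm>\<close> has a
  power in the ideal.\<close>

lemma finite_colength_reg_seq:
  assumes dim: "krull_dim R = enat (length xs)" and reg: "reg_seq {\<zero>} xs" and xs: "set xs \<subseteq> \<mm>"
  shows "finite_colength (Idl (set xs))"
proof -
  have xsc: "set xs \<subseteq> carrier R" using xs ideal_subset[OF ideal_mm] by blast
  let ?J = "Idl (set xs)"
  have J: "ideal ?J R" using xsc by (rule genideal_ideal)
  have only: "p = \<mm>" if p: "primeideal p R" "?J \<subseteq> p" for p
  proof (rule ccontr)
    assume "p \<noteq> \<mm>"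
    have "p \<noteq> carrier R" "ideal p R" using primeideal.I_notcarr[OF p(1)] primeideal.axioms(1)[OF p(1)] by auto
    then have "p \<subset> \<mm>" using proper_subset_mm \<open>p \<noteq> \<mm>\<close> by blast
    have "set xs \<subseteq> p" using p(2) genideal_self[OF xsc] by blast
    from reg_seq_prime_chain[OF reg p(1) this] obtain P where P: "P (length xs) = p"
      "\<forall>i\<le>length xs. primeideal (P i) R" "\<forall>i<length xs. P i \<subset> P (Suc i)" by blast
    let ?P = "P(Suc (length xs) := \<mm>)"
    have "\<exists>P. (\<forall>i\<le>Suc (length xs). primeideal (P i) R) \<and> (\<forall>i<Suc (length xs). P i \<subset> P (Suc i))"
      using P \<open>p \<subset> \<mm>\<close> maximalideal_prime[OF maximal]
      by (intro exI[of _ ?P]) (auto simp: less_Suc_eq le_Suc_eq)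
    then have "enat (Suc (length xs)) \<le> krull_dim R"
      unfolding krull_dim_def by (intro Sup_upper) blast
    then show False using dim by simp
  qed
  obtain A where A: "A \<subseteq> carrier R" "finite A" "\<mm> = Idl A" using finetely_gen[OF ideal_mm] by blast
  have "\<exists>k. ipow (Idl A) k \<subseteq> ?J"
  proof (rule ipow_Idl_subset_of_powers[OF A(2,1) J], rule ccontr)
    fix a assume a: "a \<in> A" and neg: "\<not> (\<exists>n::nat. a [^] n \<in> ?J)"
    have am: "a \<in> \<mm>" and ac: "a \<in> carrier R" using a A genideal_self[OF A(1)] by auto
    let ?T = "range (\<lambda>n::nat. a [^] n)"
    have "\<exists>p. primeideal p R \<and> ?J \<subseteq> p \<and> p \<inter> ?T = {}"
    proof (rule prime_avoiding[OF noetherian_ring_axioms J])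
      show "?T \<subseteq> carrier R" using ac by auto
      show "\<one> \<in> ?T" by (rule image_eqI[of _ _ 0]) auto
      show "s \<otimes> t \<in> ?T" if "s \<in> ?T" "t \<in> ?T" for s t
        using that ac by (auto simp: nat_pow_mult)
      show "?J \<inter> ?T = {}" using neg by auto
    qed
    then obtain p where p: "primeideal p R" "?J \<subseteq> p" "p \<inter> ?T = {}" by blast
    have "a [^] (1::nat) \<notin> p" using p(3) by blast
    then show False using only[OF p(1,2)] am ac by simp
  qed
  then have "\<exists>k. ipow \<mm> k \<subseteq> ?J" unfolding A(3)[symmetric] .
  then show ?thesis using J by (simp add: finite_colength_def)
qed

text \<open>A finite positive supremum of lengths is attained: otherwise \<open>d - 1\<close> would
  be an upper bound. The indexed definition of regularity is then converted from the end of the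
  list.\<close>

lemma obtain_reg_seq:
  assumes "depth R \<mm> = enat d" "d > 0"
  obtains xs where "length xs = d" "set xs \<subseteq> \<mm>" "reg_seq {\<zero>} xs"
proof -
  have "\<exists>xs. regular_sequence R xs \<and> set xs \<subseteq> \<mm> \<and> length xs = d"
  proof (rule ccontr)
    assume neg: "\<not> ?thesis"
    have "depth R \<mm> \<le> enat (d - 1)"
      unfolding depth_def
    proof (rule Sup_least, clarify)
      fix xs assume *: "regular_sequence R xs" "set xs \<subseteq> \<mm>"
      then have "enat (length xs) \<le> depth R \<mm>" unfolding depth_def by (intro Sup_upper) blast
      then have "length xs \<le> d" using assms(1) by simp
      moreover have "length xs \<noteq> d" using neg * by blast
      ultimately show "enat (length xs) \<le> enat (d - 1)" by simp
    qed
    then show False using assms by simp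
  qed
  then obtain xs where xs: "regular_sequence R xs" "set xs \<subseteq> \<mm>" "length xs = d" by blast
  have "reg_seq {\<zero>} ys"
    if "set ys \<subseteq> carrier R" "\<forall>i<length ys. \<forall>r\<in>carrier R.
        r \<otimes> (ys ! i) \<in> Idl (set (take i ys)) \<longrightarrow> r \<in> Idl (set (take i ys))" for ys
    using that
  proof (induction ys rule: rev_induct)
    case (snoc y ys)
    have ys: "set ys \<subseteq> carrier R" "y \<in> carrier R" using snoc.prems(1) by auto
    have "reg_seq {\<zero>} ys"
    proof (rule snoc.IH[OF ys(1)], intro allI impI ballI)
      fix i r assume "i < length ys" "r \<in> carrier R" "r \<otimes> (ys ! i) \<in> Idl (set (take i ys))"
      then show "r \<in> Idl (set (take i ys))" using snoc.prems(2)[rule_format, of i r] by (simp add: nth_append)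
    qed
    moreover have "colon (Idl (set ys)) y \<subseteq> Idl (set ys)"
      using snoc.prems(2)[rule_format, of "length ys"] by (auto simp: colon_def)
    ultimately show ?case
      using reg_seq_append[OF zeroideal ys(1), of "[y]"] zero_add_ideal[OF genideal_ideal[OF ys(1)]] by simp
  qed simp
  then have "reg_seq {\<zero>} xs" using xs(1) unfolding regular_sequence_def by blast
  then show thesis using that xs by blast
qed

end

section \<open>Reductions\<close>

text \<open>The top digit is the quotient by \<open>B ^ s\<close>, since the lower digits together
  stay below \<open>B ^ s\<close>.\<close>

lemma base_digits_unique:
  fixes x y :: "nat \<Rightarrow> nat"
  assumes "(\<Sum>i<s. x i * B ^ i) = (\<Sum>i<s. y i * B ^ i)" "\<And>i. i < s \<Longrightarrow> x i < B" "\<And>i. i < s \<Longrightarrow> y i < B"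
    and "i < s"
  shows "x i = y i"
  using assms
proof (induction s)
  case (Suc s)
  have lt: "(\<Sum>i<s. z i * B ^ i) < B ^ s" if "\<And>i. i < s \<Longrightarrow> z i < B" for z :: "nat \<Rightarrow> nat" and s
    using that
  proof (induction s)
    case (Suc s)
    have "Suc (z s) * B ^ s \<le> B * B ^ s" using Suc.prems[of s] by (intro mult_right_mono) auto
    moreover have "(\<Sum>i<s. z i * B ^ i) < B ^ s" using Suc by auto
    ultimately show ?case by simp
  qed simp
  have x: "(\<Sum>i<s. x i * B ^ i) < B ^ s" and y: "(\<Sum>i<s. y i * B ^ i) < B ^ s"
    using lt[of s x] lt[of s y] Suc.prems(2,3) by auto
  have eq: "(\<Sum>i<s. x i * B ^ i) + x s * B ^ s = (\<Sum>i<s. y i * B ^ i) + y s * B ^ s"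
    using Suc.prems(1) by simp
  have "B ^ s \<noteq> 0" using x by (metis not_less_zero)
  then have "x s = ((\<Sum>i<s. x i * B ^ i) + x s * B ^ s) div B ^ s" using x by simp
  also have "\<dots> = y s" unfolding eq using y \<open>B ^ s \<noteq> 0\<close> by simp
  finally have "x s = y s" .
  then show ?case using eq Suc by (cases "i = s") auto
qed simp

section \<open>Polynomial values and the infinite residue field\<close>

context cring
begin

text \<open>Values are taken in \<open>R\<close>, where the relations to be evaluated hold modulo
  ideals; the residue field enters only through the coefficients.\<close>

primrec poly_sum :: "nat \<Rightarrow> (nat \<Rightarrow> 'a) \<Rightarrow> 'a \<Rightarrow> 'a" where
  "poly_sum 0 u x = u 0"
| "poly_sum (Suc n) u x = u (Suc n) \<otimes> x [^] Suc n \<oplus> poly_sum n u x"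

lemma poly_sum_closed: "(\<And>j. u j \<in> carrier R) \<Longrightarrow> x \<in> carrier R \<Longrightarrow> poly_sum n u x \<in> carrier R"
  by (induction n) auto

lemma poly_sum_add:
  assumes "\<And>j. u j \<in> carrier R" "\<And>j. v j \<in> carrier R" "x \<in> carrier R"
  shows "poly_sum n (\<lambda>j. u j \<oplus> v j) x = poly_sum n u x \<oplus> poly_sum n v x"
proof (induction n)
  case (Suc n)
  have "poly_sum n u x \<in> carrier R" "poly_sum n v x \<in> carrier R" "x [^] Suc n \<in> carrier R"
    "u (Suc n) \<in> carrier R" "v (Suc n) \<in> carrier R"
    using assms by (auto intro: poly_sum_closed simp del: nat_pow_Suc)
  then show ?case using Suc by (simp add: l_distr a_ac del: nat_pow_Suc)
qed simp

lemma poly_sum_smult: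
  assumes "\<And>j. u j \<in> carrier R" "r \<in> carrier R" "x \<in> carrier R"
  shows "poly_sum n (\<lambda>j. r \<otimes> u j) x = r \<otimes> poly_sum n u x"
proof (induction n)
  case (Suc n)
  have "poly_sum n u x \<in> carrier R" "x [^] Suc n \<in> carrier R" "u (Suc n) \<in> carrier R"
    using assms by (auto intro: poly_sum_closed simp del: nat_pow_Suc)
  then show ?case using Suc assms(2) by (simp add: r_distr m_assoc del: nat_pow_Suc)
qed simp

lemma poly_sum_zero: "x \<in> carrier R \<Longrightarrow> (\<And>j. j \<le> n \<Longrightarrow> u j = \<zero>) \<Longrightarrow> poly_sum n u x = \<zero>"
  by (induction n) (auto simp del: nat_pow_Suc)

lemma poly_sum_delta:
  assumes "x \<in> carrier R" "k \<le> n"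
  shows "poly_sum n (\<lambda>j. if j = k then \<one> else \<zero>) x = x [^] k"
  using assms(2)
proof (induction n)
  case (Suc n)
  have "x [^] Suc n \<in> carrier R" using assms(1) by simp
  show ?case
  proof (cases "k = Suc n")
    case True
    have "poly_sum n (\<lambda>j. if j = k then \<one> else \<zero>) x = \<zero>"
      using True assms(1) by (intro poly_sum_zero) auto
    then show ?thesis using True assms(1) by (simp del: nat_pow_Suc)
  next
    case False
    then have "k \<le> n" using Suc.prems by simp
    from Suc.IH[OF this] show ?thesis using False assms(1) by (simp del: nat_pow_Suc)
  qed
qed simp

end

context noetherian_local_ring
begin

text \<open>Over the infinite residue field a nonzero polynomial has a non-root. Leading
  coefficients in \<open>\<mm>\<close> are dropped first, as they do not affect membership in
  \<open>\<mm>\<close>.\<close>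

lemma exists_poly_sum_notin_mm:
  assumes inf: "infinite (carrier (R Quot \<mm>))" and u: "\<And>j. u j \<in> carrier R"
    and k: "k \<le> n" "u k \<notin> \<mm>"
  shows "\<exists>x\<in>carrier R. poly_sum n u x \<notin> \<mm>"
proof -
  interpret M: maximalideal \<mm> R by (rule maximal)
  interpret F: field "R Quot \<mm>" by (rule M.quotient_is_field[OF is_cring])
  interpret h: ring_hom_ring R "R Quot \<mm>" "(+>) \<mm>" by (rule M.rcos_ring_hom_ring)
  have zero: "\<zero>\<^bsub>R Quot \<mm>\<^esub> = \<mm>" unfolding FactRing_def by simp
  have top: "\<exists>x\<in>carrier R. poly_sum n u x \<notin> \<mm>" if "u n \<notin> \<mm>" for n
  proof -
    \<comment> \<open>Polynomials are represented here by coefficient lists with the leading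
      coefficient first, hence \<open>rev\<close>.\<close>
    define p where "p m = map (\<lambda>j. \<mm> +> u j) (rev [0..<Suc m])" for m
    have p0: "p 0 = [\<mm> +> u 0]" and pS: "p (Suc m) = (\<mm> +> u (Suc m)) # p m" for m
      by (simp_all add: p_def)
    have len: "length (p m) = Suc m" for m by (simp add: p_def)
    have ev: "F.eval (p m) (\<mm> +> x) = \<mm> +> poly_sum m u x" if "x \<in> carrier R" for m x
    proof (induction m)
      case 0
      then show ?case using u by (simp add: p0)
    next
      case (Suc m)
      have "poly_sum m u x \<in> carrier R" using u that by (rule poly_sum_closed)
      then show ?case using Suc u that by (simp add: pS len del: nat_pow_Suc F.nat_pow_Suc add: h.hom_nat_pow)
    qed
    have "\<mm> +> u n \<noteq> \<mm>" using that u M.a_rcos_self by metis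
    then have "hd (p n) \<noteq> \<zero>\<^bsub>R Quot \<mm>\<^esub>"
      unfolding zero by (cases n) (simp_all add: p0 pS)
    moreover have "set (p n) \<subseteq> carrier (R Quot \<mm>)" using u by (auto simp: p_def)
    ultimately have "p n \<in> carrier (poly_ring (R Quot \<mm>))"
      unfolding univ_poly_carrier[symmetric] polynomial_def by simp
    then have "finite {x. F.is_root (p n) x}" by (rule F.finite_number_of_roots)
    then have "\<not> carrier (R Quot \<mm>) \<subseteq> {x. F.is_root (p n) x}" using inf finite_subset by blast
    then obtain z where z: "z \<in> carrier (R Quot \<mm>)" "\<not> F.is_root (p n) z" by blast
    then obtain x where x: "x \<in> carrier R" "z = \<mm> +> x"
      by (auto simp: FactRing_def A_RCOSETS_def' a_r_coset_def')
    have "p n \<noteq> []" using len[of n] by auto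
    then have "\<mm> +> poly_sum n u x \<noteq> \<mm>" using z x ev zero by (simp add: F.is_root_def)
    then show ?thesis using x(1) M.a_rcos_const by blast
  qed
  show ?thesis
    using k
  proof (induction n)
    case 0
    then show ?case using top[of 0] by simp
  next
    case (Suc n)
    show ?case
    proof (cases "u (Suc n) \<in> \<mm>")
      case True
      then have "k \<le> n" using Suc.prems by (metis le_SucE)
      then obtain x where x: "x \<in> carrier R" "poly_sum n u x \<notin> \<mm>" using Suc by blast
      have t: "u (Suc n) \<otimes> x [^] Suc n \<in> \<mm>"
        using True x(1) by (intro ideal.I_r_closed[OF ideal_mm]) auto
      have "poly_sum (Suc n) u x \<notin> \<mm>"
      proof
        assume "poly_sum (Suc n) u x \<in> \<mm>"
        then have "poly_sum (Suc n) u x \<ominus> u (Suc n) \<otimes> x [^] Suc n \<in> \<mm>"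
          using t by (intro ideal_minus[OF ideal_mm])
        moreover have "poly_sum (Suc n) u x \<ominus> u (Suc n) \<otimes> x [^] Suc n = poly_sum n u x"
          using add_minus_cancel_left[OF ideal.Icarr[OF ideal_mm t] poly_sum_closed[OF u x(1)]] by simp
        ultimately show False using x(2) by simp
      qed
      then show ?thesis using x(1) by blast
    qed (rule top)
  qed
qed

end

section \<open>Congruences between monomials and reductions modulo an ideal\<close>

context cring
begin

text \<open>Exchanging one factor for a congruent one turns one factor from \<open>J\<close> into
  one from \<open>D\<close>; the degrees of the other factors are kept.\<close>

lemma power_congruence:
  assumes D: "ideal D R" and J: "ideal J R"
    and p: "p \<in> ipow J m" "p' \<in> ipow J m" "p \<ominus> p' \<in> D \<cdot> ipow J (m - 1)"
    and q: "q \<in> ipow J k" "q' \<in> ipow J k" "q \<ominus> q' \<in> D \<cdot> ipow J (k - 1)"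
  shows "p \<otimes> q \<in> ipow J (m + k)" "p' \<otimes> q' \<in> ipow J (m + k)"
    "p \<otimes> q \<ominus> p' \<otimes> q' \<in> D \<cdot> ipow J (m + k - 1)"
proof -
  show "p \<otimes> q \<in> ipow J (m + k)" "p' \<otimes> q' \<in> ipow J (m + k)"
    unfolding ipow_add[OF J] using p q by (auto intro: ideal_prod.prod)
  note I = ideal_ipow[OF J]
  have car: "p \<in> carrier R" "p' \<in> carrier R" "q \<in> carrier R" "q' \<in> carrier R"
    using ideal.Icarr[OF I] p q by auto
  have "p \<otimes> q \<ominus> p' \<otimes> q' = (p \<ominus> p') \<otimes> q \<oplus> (q \<ominus> q') \<otimes> p'"
    using car by algebra
  moreover have "(p \<ominus> p') \<otimes> q \<in> D \<cdot> ipow J (m + k - 1)"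
  proof -
    have "(p \<ominus> p') \<otimes> q \<in> (D \<cdot> ipow J (m - 1)) \<cdot> ipow J k" using p q by (intro ideal_prod.prod)
    also have "\<dots> = D \<cdot> ipow J (m - 1 + k)" using D I by (simp add: ideal_prod_assoc ipow_add J)
    \<comment> \<open>For \<open>m = 0\<close> truncated subtraction makes the exponent on the left
      the larger one, so this is only an inclusion.\<close>
    also have "\<dots> \<subseteq> D \<cdot> ipow J (m + k - 1)"
      by (intro ideal_prod_mono ipow_antimono[OF J]) auto
    finally show ?thesis .
  qed
  moreover have "(q \<ominus> q') \<otimes> p' \<in> D \<cdot> ipow J (m + k - 1)"
  proof -
    have "(q \<ominus> q') \<otimes> p' \<in> (D \<cdot> ipow J (k - 1)) \<cdot> ipow J m" using p q by (intro ideal_prod.prod)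
    also have "\<dots> = D \<cdot> ipow J (k - 1 + m)" using D I by (simp add: ideal_prod_assoc ipow_add J)
    also have "\<dots> \<subseteq> D \<cdot> ipow J (m + k - 1)"
      by (intro ideal_prod_mono ipow_antimono[OF J]) auto
    finally show ?thesis .
  qed
  ultimately show "p \<otimes> q \<ominus> p' \<otimes> q' \<in> D \<cdot> ipow J (m + k - 1)"
    using D I by (simp add: ideal_add_closed ideal_prod_is_ideal)
qed

lemma pow_congruence:
  assumes D: "ideal D R" and J: "ideal J R" and x: "x \<in> J" "y \<in> J" "x \<ominus> y \<in> D"
  shows "x [^] k \<in> ipow J k \<and> y [^] k \<in> ipow J k \<and> x [^] k \<ominus> y [^] (k::nat) \<in> D \<cdot> ipow J (k - 1)"
proof (induction k)
  case 0
  show ?case using ideal_zero[OF D] D by (simp add: minus_eq r_neg ideal_prod_one)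
next
  case (Suc k)
  have 1: "x \<in> ipow J 1" "y \<in> ipow J 1" "x \<ominus> y \<in> D \<cdot> ipow J (1 - 1)"
    using x D J by (simp_all add: ideal_prod_one)
  show ?case using power_congruence[OF D J Suc[THEN conjunct1] Suc[THEN conjunct2, THEN conjunct1]
        Suc[THEN conjunct2, THEN conjunct2] 1] by simp
qed

lemma power_prod_congruence:
  assumes D: "ideal D R" and J: "ideal J R"
    and a: "\<And>i. i < s \<Longrightarrow> a i \<in> J" "\<And>i. i < s \<Longrightarrow> b i \<in> J" "\<And>i. i < s \<Longrightarrow> a i \<ominus> b i \<in> D"
  shows "power_prod a s \<alpha> \<in> ipow J (\<Sum>i<s. \<alpha> i) \<and> power_prod b s \<alpha> \<in> ipow J (\<Sum>i<s. \<alpha> i) \<and>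
    power_prod a s \<alpha> \<ominus> power_prod b s \<alpha> \<in> D \<cdot> ipow J ((\<Sum>i<s. \<alpha> i) - 1)"
  using a
proof (induction s)
  case 0
  show ?case using ideal_zero[OF D] D by (simp add: minus_eq r_neg ideal_prod_one)
next
  case (Suc s)
  then have IH: "power_prod a s \<alpha> \<in> ipow J (\<Sum>i<s. \<alpha> i)" "power_prod b s \<alpha> \<in> ipow J (\<Sum>i<s. \<alpha> i)"
    "power_prod a s \<alpha> \<ominus> power_prod b s \<alpha> \<in> D \<cdot> ipow J ((\<Sum>i<s. \<alpha> i) - 1)" by auto
  note P = pow_congruence[OF D J Suc.prems(1,2,3)[of s], of "\<alpha> s"]
  show ?case using power_congruence[OF D J IH, of "a s [^] \<alpha> s" "\<alpha> s" "b s [^] \<alpha> s"] P by simp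
qed

lemma power_prod_scaled:
  assumes "y \<in> carrier R" "l \<in> carrier R"
  shows "power_prod (\<lambda>i. l [^] (W i :: nat) \<otimes> y) s \<alpha> = l [^] (\<Sum>i<s. \<alpha> i * W i) \<otimes> y [^] (\<Sum>i<s. \<alpha> i)"
proof (induction s)
  case (Suc s)
  have "(l [^] W s \<otimes> y) [^] \<alpha> s = l [^] (\<alpha> s * W s) \<otimes> y [^] \<alpha> s"
    using assms by (simp add: nat_pow_distrib nat_pow_pow mult.commute)
  then show ?case using Suc assms by (simp add: nat_pow_mult[symmetric] m_ac)
qed (use assms in simp)

text \<open>Each element lies outside the ideal reached before it, so adjoining the elements one by
  one gives a strict chain.\<close>

lemma card_le_ilen_independent:
  assumes "finite X" "\<And>x. x \<in> X \<Longrightarrow> g x \<in> carrier R" "ideal B R"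
    and "\<And>x. x \<in> X \<Longrightarrow> g x \<notin> B <+> Idl (g ` (X - {x}))"
  shows "enat (card X) \<le> ilen B (B <+> Idl (g ` X))"
  using assms
proof (induction X rule: finite_induct)
  case (insert x X)
  have gx: "g x \<in> carrier R" and gX: "g ` X \<subseteq> carrier R" using insert.prems(1) by auto
  let ?C = "B <+> Idl (g ` X)" and ?A = "B <+> Idl (g ` insert x X)"
  have sub: "g ` (X - {y}) \<subseteq> g ` (insert x X - {y})" for y by auto
  have gI: "g ` insert x X \<subseteq> carrier R" using gx gX by auto
  have I: "ideal (Idl (g ` X)) R" "ideal (Idl (g ` insert x X)) R"
    using genideal_ideal gX gI by blast+
  have ids: "ideal ?C R" "ideal ?A R" using insert.prems(2) I by (auto intro: add_ideals)
  have IH: "enat (card X) \<le> ilen B ?C"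
  proof (rule insert.IH)
    fix y assume y: "y \<in> X"
    have "B <+> Idl (g ` (X - {y})) \<subseteq> B <+> Idl (g ` (insert x X - {y}))"
      using gI by (intro set_add_mono order_refl Idl_mono sub) auto
    then show "g y \<notin> B <+> Idl (g ` (X - {y}))" using insert.prems(3)[of y] y by blast
  qed (use insert.prems in auto)
  have "g x \<notin> ?C" using insert.prems(3)[of x] insert.hyps(2) by simp
  moreover have "g x \<in> ?A" using genideal_self[OF gI] subset_addI2[OF insert.prems(2) I(2)] by auto
  moreover have le: "?C \<subseteq> ?A" using gI by (intro set_add_mono order_refl Idl_mono) auto
  ultimately have "1 \<le> ilen ?C ?A" using ids by (intro ilen_ge_1) auto
  with IH have "enat (card X) + 1 \<le> ilen B ?C + ilen ?C ?A" by (rule add_mono)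
  also have "\<dots> = ilen B ?A"
    by (rule ilen_additive[symmetric, OF ids(2,1) insert.prems(2) subset_addI1[OF insert.prems(2) I(1)] le])
  finally show ?case using insert.hyps by (simp add: one_enat_def)
qed (simp add: zero_enat_def[symmetric])

text \<open>The base ideal \<open>c\<close> serves two uses: \<open>c = {\<zero>}\<close> gives a
  reduction of \<open>K\<close>, and the ideal of \<open>d - 1\<close> regular elements gives the
  exchange step.\<close>

definition reduction_mod :: "'a set \<Rightarrow> 'a set \<Rightarrow> nat \<Rightarrow> (nat \<Rightarrow> 'a) \<Rightarrow> bool" where
  "reduction_mod c J s a \<longleftrightarrow> (\<forall>i<s. a i \<in> J) \<and>
     (\<exists>n. ipow J (Suc n) \<subseteq> ((Idl (a ` {..<s})) \<cdot> ipow J n) <+> c)"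

text \<open>The containment is iterated, and all new terms in \<open>c\<close> are absorbed. Here
  \<open>K\<close> plays the part of the reduction and \<open>J\<close> that of the ideal being
  reduced.\<close>

lemma ipow_subset_of_reduction:
  assumes K: "ideal K R" and J: "ideal J R" and c: "ideal c R" and r: "ipow J (Suc n) \<subseteq> (K \<cdot> ipow J n) <+> c"
  shows "ipow J (n + k) \<subseteq> (ipow K k \<cdot> ipow J n) <+> c"
proof (induction k)
  case 0
  show ?case using subset_addI1[OF ideal_ipow[OF J] c, of n] by (simp add: one_prod J)
next
  case (Suc k)
  note I = ideal_ipow[OF J]
  have "ipow J (n + Suc k) = ipow J k \<cdot> ipow J (Suc n)"
    using ipow_add[OF J, of k "Suc n"] by (simp add: add.commute)
  also have "\<dots> \<subseteq> ipow J k \<cdot> ((K \<cdot> ipow J n) <+> c)"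
    by (rule ideal_prod_mono[OF order_refl r])
  also have "\<dots> = (ipow J k \<cdot> (K \<cdot> ipow J n)) <+> (ipow J k \<cdot> c)"
    by (rule ideal_prod_distr(1)) (auto intro: I c ideal_prod_is_ideal K)
  also have "\<dots> \<subseteq> (K \<cdot> ipow J (n + k)) <+> c"
  proof (rule set_add_mono)
    have "ipow J k \<cdot> (K \<cdot> ipow J n) = K \<cdot> (ipow J k \<cdot> ipow J n)"
      by (metis I K ideal_prod_assoc ideal_prod_commute)
    then show "ipow J k \<cdot> (K \<cdot> ipow J n) \<subseteq> K \<cdot> ipow J (n + k)"
      using ipow_add[OF J, of k n] by (simp add: add.commute)
    show "ipow J k \<cdot> c \<subseteq> c" by (rule ideal_prod_subset2[OF I c])
  qed
  also have "\<dots> \<subseteq> (K \<cdot> ((ipow K k \<cdot> ipow J n) <+> c)) <+> c"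
    by (intro set_add_mono ideal_prod_mono order_refl Suc.IH)
  also have "\<dots> \<subseteq> (ipow K (Suc k) \<cdot> ipow J n) <+> c"
  proof (rule add_subset)
    have ids: "ideal (ipow K k \<cdot> ipow J n) R" "ideal (ipow K (Suc k) \<cdot> ipow J n) R"
      using K I by (auto intro: ideal_prod_is_ideal ideal_ipow)
    show "ideal ((ipow K (Suc k) \<cdot> ipow J n) <+> c) R" using ids c by (intro add_ideals)
    have "K \<cdot> ((ipow K k \<cdot> ipow J n) <+> c) = (K \<cdot> (ipow K k \<cdot> ipow J n)) <+> (K \<cdot> c)"
      by (rule ideal_prod_distr(1)[OF K ids(1) c])
    also have "K \<cdot> (ipow K k \<cdot> ipow J n) = ipow K (Suc k) \<cdot> ipow J n"
      using K I by (simp add: ipow_Suc ideal_prod_assoc)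
    finally show "K \<cdot> ((ipow K k \<cdot> ipow J n) <+> c) \<subseteq> (ipow K (Suc k) \<cdot> ipow J n) <+> c"
      using ideal_prod_subset2[OF K c] set_add_mono by blast
    show "c \<subseteq> (ipow K (Suc k) \<cdot> ipow J n) <+> c" by (rule subset_addI2[OF ids(2) c])
  qed
  finally show ?case .
qed

end

context noetherian_local_ring
begin

text \<open>A monomial of degree \<open>e\<close> that depends on the others modulo \<open>\<mm> J\<^sup>e + c\<close> gives a homogeneous
  relation over the infinite residue field. Substituting
  \<open>a\<^sub>i = a'\<^sub>i + l\<^bsup>B^i\<^esup> a\<^sub>t\<close> with \<open>B > e\<close> turns it into a nonzero polynomial in \<open>l\<close> times
  \<open>a\<^sub>t\<^sup>e\<close>, up to \<open>(a'\<^sub>0, \<dots>, a'\<^sub>t\<^sub>-\<^sub>1) J\<^sup>e\<^sup>-\<^sup>1\<close>. For suitable \<open>l\<close> it follows that \<open>a\<^sub>t\<close> is superfluous.\<close>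
lemma reduction_mod_dependent:
  assumes inf: "infinite (carrier (R Quot \<mm>))" and J: "ideal J R" and c: "ideal c R"
    and red: "reduction_mod c J (Suc t) a" and e: "e \<ge> 1" and \<beta>: "\<beta> \<in> multi_indices (Suc t) e"
    and dep: "power_prod a (Suc t) \<beta> \<in> ((\<mm> \<cdot> ipow J e) <+> c)
        <+> Idl (power_prod a (Suc t) ` (multi_indices (Suc t) e - {\<beta>}))"
  shows "\<exists>a'. reduction_mod c J t a'"
proof -
  define s where "s = Suc t"
  define y where "y = a t"
  define B where "B = Suc e"
  \<comment> \<open>These weights read an exponent as a number in base \<open>B\<close>; since the
    digits are at most \<open>e < B\<close> and the degree is fixed, \<open>w\<close> separates
    monomials. \<open>W t = 0\<close> leaves \<open>a t\<close> itself unchanged.\<close>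
  define W where "W i = (if i < t then B ^ i else 0)" for i
  define w where "w \<alpha> = (\<Sum>i<s. \<alpha> i * W i)" for \<alpha>
  define M where "M = multi_indices s e"
  define N where "N = (\<Sum>\<alpha>\<in>M. w \<alpha>)"
  \<comment> \<open>Generated by the new elements. Modulo \<open>D l\<close> each \<open>a i\<close>
    becomes a multiple of \<open>y\<close>, so modulo \<open>T l\<close> a monomial of exponent
    \<open>\<alpha>\<close> becomes \<open>l^(w \<alpha>) y^e\<close>.\<close>
  define D where "D l = Idl ((\<lambda>i. a i \<ominus> l [^] W i \<otimes> y) ` {..<t})" for l
  define T where "T l = D l \<cdot> ipow J (e - 1)" for l
  obtain n0 where aJ: "\<And>i. i < s \<Longrightarrow> a i \<in> J"
    and n0: "ipow J (Suc n0) \<subseteq> ((Idl (a ` {..<s})) \<cdot> ipow J n0) <+> c"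
    using red by (auto simp: reduction_mod_def s_def)
  have ac: "a i \<in> carrier R" if "i < s" for i using ideal.Icarr[OF J aJ[OF that]] .
  have y: "y \<in> J" "y \<in> carrier R" using aJ[of t] ac[of t] by (auto simp: y_def s_def)
  have finM: "finite M" unfolding M_def by (rule finite_multi_indices)
  have wN: "w \<alpha> \<le> N" if "\<alpha> \<in> M" for \<alpha> unfolding N_def using finM that by (intro member_le_sum) auto
  have w_inj: "\<alpha> = \<alpha>'" if h: "\<alpha> \<in> M" "\<alpha>' \<in> M" "w \<alpha> = w \<alpha>'" for \<alpha> \<alpha>'
  proof -
    have le: "\<gamma> i < B" if g: "\<gamma> \<in> M" "i < t" for \<gamma> i
    proof -
      have "\<gamma> i \<le> (\<Sum>i<s. \<gamma> i)" using g(2) by (intro member_le_sum) (auto simp: s_def)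
      then show ?thesis using g(1) by (simp add: M_def multi_indices_def B_def)
    qed
    have "w \<gamma> = (\<Sum>i<t. \<gamma> i * B ^ i)" for \<gamma> unfolding w_def s_def by (simp add: W_def)
    then have eq: "\<alpha> i = \<alpha>' i" if "i < t" for i
      using base_digits_unique[of \<alpha> B t \<alpha>' i] h le that by simp
    moreover have "\<alpha> t = \<alpha>' t"
    proof -
      have "(\<Sum>i<t. \<alpha> i) + \<alpha> t = (\<Sum>i<t. \<alpha>' i) + \<alpha>' t"
        using h(1,2) by (simp add: M_def multi_indices_def s_def)
      moreover have "(\<Sum>i<t. \<alpha> i) = (\<Sum>i<t. \<alpha>' i)" using eq by simp
      ultimately show ?thesis by simp
    qed
    moreover have "\<alpha> i = \<alpha>' i" if "i > t" for i
      using h(1,2) that by (simp add: M_def multi_indices_def s_def)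
    ultimately show ?thesis by (metis ext linorder_neqE_nat)
  qed
  have Dg: "(\<lambda>i. a i \<ominus> l [^] W i \<otimes> y) ` {..<t} \<subseteq> carrier R" if "l \<in> carrier R" for l
    using ac y that by (auto simp: s_def)
  have D: "ideal (D l) R" if "l \<in> carrier R" for l
    unfolding D_def by (rule genideal_ideal[OF Dg[OF that]])
  have Ti: "ideal (T l) R" if "l \<in> carrier R" for l
    unfolding T_def using D[OF that] J by (intro ideal_prod_is_ideal ideal_ipow)
  have cong: "power_prod a s \<alpha> \<ominus> l [^] w \<alpha> \<otimes> y [^] e \<in> T l" if h: "l \<in> carrier R" "\<alpha> \<in> M" for l \<alpha>
  proof -
    have "a i \<ominus> l [^] W i \<otimes> y \<in> D l" if "i < s" for i
    proof (cases "i < t")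
      case True
      then show ?thesis unfolding D_def using genideal_self[OF Dg[OF h(1)]] by blast
    next
      case False
      then have "i = t" using that by (simp add: s_def)
      then show ?thesis using y h ideal_zero[OF D[OF h(1)]] by (simp add: W_def y_def minus_eq r_neg)
    qed
    moreover have "l [^] W i \<otimes> y \<in> J" for i using y(1) h(1) by (intro ideal.I_l_closed[OF J]) auto
    ultimately have "power_prod a s \<alpha> \<ominus> power_prod (\<lambda>i. l [^] W i \<otimes> y) s \<alpha> \<in> D l \<cdot> ipow J ((\<Sum>i<s. \<alpha> i) - 1)"
      using power_prod_congruence[OF D[OF h(1)] J, of s a "\<lambda>i. l [^] W i \<otimes> y" \<alpha>] aJ by blast
    moreover have "(\<Sum>i<s. \<alpha> i) = e" using h(2) by (simp add: M_def multi_indices_def)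
    ultimately show ?thesis using power_prod_scaled[OF y(2) h(1), of W s \<alpha>] by (simp add: T_def w_def)
  qed
  define X where "X = M - {\<beta>}"
  have \<beta>M: "\<beta> \<in> M" using \<beta> by (simp add: M_def s_def)
  \<comment> \<open>Elements congruent to a polynomial in \<open>l\<close> times \<open>y^e\<close>,
    with coefficients independent of \<open>l\<close> and none at \<open>w \<beta>\<close>. As
    \<open>Z\<close> is an ideal containing all other monomials, their combination has this form
    before \<open>l\<close> is chosen.\<close>
  define Z where "Z = {z \<in> carrier R. \<exists>u. (\<forall>j. u j \<in> carrier R) \<and> u (w \<beta>) = \<zero> \<and>
      (\<forall>l\<in>carrier R. z \<ominus> poly_sum N u l \<otimes> y [^] e \<in> T l)}"
  have ye: "y [^] e \<in> carrier R" using y by simp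
  have Z: "ideal Z R"
  proof (rule idealI[OF ring_axioms])
    have smult: "r \<otimes> z \<in> Z" if h: "z \<in> Z" "r \<in> carrier R" for z r
    proof -
      obtain u where u: "z \<in> carrier R" "\<And>j. u j \<in> carrier R" "u (w \<beta>) = \<zero>"
        "\<And>l. l \<in> carrier R \<Longrightarrow> z \<ominus> poly_sum N u l \<otimes> y [^] e \<in> T l" using h(1) unfolding Z_def by blast
      have "r \<otimes> z \<ominus> poly_sum N (\<lambda>j. r \<otimes> u j) l \<otimes> y [^] e \<in> T l" if l: "l \<in> carrier R" for l
      proof -
        have pc: "poly_sum N u l \<in> carrier R" using u(2) l by (rule poly_sum_closed)
        have "r \<otimes> z \<ominus> poly_sum N (\<lambda>j. r \<otimes> u j) l \<otimes> y [^] e = r \<otimes> (z \<ominus> poly_sum N u l \<otimes> y [^] e)"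
          unfolding poly_sum_smult[OF u(2) h(2) l] using pc u(1) h(2) ye by algebra
        then show ?thesis using ideal.I_l_closed[OF Ti[OF l] u(4)[OF l] h(2)] by simp
      qed
      then show ?thesis using u h unfolding Z_def
        by (intro CollectI conjI exI[of _ "\<lambda>j. r \<otimes> u j"]) auto
    qed
    show "subgroup Z (add_monoid R)"
    proof
      show "Z \<subseteq> carrier (add_monoid R)" by (auto simp: Z_def)
      have "\<zero> \<ominus> poly_sum N (\<lambda>_. \<zero>) l \<otimes> y [^] e \<in> T l" if l: "l \<in> carrier R" for l
        using poly_sum_zero[OF l, of N "\<lambda>_. \<zero>"] ye ideal_zero[OF Ti[OF l]] by (simp add: minus_eq)
      then show "\<one>\<^bsub>add_monoid R\<^esub> \<in> Z" unfolding Z_def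
        by (intro CollectI conjI exI[of _ "\<lambda>_. \<zero>"]) auto
      show "inv\<^bsub>add_monoid R\<^esub> z \<in> Z" if "z \<in> Z" for z
      proof -
        have "z \<in> carrier R" using that by (simp add: Z_def)
        then have "\<ominus> z = (\<ominus> \<one>) \<otimes> z" by (simp add: l_minus)
        then show ?thesis using smult[OF that, of "\<ominus> \<one>"] by (simp add: a_inv_def)
      qed
      show "z \<otimes>\<^bsub>add_monoid R\<^esub> z' \<in> Z" if h: "z \<in> Z" "z' \<in> Z" for z z'
      proof -
        obtain u where u: "z \<in> carrier R" "\<And>j. u j \<in> carrier R" "u (w \<beta>) = \<zero>"
          "\<And>l. l \<in> carrier R \<Longrightarrow> z \<ominus> poly_sum N u l \<otimes> y [^] e \<in> T l" using h(1) unfolding Z_def by blast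
        obtain u' where u': "z' \<in> carrier R" "\<And>j. u' j \<in> carrier R" "u' (w \<beta>) = \<zero>"
          "\<And>l. l \<in> carrier R \<Longrightarrow> z' \<ominus> poly_sum N u' l \<otimes> y [^] e \<in> T l" using h(2) unfolding Z_def by blast
        have "z \<oplus> z' \<ominus> poly_sum N (\<lambda>j. u j \<oplus> u' j) l \<otimes> y [^] e \<in> T l" if l: "l \<in> carrier R" for l
        proof -
          have pc: "poly_sum N u l \<in> carrier R" "poly_sum N u' l \<in> carrier R"
            using u(2) u'(2) l by (auto intro: poly_sum_closed)
          have "z \<oplus> z' \<ominus> poly_sum N (\<lambda>j. u j \<oplus> u' j) l \<otimes> y [^] e
              = (z \<ominus> poly_sum N u l \<otimes> y [^] e) \<oplus> (z' \<ominus> poly_sum N u' l \<otimes> y [^] e)"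
            unfolding poly_sum_add[OF u(2) u'(2) l] using pc u(1) u'(1) ye by algebra
          then show ?thesis using ideal_add_closed[OF Ti[OF l] u(4)[OF l] u'(4)[OF l]] by simp
        qed
        then show ?thesis using u u' unfolding Z_def
          by (intro CollectI conjI exI[of _ "\<lambda>j. u j \<oplus> u' j"]) auto
      qed
    qed
    fix z x assume h: "z \<in> Z" "x \<in> carrier R"
    then have "z \<in> carrier R" by (simp add: Z_def)
    then show "x \<otimes> z \<in> Z" "z \<otimes> x \<in> Z" using smult[OF h] h(2) by (simp_all add: m_comm)
  qed
  have pX: "power_prod a s ` X \<subseteq> carrier R"
    using power_prod_closed[where a = a and s = s, OF ac] by auto
  have "power_prod a s ` X \<subseteq> Z"
  proof clarify
    fix \<alpha> assume \<alpha>: "\<alpha> \<in> X"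
    then have \<alpha>M: "\<alpha> \<in> M" "\<alpha> \<noteq> \<beta>" by (auto simp: X_def)
    let ?u = "\<lambda>j. if j = w \<alpha> then \<one> else \<zero>"
    have "power_prod a s \<alpha> \<ominus> poly_sum N ?u l \<otimes> y [^] e \<in> T l" if "l \<in> carrier R" for l
      using cong[OF that \<alpha>M(1)] poly_sum_delta[OF that wN[OF \<alpha>M(1)]] by simp
    moreover have "w \<alpha> \<noteq> w \<beta>" using w_inj[OF \<alpha>M(1) \<beta>M] \<alpha>M(2) by blast
    ultimately show "power_prod a s \<alpha> \<in> Z" using power_prod_closed[where a = a and s = s, OF ac] unfolding Z_def
      by (intro CollectI conjI exI[of _ ?u]) auto
  qed
  then have IdlZ: "Idl (power_prod a s ` X) \<subseteq> Z" using Idl_subset_iff[OF pX Z] by blast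
  let ?V = "(\<mm> \<cdot> ipow J e) <+> c"
  have V: "ideal ?V R" using ideal_mm J c by (intro ideal_closed)
  have "power_prod a s \<beta> \<in> ?V <+> Idl (power_prod a s ` X)"
    using dep by (simp only: s_def M_def X_def)
  then obtain v z where vz: "v \<in> ?V" "z \<in> Z" "power_prod a s \<beta> = v \<oplus> z"
    using IdlZ by (metis set_addE subsetD)
  obtain u where u: "z \<in> carrier R" "\<And>j. u j \<in> carrier R" "u (w \<beta>) = \<zero>"
    "\<And>l. l \<in> carrier R \<Longrightarrow> z \<ominus> poly_sum N u l \<otimes> y [^] e \<in> T l" using vz(2) unfolding Z_def by blast
  let ?\<delta> = "\<lambda>j. if j = w \<beta> then \<one> else \<zero>"
  \<comment> \<open>The relation as one polynomial in \<open>l\<close>; its coefficient at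
    \<open>w \<beta>\<close> is 1, which keeps it nonzero over the residue field.\<close>
  define u' where "u' j = ?\<delta> j \<oplus> (\<ominus> \<one>) \<otimes> u j" for j
  have u'c: "u' j \<in> carrier R" for j using u(2) by (simp add: u'_def)
  have "u' (w \<beta>) = \<one>" using u(3) by (simp add: u'_def)
  then have "u' (w \<beta>) \<notin> \<mm>" using one_notin_mm by simp
  then obtain l where l: "l \<in> carrier R" "poly_sum N u' l \<notin> \<mm>"
    using exists_poly_sum_notin_mm[of u', OF inf u'c wN[OF \<beta>M]] by blast
  have pc: "poly_sum N u l \<in> carrier R" using u(2) l(1) by (rule poly_sum_closed)
  have pu': "poly_sum N u' l = l [^] w \<beta> \<ominus> poly_sum N u l"
  proof -
    have "poly_sum N u' l = poly_sum N ?\<delta> l \<oplus> poly_sum N (\<lambda>j. (\<ominus> \<one>) \<otimes> u j) l"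
      unfolding u'_def using u(2) l(1) by (intro poly_sum_add) auto
    also have "\<dots> = l [^] w \<beta> \<oplus> (\<ominus> \<one>) \<otimes> poly_sum N u l"
      using poly_sum_delta[OF l(1) wN[OF \<beta>M]] poly_sum_smult[OF u(2) _ l(1), of "\<ominus> \<one>"] by simp
    finally show ?thesis using pc by (simp add: l_minus minus_eq)
  qed
  let ?U = "?V <+> T l"
  have U: "ideal ?U R" using V Ti[OF l(1)] by (rule add_ideals)
  have vc: "v \<in> carrier R" using ideal.Icarr[OF V vz(1)] .
  have lw: "l [^] w \<beta> \<in> carrier R" using l(1) by simp
  \<comment> \<open>Comparing the congruences for \<open>z\<close> and for the monomial
    \<open>v + z\<close> isolates a multiple of \<open>y^e\<close> whose factor is a unit by the
    choice of \<open>l\<close>.\<close>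
  have "poly_sum N u' l \<otimes> y [^] e
      = v \<oplus> ((z \<ominus> poly_sum N u l \<otimes> y [^] e) \<ominus> (power_prod a s \<beta> \<ominus> l [^] w \<beta> \<otimes> y [^] e))"
    unfolding pu' vz(3) using pc lw vc u(1) ye by algebra
  also have "\<dots> \<in> ?U"
    by (rule set_addI[OF vz(1) ideal_minus[OF Ti[OF l(1)] u(4)[OF l(1)] cong[OF l(1) \<beta>M]]])
  finally have "poly_sum N u' l \<otimes> y [^] e \<in> ?U" .
  moreover obtain r where r: "r \<in> carrier R" "r \<otimes> poly_sum N u' l = \<one>"
    using exists_inverse[OF poly_sum_closed[OF u'c l(1)] l(2)] by blast
  ultimately have "r \<otimes> (poly_sum N u' l \<otimes> y [^] e) \<in> ?U" using ideal.I_l_closed[OF U] by blast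
  moreover have "r \<otimes> (poly_sum N u' l \<otimes> y [^] e) = (r \<otimes> poly_sum N u' l) \<otimes> y [^] e"
    by (rule m_assoc[symmetric, OF r(1) poly_sum_closed[OF u'c l(1)] ye])
  ultimately have yU: "y [^] e \<in> ?U" using r(2) ye by simp
  let ?K = "Idl (a ` {..<s})"
  have Ki: "ideal ?K R" using ac by (intro genideal_ideal) auto
  have "ipow ?K e \<subseteq> ?U"
  proof -
    have "power_prod a s ` M \<subseteq> ?U"
    proof clarify
      fix \<alpha> assume \<alpha>: "\<alpha> \<in> M"
      have pcl: "power_prod a s \<alpha> \<in> carrier R" using power_prod_closed[where a = a and s = s, OF ac] .
      have lwc: "l [^] w \<alpha> \<in> carrier R" using l(1) by simp
      have "power_prod a s \<alpha> \<ominus> l [^] w \<alpha> \<otimes> y [^] e \<in> ?U"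
        using cong[OF l(1) \<alpha>] subset_addI2[OF V Ti[OF l(1)]] by blast
      moreover have "l [^] w \<alpha> \<otimes> y [^] e \<in> ?U" by (rule ideal.I_l_closed[OF U yU lwc])
      ultimately have "(power_prod a s \<alpha> \<ominus> l [^] w \<alpha> \<otimes> y [^] e) \<oplus> l [^] w \<alpha> \<otimes> y [^] e \<in> ?U"
        by (rule ideal_add_closed[OF U])
      moreover have "(power_prod a s \<alpha> \<ominus> l [^] w \<alpha> \<otimes> y [^] e) \<oplus> l [^] w \<alpha> \<otimes> y [^] e = power_prod a s \<alpha>"
        using pcl lwc ye by algebra
      ultimately show "power_prod a s \<alpha> \<in> ?U" by simp
    qed
    moreover have "power_prod a s ` M \<subseteq> carrier R" using power_prod_closed[where a = a and s = s, OF ac] by auto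
    ultimately show ?thesis
      using ipow_Idl[where a = a and s = s and n = e, OF ac] Idl_subset_iff[OF _ U] unfolding M_def by simp
  qed
  note I = ideal_ipow[OF J]
  \<comment> \<open>Reduction exponent for the new elements: \<open>n0\<close> from the old
    reduction, and \<open>e - 1\<close> because one of \<open>e\<close> factors passes into
    \<open>D l\<close>.\<close>
  let ?n = "n0 + e - 1"
  let ?L = "(D l \<cdot> ipow J ?n) <+> c"
  have Li: "ideal (D l \<cdot> ipow J ?n) R" "ideal ?L R" using D[OF l(1)] I c by (auto intro: add_ideals ideal_prod_is_ideal)
  have mJ: "ideal (\<mm> \<cdot> ipow J (n0 + e)) R" using ideal_mm I by (rule ideal_prod_is_ideal)
  let ?E = "(\<mm> \<cdot> ipow J (n0 + e)) <+> ?L"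
  have E: "ideal ?E R" using mJ Li(2) by (rule add_ideals)
  have "ipow J (n0 + e) \<subseteq> (ipow ?K e \<cdot> ipow J n0) <+> c"
    by (rule ipow_subset_of_reduction[OF Ki J c n0])
  also have "\<dots> \<subseteq> ?E"
  proof (rule add_subset[OF E])
    have cL: "c \<subseteq> ?L" by (rule subset_addI2[OF Li(1) c])
    have LE: "?L \<subseteq> ?E" by (rule subset_addI2[OF mJ Li(2)])
    show "c \<subseteq> ?E" using cL LE by blast
    have "ipow ?K e \<cdot> ipow J n0 \<subseteq> ?U \<cdot> ipow J n0"
      by (rule ideal_prod_mono[OF \<open>ipow ?K e \<subseteq> ?U\<close> order_refl])
    also have "\<dots> \<subseteq> ?E"
    proof -
      have mJe: "ideal (\<mm> \<cdot> ipow J e) R" using ideal_mm I by (rule ideal_prod_is_ideal)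
      have eq: "?U \<cdot> ipow J n0 = (((\<mm> \<cdot> ipow J e) \<cdot> ipow J n0) <+> (c \<cdot> ipow J n0)) <+> (T l \<cdot> ipow J n0)"
        using ideal_prod_distr(2)[OF I V Ti[OF l(1)]] ideal_prod_distr(2)[OF I mJe c] by simp
      have 1: "(\<mm> \<cdot> ipow J e) \<cdot> ipow J n0 \<subseteq> ?E"
        using ideal_prod_assoc[OF ideal_mm I I] ipow_add[OF J, of e n0] subset_addI1[OF mJ Li(2)]
        by (simp add: add.commute)
      have 2: "c \<cdot> ipow J n0 \<subseteq> ?E" using ideal_prod_subset1[OF c I] cL LE by blast
      have "T l \<cdot> ipow J n0 = D l \<cdot> ipow J (e - 1 + n0)"
        unfolding T_def using ideal_prod_assoc[OF D[OF l(1)] I I] ipow_add[OF J] by simp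
      also have "e - 1 + n0 = ?n" using e by simp
      finally have 3: "T l \<cdot> ipow J n0 \<subseteq> ?E" using subset_addI1[OF Li(1) c] LE by blast
      show ?thesis unfolding eq by (intro add_subset E 1 2 3)
    qed
    finally show "ipow ?K e \<cdot> ipow J n0 \<subseteq> ?E" .
  qed
  finally have "ipow J (n0 + e) \<subseteq> ?L" by (rule nakayama[OF I Li(2)])
  moreover have "n0 + e = Suc ?n" using e by simp
  ultimately have "ipow J (Suc ?n) \<subseteq> ((Idl ((\<lambda>i. a i \<ominus> l [^] W i \<otimes> y) ` {..<t})) \<cdot> ipow J ?n) <+> c"
    unfolding D_def by simp
  moreover have "a i \<ominus> l [^] W i \<otimes> y \<in> J" if "i < t" for i
    using aJ[of i] that y l(1) by (intro ideal_minus[OF J] ideal.I_l_closed[OF J]) (auto simp: s_def)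
  ultimately have "reduction_mod c J t (\<lambda>i. a i \<ominus> l [^] W i \<otimes> y)"
    unfolding reduction_mod_def by (intro conjI allI impI exI[of _ ?n])
  then show ?thesis by blast
qed

text \<open>Take a reduction with the fewest elements, say \<open>s\<close>. If
  \<open>s > t\<close>, no monomial depends on the others, so the colength of \<open>c + J^n\<close>
  grows at least like a polynomial of degree \<open>s\<close>, against the bound of order
  \<open>n^t\<close>.\<close>

lemma exists_reduction_mod:
  assumes inf: "infinite (carrier (R Quot \<mm>))" and J: "finite_colength J" "J \<subseteq> \<mm>" and c: "ideal c R"
    and bound: "\<And>n. n \<ge> 1 \<Longrightarrow> colength R (c <+> ipow J n) \<le> C * n ^ t"
  shows "\<exists>a. reduction_mod c J t a"
proof -
  have Ji: "ideal J R" using J(1) by (rule finite_colength_ideal)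
  \<comment> \<open>Appended zeros bring the number of elements to exactly \<open>t\<close>.\<close>
  have pad: "\<exists>a. reduction_mod c J s' a" if h: "reduction_mod c J s a" "s \<le> s'" for s s' a
  proof -
    let ?b = "\<lambda>i. if i < s then a i else \<zero>"
    have a: "\<And>i. i < s \<Longrightarrow> a i \<in> J" using h by (simp add: reduction_mod_def)
    have bJ: "?b i \<in> J" for i using a ideal_zero[OF Ji] by auto
    have "a ` {..<s} \<subseteq> ?b ` {..<s'}" using h(2) by force
    moreover have "?b ` {..<s'} \<subseteq> carrier R" using bJ ideal_subset[OF Ji] by blast
    ultimately have "Idl (a ` {..<s}) \<subseteq> Idl (?b ` {..<s'})" by (rule Idl_mono)
    then have "((Idl (a ` {..<s})) \<cdot> ipow J n) <+> c \<subseteq> ((Idl (?b ` {..<s'})) \<cdot> ipow J n) <+> c" for n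
      by (intro set_add_mono ideal_prod_mono order_refl)
    moreover obtain n where "ipow J (Suc n) \<subseteq> ((Idl (a ` {..<s})) \<cdot> ipow J n) <+> c"
      using h(1) by (auto simp: reduction_mod_def)
    ultimately have "ipow J (Suc n) \<subseteq> ((Idl (?b ` {..<s'})) \<cdot> ipow J n) <+> c" by (meson subset_trans)
    then have "reduction_mod c J s' ?b"
      unfolding reduction_mod_def using bJ by (intro conjI allI impI exI[of _ n])
    then show ?thesis by blast
  qed
  have "\<exists>s a. reduction_mod c J s a"
  proof -
    obtain a and s :: nat where a: "\<And>i. i < s \<Longrightarrow> a i \<in> carrier R" "J = Idl (a ` {..<s})"
      using obtain_indexed_generators[OF Ji] by metis
    have "a ` {..<s} \<subseteq> J" unfolding a(2) using a(1) by (intro genideal_self) auto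
    moreover have "ipow J (Suc 0) \<subseteq> ((Idl (a ` {..<s})) \<cdot> ipow J 0) <+> c"
      using subset_addI1[OF Ji c] a(2) Ji by (simp add: ideal_prod_one)
    ultimately show ?thesis unfolding reduction_mod_def by blast
  qed
  then have ex: "\<exists>s. \<exists>a. reduction_mod c J s a" .
  define s where "s = (LEAST s. \<exists>a. reduction_mod c J s a)"
  obtain a where a: "reduction_mod c J s a" unfolding s_def using LeastI_ex[OF ex] by blast
  have "s \<le> t"
  proof (rule ccontr)
    assume "\<not> s \<le> t"
    then obtain s' where s': "s = Suc s'" "t \<le> s'" by (cases s) auto
    have nmin: "\<not> (\<exists>a. reduction_mod c J s' a)"
      using not_less_Least[of s' "\<lambda>s. \<exists>a. reduction_mod c J s a"] s'(1) by (simp add: s_def)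
    have aJ: "a i \<in> J" if "i < s" for i using a that by (simp add: reduction_mod_def)
    have ac: "a i \<in> carrier R" if "i < s" for i using ideal.Icarr[OF Ji aJ[OF that]] .
    note I = ideal_ipow[OF Ji]
    have fin: "finite_colength (c <+> ipow J n)" for n
      by (rule finite_colength_mono[OF finite_colength_ipow[OF J(1)] add_ideals[OF c I] subset_addI2[OF c I]])
    \<comment> \<open>By minimality and \<open>reduction_mod_dependent\<close> the monomials of
      degree \<open>e\<close> are independent modulo \<open>\<mm> J^e + c\<close>. Because of
      \<open>J \<subseteq> \<mm>\<close> the interval they span lies between
      \<open>c + J^(e+1)\<close> and \<open>c + J^e\<close>.\<close>
    have grow: "colength R (c <+> ipow J e) + card (multi_indices s e) \<le> colength R (c <+> ipow J (Suc e))"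
      if e: "e \<ge> 1" for e
    proof -
      let ?M = "multi_indices s e" and ?B = "(\<mm> \<cdot> ipow J e) <+> c"
      let ?A = "?B <+> Idl (power_prod a s ` ?M)"
      have B: "ideal ?B R" using ideal_mm I c by (intro add_ideals ideal_prod_is_ideal)
      have pM: "power_prod a s ` ?M \<subseteq> carrier R" using power_prod_closed[where a = a and s = s, OF ac] by auto
      have A: "ideal ?A R" using B genideal_ideal[OF pM] by (rule add_ideals)
      have "enat (card ?M) \<le> ilen ?B ?A"
      proof (rule card_le_ilen_independent[OF finite_multi_indices _ B])
        show "power_prod a s \<beta> \<in> carrier R" for \<beta> using power_prod_closed[where a = a and s = s, OF ac] .
        show "power_prod a s \<beta> \<notin> ?B <+> Idl (power_prod a s ` (?M - {\<beta>}))" if "\<beta> \<in> ?M" for \<beta>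
          using reduction_mod_dependent[OF inf Ji c a[unfolded s'(1)] e] that nmin unfolding s'(1) by blast
      qed
      also have "\<dots> \<le> ilen (c <+> ipow J (Suc e)) (c <+> ipow J e)"
      proof (rule ilen_mono[OF A B add_ideals[OF c I] add_ideals[OF c I]])
        have "ipow J (Suc e) \<subseteq> \<mm> \<cdot> ipow J e" using J(2) by (simp add: ipow_Suc Ji ideal_prod_mono)
        then have "c <+> ipow J (Suc e) \<subseteq> c <+> (\<mm> \<cdot> ipow J e)" by (rule set_add_mono[OF order_refl])
        then show "c <+> ipow J (Suc e) \<subseteq> ?B"
          using ideal_add_comm[OF c ideal_prod_is_ideal[OF ideal_mm I]] by simp
        show "?B \<subseteq> ?A" by (rule subset_addI1[OF B genideal_ideal[OF pM]])
        have "power_prod a s \<beta> \<in> ipow J e" if "\<beta> \<in> ?M" for \<beta>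
          using power_prod_in_ipow[OF Ji, of s a \<beta>] aJ that by (simp add: multi_indices_def)
        then have "Idl (power_prod a s ` ?M) \<subseteq> ipow J e" using Idl_subset_iff[OF pM I] by blast
        then have "Idl (power_prod a s ` ?M) \<subseteq> c <+> ipow J e" using subset_addI2[OF c I] by blast
        moreover have "?B \<subseteq> c <+> ipow J e"
          using ideal_prod_subset2[OF ideal_mm I] subset_addI1[OF c I] subset_addI2[OF c I]
          by (intro add_subset add_ideals[OF c I]) blast+
        ultimately show "?A \<subseteq> c <+> ipow J e" using add_subset[OF add_ideals[OF c I]] by metis
      qed
      finally have "enat (card ?M) \<le> ilen (c <+> ipow J (Suc e)) (c <+> ipow J e)" .
      moreover have "c <+> ipow J (Suc e) \<subseteq> c <+> ipow J e"
        by (intro set_add_mono order_refl ipow_antimono[OF Ji]) simp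
      ultimately show ?thesis using colength_additive[OF fin[of "Suc e"] add_ideals[OF c I], of e] by simp
    qed
    \<comment> \<open>The extra 1 pays for the monomial of degree 0, as \<open>grow\<close> starts
      at \<open>e = 1\<close>.\<close>
    have sum: "(\<Sum>e<n. card (multi_indices s e)) \<le> colength R (c <+> ipow J n) + 1" if "n \<ge> 1" for n
      using that
    proof (induction n rule: dec_induct)
      case base
      show ?case by (simp add: s'(1) card_multi_indices)
    next
      case (step n)
      then show ?case using grow[of n] by simp
    qed
    let ?p = "binom_poly s - 1" and ?q = "Polynomial.monom (of_nat C) t :: rat poly"
    have val: "poly ?p (of_nat n) = of_nat (\<Sum>e<n. card (multi_indices s e)) - 1" if "n \<ge> 1" for n
      using sum_card_multi_indices[OF that, of s] by simp
    have ge: "(\<Sum>e<n. card (multi_indices s e)) \<ge> 1" if "n \<ge> 1" for n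
    proof -
      have "card (multi_indices s 0) \<le> (\<Sum>e<n. card (multi_indices s e))"
        using that by (intro member_le_sum) auto
      then show ?thesis by (simp add: s'(1) card_multi_indices)
    qed
    have 1: "poly ?p (of_nat n) \<ge> 0" if "n \<ge> 1" for n
      using val[OF that] ge[OF that] by (metis diff_ge_0_iff_ge of_nat_1 of_nat_le_iff)
    have 2: "poly ?p (of_nat n) \<le> poly ?q (of_nat n)" if "n \<ge> 1" for n
    proof -
      have "(\<Sum>e<n. card (multi_indices s e)) \<le> C * n ^ t + 1"
        using sum[OF that] bound[OF that] by linarith
      then have "(of_nat (\<Sum>e<n. card (multi_indices s e)) :: rat) \<le> of_nat (C * n ^ t + 1)"
        by (simp only: of_nat_le_iff)
      then show ?thesis unfolding val[OF that] by (simp add: poly_monom)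
    qed
    have "Polynomial.degree ?p \<le> t"
    proof (rule degree_le_of_eventually_le)
      show "\<forall>\<^sub>F n in sequentially. 0 \<le> poly ?p (of_nat n)"
        using 1 unfolding eventually_sequentially by blast
      show "\<forall>\<^sub>F n in sequentially. poly ?p (of_nat n) \<le> poly ?q (of_nat n)"
        using 2 unfolding eventually_sequentially by blast
    qed (rule degree_monom_le)
    moreover have "Polynomial.coeff ?p s \<noteq> 0"
      using coeff_binom_poly[of s] coeff_eq_0[of "1 :: rat poly" s] s'(1)
      by (simp del: binom_poly.simps coeff_1)
    ultimately show False using le_degree[of ?p s] s' by simp
  qed
  then show ?thesis using pad[OF a] by blast
qed

end

section \<open>Multiplicities\<close>

lemma degree_pcompose_shift: "Polynomial.degree (pcompose p [:a, 1 :: rat:]) = Polynomial.degree p"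
  by (simp add: degree_pcompose)

lemma coeff_pcompose_shift:
  fixes a :: rat
  assumes "Polynomial.degree p \<le> k"
  shows "Polynomial.coeff (pcompose p [:a, 1:]) k = Polynomial.coeff p k"
proof (cases "Polynomial.degree p = k")
  case True
  then show ?thesis
    using lead_coeff_comp[of "[:a, 1:]" p] by (simp add: degree_pcompose_shift)
next
  case False
  then show ?thesis using assms by (simp add: coeff_eq_0 degree_pcompose_shift)
qed

lemma coeff_sum_binom_poly:
  "Polynomial.coeff (\<Sum>j\<le>k. Polynomial.smult (c j) (binom_poly j)) k = c k / fact k"
proof -
  have "Polynomial.coeff (\<Sum>j\<le>k. Polynomial.smult (c j) (binom_poly j)) k
      = (\<Sum>j\<le>k. c j * Polynomial.coeff (binom_poly j) k)"
    by (simp add: coeff_sum)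
  also have "\<dots> = (\<Sum>j\<le>k. if j = k then c k / fact k else 0)"
    by (rule sum.cong) (auto simp: coeff_binom_poly coeff_binom_poly_less simp del: binom_poly.simps)
  finally show ?thesis by simp
qed

lemma degree_sum_binom_poly_le:
  "Polynomial.degree (\<Sum>j\<le>k. Polynomial.smult (c j) (binom_poly j)) \<le> k"
  by (intro degree_sum_le order_trans[OF degree_smult_le]) (auto simp: degree_binom_poly)

text \<open>Monomials of degree below \<open>n\<close> have all exponents below \<open>n\<close>,
  and for \<open>s \<ge> 1\<close> their degrees are among those up to \<open>s * n\<close>.\<close>

lemma sum_card_multi_indices_le:
  assumes "s \<ge> 1" shows "(\<Sum>k<n. card (multi_indices s k)) \<le> n ^ s"
proof -
  let ?Q = "\<lambda>k. {\<alpha> \<in> multi_indices s k. \<forall>i<s. \<alpha> i < n}"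
  have "(\<Sum>k<n. card (multi_indices s k)) = (\<Sum>k<n. card (?Q k))"
    by (rule sum.cong) (simp_all add: bounded_multi_indices)
  also have "\<dots> \<le> (\<Sum>k\<le>s * n. card (?Q k))"
  proof (rule sum_mono2)
    have "k \<le> s * n" if "k < n" for k using mult_le_mono[of 1 s k n] assms that by simp
    then show "{..<n} \<subseteq> {..s * n}" by auto
  qed auto
  also have "\<dots> = n ^ s" by (rule sum_card_bounded_multi_indices)
  finally show ?thesis .
qed

lemma neg_one_power_cancel: "(-1) ^ m * ((-1) ^ m * x) = (x :: int)"
  by (simp flip: mult.assoc power_mult_distrib)

text \<open>The definition lists coefficients from the top with alternating signs; the substitution
  \<open>j = d - i\<close> turns them into coordinates in the binomial basis. Their uniqueness makes
  the definite description well defined.\<close>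

lemma hilbert_coeff_eqI:
  assumes "hilbert_poly R I = (\<Sum>j\<le>d. Polynomial.smult (of_int (c j)) (binom_poly j))" "i \<le> d"
  shows "hilbert_coeff R d I i = (-1) ^ i * c (d - i)"
proof -
  let ?f = "\<lambda>e x. (\<Sum>i\<le>d. (-1) ^ i * of_int (e i) * ((x + of_nat d - of_nat i - 1) gchoose (d - i)))"
  have f: "?f e x = (\<Sum>j\<le>d. of_int ((-1) ^ (d - j) * e (d - j)) * poly (binom_poly j) x)"
    for e :: "nat \<Rightarrow> int" and x :: rat
  proof -
    have "?f e x = (\<Sum>j\<le>d. (-1) ^ (d - j) * of_int (e (d - j))
        * ((x + of_nat d - of_nat (d - j) - 1) gchoose (d - (d - j))))"
      by (rule sum.reindex_bij_witness[of _ "\<lambda>j. d - j" "\<lambda>j. d - j"]) auto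
    also have "\<dots> = (\<Sum>j\<le>d. of_int ((-1) ^ (d - j) * e (d - j)) * poly (binom_poly j) x)"
      by (rule sum.cong)
         (auto simp: poly_binom_poly_gchoose of_nat_diff algebra_simps simp del: binom_poly.simps)
    finally show ?thesis .
  qed
  define e0 where "e0 i = (if i \<le> d then (-1) ^ i * c (d - i) else 0)" for i
  let ?P = "\<lambda>e. (\<forall>i>d. e i = 0) \<and> (\<forall>x. poly (hilbert_poly R I) x = ?f e x)"
  have hp: "poly (hilbert_poly R I) x = (\<Sum>j\<le>d. of_int (c j) * poly (binom_poly j) x)" for x
    unfolding assms(1) by (simp add: poly_sum del: binom_poly.simps)
  have "hilbert_coeff R d I = e0"
    unfolding hilbert_coeff_def
  proof (rule the_equality)
    have sgn: "(-1) ^ (d - j) * e0 (d - j) = c j" if "j \<le> d" for j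
      using that by (simp add: e0_def neg_one_power_cancel)
    show "?P e0"
      unfolding f hp using sgn by (auto simp: e0_def intro!: sum.cong simp del: binom_poly.simps)
    fix e assume e: "?P e"
    have eq: "(\<Sum>j\<le>d. (of_int ((-1) ^ (d - j) * e (d - j)) - of_int (c j)) * poly (binom_poly j) x) = 0" for x :: rat
      using e[THEN conjunct2, rule_format, of x] unfolding f hp
      by (simp add: left_diff_distrib sum_subtractf del: binom_poly.simps)
    have c: "(-1) ^ (d - j) * e (d - j) = c j" if "j \<le> d" for j
    proof -
      have "(of_int ((-1) ^ (d - j) * e (d - j)) - of_int (c j) :: rat) = 0"
        by (rule binom_poly_coeffs_unique[OF eq that])
      then have "(of_int ((-1) ^ (d - j) * e (d - j)) :: rat) = of_int (c j)" by simp
      then show ?thesis by (simp only: of_int_eq_iff)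
    qed
    show "e = e0"
    proof
      fix i
      show "e i = e0 i"
      proof (cases "i \<le> d")
        case True
        then have eq: "c (d - i) = (-1) ^ i * e i" using c[of "d - i"] by simp
        have "e0 i = (-1) ^ i * c (d - i)" using True by (simp add: e0_def)
        then show ?thesis unfolding eq neg_one_power_cancel by simp
      qed (use e in \<open>simp add: e0_def\<close>)
    qed
  qed
  then show ?thesis using assms(2) by (simp add: e0_def)
qed

section \<open>Hilbert polynomials and the Ratliff-Rush closure\<close>

context noetherian_local_ring
begin

lemma hilbert_poly_ipow: "hilbert_poly R I = eventual_poly (\<lambda>n. colength R (ipow I n))"
  by (simp add: hilbert_poly_def ipow_def)

lemma fiber_multiplicity_ipow:
  "fiber_multiplicity R d I =
     fact (d - 1) * Polynomial.coeff (eventual_poly (\<lambda>n. min_gens R (ipow I n))) (d - 1)"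
  by (simp add: fiber_multiplicity_def ipow_def)

lemma colength_antimono:
  "finite_colength B \<Longrightarrow> ideal A R \<Longrightarrow> B \<subseteq> A \<Longrightarrow> colength R A \<le> colength R B"
  by (rule colength_additive(2))

lemma eventually_hilbert_poly:
  assumes "finite_colength I"
  shows "\<forall>\<^sub>F n in sequentially. of_nat (colength R (ipow I n)) = poly (hilbert_poly R I) (of_nat n)"
proof -
  obtain p :: "rat poly" where
    p: "\<forall>\<^sub>F n in sequentially. of_nat (colength R (ipow I n)) = poly p (of_nat n)"
    using eventually_poly_colength[OF assms] unfolding eventually_poly_def by blast
  then have "hilbert_poly R I = p" unfolding hilbert_poly_ipow by (rule eventual_poly_eqI)
  then show ?thesis using p by simp
qed

text \<open>For \<open>I \<subseteq> J\<close> the length of \<open>J^n/I^n\<close> is a difference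
  of colengths, and it vanishes exactly when the powers agree.\<close>

lemma hilbert_poly_eq_iff:
  assumes I: "finite_colength I" and J: "ideal J R" "I \<subseteq> J"
  shows "hilbert_poly R J = hilbert_poly R I \<longleftrightarrow> (\<forall>\<^sub>F n in sequentially. ipow J n = ipow I n)"
proof
  have Ji: "finite_colength J" using I J by (rule finite_colength_mono)
  have Ii: "ideal I R" using I by (rule finite_colength_ideal)
  show "hilbert_poly R J = hilbert_poly R I" if "\<forall>\<^sub>F n in sequentially. ipow J n = ipow I n"
    unfolding hilbert_poly_ipow by (rule eventual_poly_cong) (use that in \<open>auto elim: eventually_mono\<close>)
  assume hp: "hilbert_poly R J = hilbert_poly R I"
  have "\<forall>\<^sub>F n in sequentially. (of_nat (colength R (ipow J n)) :: rat) = of_nat (colength R (ipow I n))"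
    using eventually_hilbert_poly[OF I] eventually_hilbert_poly[OF Ji] by eventually_elim (simp add: hp)
  then show "\<forall>\<^sub>F n in sequentially. ipow J n = ipow I n"
  proof (rule eventually_mono)
    fix n assume eq: "(of_nat (colength R (ipow J n)) :: rat) = of_nat (colength R (ipow I n))"
    have sub: "ipow I n \<subseteq> ipow J n" by (rule ipow_mono[OF Ii J])
    have "ilen (ipow I n) (ipow J n) = 0"
      using colength_additive(1)[OF finite_colength_ipow[OF I] ideal_ipow[OF J(1)] sub] eq
      by (simp add: zero_enat_def)
    then show "ipow J n = ipow I n"
      using ilen_eq_0[OF ideal_ipow[OF J(1)] ideal_ipow[OF Ii] sub] by simp
  qed
qed

text \<open>The Noetherian property provides a maximal admissible ideal \<open>K\<close>. It is the
  greatest one because the sum of two admissible ideals is admissible.\<close>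

lemma ratliff_rush_greatest:
  assumes I: "finite_colength I"
  shows "ideal (ratliff_rush R I) R" "I \<subseteq> ratliff_rush R I"
    "hilbert_poly R (ratliff_rush R I) = hilbert_poly R I"
proof -
  let ?P = "\<lambda>J. ideal J R \<and> I \<subseteq> J \<and> hilbert_poly R J = hilbert_poly R I"
  have Ii: "ideal I R" using I by (rule finite_colength_ideal)
  have ne: "{J. ?P J} \<noteq> {}" using Ii by blast
  have "\<exists>K\<in>{J. ?P J}. \<forall>L\<in>{J. ?P J}. K \<subseteq> L \<longrightarrow> L = K"
    by (rule ideal_set_maximal[OF ne]) simp
  then obtain K where "K \<in> {J. ?P J}" and K_max: "\<forall>L\<in>{J. ?P J}. K \<subseteq> L \<longrightarrow> L = K" by (rule bexE)
  then have K: "?P K" by simp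
  have "ratliff_rush R I = K"
    unfolding ratliff_rush_def
  proof (rule Greatest_equality)
    show "?P K" by (rule K)
    fix J assume J: "?P J"
    let ?L = "J <+> K"
    have ids: "ideal J R" "ideal K R" "ideal ?L R" using J K by (auto intro: add_ideals)
    have sub: "I \<subseteq> ?L" "K \<subseteq> ?L" "J \<subseteq> ?L"
      using subset_addI1[OF ids(1,2)] subset_addI2[OF ids(1,2)] K by auto
    have "\<forall>\<^sub>F n in sequentially. ipow J n = ipow I n" "\<forall>\<^sub>F n in sequentially. ipow K n = ipow I n"
      using hilbert_poly_eq_iff[OF I] J K by auto
    then have "\<forall>\<^sub>F n in sequentially. ipow J n = ipow I n \<and> ipow K n = ipow I n"
      by (rule eventually_conj)
    then obtain N where N: "\<And>n. n \<ge> N \<Longrightarrow> ipow J n = ipow I n" "\<And>n. n \<ge> N \<Longrightarrow> ipow K n = ipow I n"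
      unfolding eventually_sequentially by blast
    \<comment> \<open>Both \<open>J\<close> and \<open>K\<close> multiply \<open>I^n\<close> onto
      \<open>I^(n+1)\<close> for large \<open>n\<close>, hence so does their sum.\<close>
    have LI: "?L \<cdot> ipow I n = ipow I (Suc n)" if n: "n \<ge> N" for n
    proof -
      have "J \<cdot> ipow I n = ipow I (Suc n)" "K \<cdot> ipow I n = ipow I (Suc n)"
        using N[of n] N[of "Suc n"] n ipow_Suc[OF ids(1), of n] ipow_Suc[OF ids(2), of n] by auto
      then show ?thesis
        using ideal_prod_distr(2)[OF ideal_ipow[OF Ii] ids(1,2)]
          ideal_add_absorb[OF ideal_ipow[OF Ii] ideal_ipow[OF Ii] order_refl] by simp
    qed
    have LkI: "ipow ?L k \<cdot> ipow I n = ipow I (k + n)" if n: "n \<ge> N" for k n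
    proof (induction k)
      case (Suc k)
      have "ipow ?L (Suc k) \<cdot> ipow I n = ?L \<cdot> (ipow ?L k \<cdot> ipow I n)"
        using ideal_prod_assoc[OF ids(3) ideal_ipow[OF ids(3)] ideal_ipow[OF Ii]] by (simp add: ipow_Suc ids(3))
      then show ?case using Suc LI[of "k + n"] n by simp
    qed (simp add: one_prod Ii)
    \<comment> \<open>Of \<open>2N\<close> factors, \<open>N\<close> come from the same ideal; since
      \<open>J^N = K^N = I^N\<close>, the remaining power of \<open>?L\<close> is absorbed by
      \<open>I^N\<close>.\<close>
    have "ipow ?L (N + N) \<subseteq> (ipow J N \<cdot> ipow ?L N) <+> (ipow K N \<cdot> ipow ?L N)"
      by (rule binomial_ipow_subset[OF ids(1,2)])
    also have "\<dots> = ipow I (N + N)"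
      using LkI[of N N] ideal_prod_commute[OF ideal_ipow[OF Ii] ideal_ipow[OF ids(3)], of N N]
        ideal_add_absorb[OF ideal_ipow[OF Ii] ideal_ipow[OF Ii] order_refl] by (simp add: N)
    finally have base: "ipow ?L (N + N) = ipow I (N + N)"
      using ipow_mono[OF Ii ids(3) sub(1)] by blast
    have "ipow ?L n = ipow I n" if n: "n \<ge> N + N" for n
    proof -
      have "ipow ?L n = ipow ?L (n - (N + N)) \<cdot> ipow ?L (N + N)"
        using ipow_add[OF ids(3), of "n - (N + N)" "N + N"] n by simp
      also have "\<dots> = ipow I n" unfolding base using LkI[of "N + N" "n - (N + N)"] n by simp
      finally show ?thesis .
    qed
    then have "\<forall>\<^sub>F n in sequentially. ipow ?L n = ipow I n" unfolding eventually_sequentially by blast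
    then have "hilbert_poly R ?L = hilbert_poly R I" using hilbert_poly_eq_iff[OF I ids(3) sub(1)] by blast
    then have "?P ?L" using ids(3) sub(1) by simp
    then have "?L = K" using K_max[rule_format, of ?L] sub(2) by simp
    then show "J \<le> K" using sub(3) by simp
  qed
  then show "ideal (ratliff_rush R I) R" "I \<subseteq> ratliff_rush R I"
    "hilbert_poly R (ratliff_rush R I) = hilbert_poly R I" using K by auto
qed

lemma finite_colength_of_primary:
  assumes "primary_to \<mm> I R"
  shows "finite_colength I" "I \<subseteq> \<mm>"
proof -
  interpret P: primary_to \<mm> I R by fact
  have I: "ideal I R" by (rule P.is_ideal)
  obtain A where A: "A \<subseteq> carrier R" "finite A" "\<mm> = Idl A" using finetely_gen[OF ideal_mm] by blast
  have "\<exists>n::nat. a [^] n \<in> I" if "a \<in> A" for a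
  proof -
    have "a \<in> \<mm>" using that A(3) genideal_self[OF A(1)] by blast
    then show ?thesis using P.radical unfolding radical_ideal_def by blast
  qed
  then have "\<exists>k. ipow (Idl A) k \<subseteq> I" by (rule ipow_Idl_subset_of_powers[OF A(2,1) I])
  then have "\<exists>k. ipow \<mm> k \<subseteq> I" unfolding A(3)[symmetric] .
  then show "finite_colength I" using I by (simp add: finite_colength_def)
  show "I \<subseteq> \<mm>" by (rule proper_subset_mm[OF I P.proper])
qed

lemma colength_pos:
  assumes "finite_colength J" "J \<subseteq> \<mm>" shows "colength R J \<ge> 1"
proof -
  have "ilen \<mm> (carrier R) \<le> ilen J (carrier R)"
    using assms(2) by (intro ilen_mono oneideal ideal_mm finite_colength_ideal assms(1) ideal_subset) auto
  then show ?thesis unfolding ilen_mm colength_ilen[OF assms(1)] by (simp add: one_enat_def)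
qed

end

section \<open>Minimal reductions in Cohen-Macaulay local rings\<close>

locale cm_local_ring = noetherian_local_ring +
  fixes d :: nat
  assumes krull_dim: "krull_dim R = enat d" and depth_dim: "depth R \<mm> = enat d" and d_pos: "d > 0"
    and infinite_residue_field: "infinite (carrier (R Quot \<mm>))"
begin

lemma finite_colength_regular:
  "length xs = d \<Longrightarrow> reg_seq {\<zero>} xs \<Longrightarrow> set xs \<subseteq> \<mm> \<Longrightarrow> finite_colength (Idl (set xs))"
  using finite_colength_reg_seq krull_dim by simp

text \<open>Let \<open>X\<close> be generated by a regular sequence of length \<open>d\<close>. With
  \<open>\<mm>^k \<subseteq> I\<close> the power \<open>X^(k n)\<close> lies in \<open>I^n\<close>,
  and the colength of \<open>X^n\<close> is bounded by counting monomials.\<close>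

lemma colength_ipow_growth:
  assumes I: "finite_colength I"
  shows "\<exists>C. \<forall>n\<ge>1. colength R (ipow I n) \<le> C * n ^ d"
proof -
  obtain xs where xs: "length xs = d" "set xs \<subseteq> \<mm>" "reg_seq {\<zero>} xs"
    using obtain_reg_seq[OF depth_dim d_pos] by blast
  let ?X = "Idl (set xs)" and ?a = "\<lambda>i. xs ! i"
  have X: "finite_colength ?X" using finite_colength_regular xs by blast
  have xsc: "set xs \<subseteq> carrier R" using xs(2) ideal_subset[OF ideal_mm] by blast
  have Xi: "ideal ?X R" "ideal I R" using finite_colength_ideal X I by auto
  have set_xs: "set xs = ?a ` {..<d}" using xs(1) by (auto simp: set_conv_nth)
  have ac: "?a i \<in> carrier R" if "i < d" for i using that xsc xs(1) by auto
  have Xm: "?X \<subseteq> \<mm>" using Idl_subset_iff[OF xsc ideal_mm] xs(2) by blast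
  obtain k where k: "ipow \<mm> k \<subseteq> I" using I by (auto simp: finite_colength_def)
  have Xn: "colength R (ipow ?X n) \<le> n ^ d * colength R ?X" for n
  proof -
    have "colength R (ipow ?X n) \<le> (\<Sum>k<n. card (multi_indices d k)) * colength R ?X"
      unfolding set_xs by (rule colength_ipow_le) (use ac X set_xs in auto)
    also have "\<dots> \<le> n ^ d * colength R ?X"
      using d_pos by (intro mult_right_mono sum_card_multi_indices_le) auto
    finally show ?thesis .
  qed
  have "colength R (ipow I n) \<le> (k ^ d * colength R ?X) * n ^ d" for n
  proof -
    have "ipow ?X (k * n) \<subseteq> ipow I n"
      using ipow_mult[OF Xi(1), of k n] ipow_mono[OF Xi(1) ideal_mm Xm, of k] k
        ipow_mono[OF ideal_ipow[OF Xi(1)] Xi(2), of k n] by simp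
    then have "colength R (ipow I n) \<le> colength R (ipow ?X (k * n))"
      by (intro colength_antimono finite_colength_ipow X ideal_ipow Xi)
    also have "\<dots> \<le> (k * n) ^ d * colength R ?X" by (rule Xn)
    finally show ?thesis by (simp add: power_mult_distrib mult_ac)
  qed
  then show ?thesis by blast
qed

lemma degree_hilbert_poly_le:
  assumes "finite_colength I" shows "Polynomial.degree (hilbert_poly R I) \<le> d"
proof -
  obtain C where C: "\<And>n. n \<ge> 1 \<Longrightarrow> colength R (ipow I n) \<le> C * n ^ d"
    using colength_ipow_growth[OF assms] by blast
  let ?q = "Polynomial.monom (of_nat C) d :: rat poly"
  note ev = eventually_hilbert_poly[OF assms]
  show ?thesis
  proof (rule degree_le_of_eventually_le)
    show "\<forall>\<^sub>F n in sequentially. poly (hilbert_poly R I) (of_nat n) \<ge> 0"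
      using ev by (rule eventually_mono) (metis of_nat_0_le_iff)
    show "\<forall>\<^sub>F n in sequentially. poly (hilbert_poly R I) (of_nat n) \<le> poly ?q (of_nat n)"
      using eventually_conj[OF ev eventually_ge_at_top[of 1]]
    proof (rule eventually_mono)
      fix n :: nat
      assume n: "of_nat (colength R (ipow I n)) = poly (hilbert_poly R I) (of_nat n) \<and> 1 \<le> n"
      have "(of_nat (colength R (ipow I n)) :: rat) \<le> of_nat (C * n ^ d)"
        using C[OF conjunct2[OF n]] by (simp only: of_nat_le_iff)
      moreover have "poly ?q (of_nat n) = of_nat (C * n ^ d)" by (simp add: poly_monom)
      ultimately show "poly (hilbert_poly R I) (of_nat n) \<le> poly ?q (of_nat n)"
        using n by metis
    qed
  qed (rule degree_monom_le)
qed

text \<open>Modulo \<open>cs\<close> the powers of \<open>J\<close> contain powers of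
  \<open>x\<close>, so their colengths grow linearly and \<open>J\<close> has a reduction by a
  single \<open>b\<close>. Some power of \<open>x\<close> then lies in \<open>(b) + (cs)\<close>, so
  \<open>b\<close> inherits regularity from \<open>x\<close>. The last two conclusions serve to show
  that \<open>b\<close> is independent modulo \<open>\<mm> J\<close>.\<close>

lemma reg_seq_exchange:
  assumes cs: "length cs = d - 1" "set cs \<subseteq> \<mm>" "reg_seq {\<zero>} (cs @ [x])" "x \<in> \<mm>"
    and J: "finite_colength J" "J \<subseteq> \<mm>"
  obtains b n where "b \<in> J" "reg_seq {\<zero>} (cs @ [b])"
    "ipow J (Suc n) \<subseteq> ((PIdl b) \<cdot> ipow J n) <+> Idl (set cs)" "\<not> ipow J (Suc n) \<subseteq> Idl (set cs)"
proof -
  let ?c = "Idl (set cs)"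
  have csc: "set cs \<subseteq> carrier R" and xc: "x \<in> carrier R"
    using cs(2,4) ideal_subset[OF ideal_mm] by auto
  have c: "ideal ?c R" using csc by (rule genideal_ideal)
  have Ji: "ideal J R" using J(1) by (rule finite_colength_ideal)
  have append: "reg_seq {\<zero>} (cs @ [y]) \<longleftrightarrow> reg_seq {\<zero>} cs \<and> colon ?c y \<subseteq> ?c" for y
    using reg_seq_append[OF zeroideal csc, of "[y]"] zero_add_ideal[OF c] by simp
  have reg: "reg_seq {\<zero>} cs" "colon ?c x \<subseteq> ?c" using append cs(3) by auto
  have c_proper: "\<one> \<notin> ?c"
    using Idl_subset_iff[OF csc ideal_mm] cs(2) one_notin_mm by blast
  have P: "ideal (PIdl (x [^] (n::nat))) R" for n using xc by (simp add: cgenideal_ideal)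
  have "Idl (set (cs @ [x])) = ?c <+> PIdl x"
    using Idl_insert[OF xc csc] ideal_add_comm[OF c cgenideal_ideal[OF xc]] by simp
  moreover have "finite_colength (Idl (set (cs @ [x])))"
    by (rule finite_colength_regular) (use cs d_pos in auto)
  ultimately have fin: "finite_colength (?c <+> PIdl x)" by simp
  let ?C = "\<lambda>n::nat. ?c <+> PIdl (x [^] n)"
  have Ci: "ideal (?C n) R" for n by (rule add_ideals[OF c P])
  have C_sub: "?C (Suc n) \<subseteq> ?C n" for n
    by (rule set_add_mono[OF order_refl PIdl_pow_Suc_subset[OF xc]])
  have ilenC: "ilen (?C n) (carrier R) \<le> of_nat n * ilen (?c <+> PIdl x) (carrier R)" for n
  proof (induction n)
    case 0
    have "?C 0 = carrier R"
      using subset_addI2[OF c P, of 0] cgenideal_self[of \<one>] by (intro ideal_eq_carrier[OF Ci]) auto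
    then show ?case by simp
  next
    case (Suc n)
    have eq: "?C (Suc n) <+> PIdl (x [^] n) = ?C n"
      using ideal_add_assoc[OF c P P] ideal_add_comm[OF P P] ideal_add_absorb[OF P P PIdl_pow_Suc_subset[OF xc]] by metis
    have xn: "x [^] n \<in> carrier R" using xc by simp
    have "?c <+> PIdl x \<subseteq> colon (?C (Suc n)) (x [^] n)"
    proof (rule add_subset[OF ideal_colon[OF Ci xn]])
      show "?c \<subseteq> colon (?C (Suc n)) (x [^] n)"
        using subset_addI1[OF c P, of "Suc n"] subset_colon[OF Ci xn, of "Suc n"] by blast
      have "x \<otimes> x [^] n \<in> PIdl (x [^] Suc n)" using cgenideal_self[of "x [^] Suc n"] xc by (simp add: m_comm)
      then have "x \<in> colon (?C (Suc n)) (x [^] n)"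
        using subset_addI2[OF c P, of "Suc n"] xc by (intro colonI) auto
      then show "PIdl x \<subseteq> colon (?C (Suc n)) (x [^] n)"
        using PIdl_subset_iff[OF xc ideal_colon[OF Ci xn]] by blast
    qed
    then have "ilen (colon (?C (Suc n)) (x [^] n)) (carrier R) \<le> ilen (?c <+> PIdl x) (carrier R)"
      by (intro ilen_mono oneideal ideal_colon Ci xn ideal_subset add_ideals c cgenideal_ideal xc)
    then have "ilen (?C (Suc n)) (?C n) \<le> ilen (?c <+> PIdl x) (carrier R)"
      using ilen_cyclic[OF Ci xn, of "Suc n"] unfolding eq by simp
    then have "ilen (?C (Suc n)) (?C n) + ilen (?C n) (carrier R)
        \<le> ilen (?c <+> PIdl x) (carrier R) + of_nat n * ilen (?c <+> PIdl x) (carrier R)"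
      using Suc by (rule add_mono)
    moreover have "ilen (?C (Suc n)) (carrier R) = ilen (?C (Suc n)) (?C n) + ilen (?C n) (carrier R)"
      by (rule ilen_additive[OF oneideal Ci Ci C_sub ideal_subset[OF Ci]])
    ultimately show ?case by (simp add: distrib_right)
  qed
  obtain k where k: "ipow \<mm> k \<subseteq> J" using J(1) by (auto simp: finite_colength_def)
  have xk: "x [^] (k * n) \<in> ipow J n" for n
  proof -
    have "x [^] (k * n) \<in> ipow \<mm> (k * n)" by (rule pow_in_ipow[OF ideal_mm cs(4)])
    then show ?thesis
      using ipow_mult[OF ideal_mm, of k n] ipow_mono[OF ideal_ipow[OF ideal_mm] Ji k, of n] by auto
  qed
  have finJ: "finite_colength (?c <+> ipow J n)" for n
    by (rule finite_colength_mono[OF finite_colength_ipow[OF J(1)] add_ideals[OF c ideal_ipow[OF Ji]]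
          subset_addI2[OF c ideal_ipow[OF Ji]]])
  \<comment> \<open>The exponent 1 of \<open>n\<close> is what yields a reduction by one
    element.\<close>
  have "colength R (?c <+> ipow J n) \<le> (k * colength R (?c <+> PIdl x)) * n ^ 1" for n
  proof -
    have "?C (k * n) \<subseteq> ?c <+> ipow J n"
      using xk[of n] PIdl_subset_iff[of "x [^] (k * n)" "ipow J n"] xc Ji
      by (intro set_add_mono order_refl) simp
    then have "ilen (?c <+> ipow J n) (carrier R) \<le> ilen (?C (k * n)) (carrier R)"
      by (intro ilen_mono oneideal Ci add_ideals c ideal_ipow Ji ideal_subset) 
    also have "\<dots> \<le> of_nat (k * n) * ilen (?c <+> PIdl x) (carrier R)" by (rule ilenC)
    finally show ?thesis
      by (simp add: colength_ilen finJ fin of_nat_eq_enat mult_ac)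
  qed
  then obtain a where a: "reduction_mod ?c J 1 a"
    using exists_reduction_mod[OF infinite_residue_field J c] by blast
  then have "a 0 \<in> J" by (simp add: reduction_mod_def)
  moreover obtain n where "ipow J (Suc n) \<subseteq> ((Idl (a ` {..<1})) \<cdot> ipow J n) <+> ?c"
    using a unfolding reduction_mod_def by blast
  moreover define b where "b = a 0"
  moreover have "a ` {..<1} = {b}" by (auto simp: b_def)
  moreover have "b \<in> carrier R" using ideal.Icarr[OF Ji] calculation by simp
  ultimately have b: "b \<in> J" "b \<in> carrier R" "ipow J (Suc n) \<subseteq> ((PIdl b) \<cdot> ipow J n) <+> ?c"
    by (simp_all add: cgenideal_eq_genideal)
  have Pb: "ideal (PIdl b) R" using b(2) by (rule cgenideal_ideal)
  \<comment> \<open>If \<open>r\<close> annihilates \<open>b\<close> modulo \<open>cs\<close>, it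
    annihilates a power of \<open>x\<close>, which can be cancelled.\<close>
  have "colon ?c b \<subseteq> ?c"
  proof
    fix r assume r: "r \<in> colon ?c b"
    then have rc: "r \<in> carrier R" "r \<otimes> b \<in> ?c" by (auto simp: colon_def)
    have "x [^] (k * Suc n) \<in> ((PIdl b) \<cdot> ipow J n) <+> ?c" using xk b(3) by blast
    then have "x [^] (k * Suc n) \<in> PIdl b <+> ?c"
      using set_add_mono[OF ideal_prod_subset1[OF Pb ideal_ipow[OF Ji]] order_refl] by blast
    then obtain t c' where t: "t \<in> carrier R" "c' \<in> ?c" "x [^] (k * Suc n) = t \<otimes> b \<oplus> c'"
      by (metis set_addE PIdlE)
    have c'c: "c' \<in> carrier R" using ideal.Icarr[OF c t(2)] .
    have "r \<otimes> x [^] (k * Suc n) = t \<otimes> (r \<otimes> b) \<oplus> r \<otimes> c'"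
      unfolding t(3) using rc(1) t(1) c'c b(2) by algebra
    also have "\<dots> \<in> ?c" by (rule ideal_add_closed[OF c ideal.I_l_closed[OF c rc(2) t(1)] ideal.I_l_closed[OF c t(2) rc(1)]])
    finally have "r \<in> colon ?c (x [^] (k * Suc n))" using rc(1) by (rule colonI[rotated])
    then show "r \<in> ?c" using colon_pow_subset[OF reg(2) xc c] by blast
  qed
  then have "reg_seq {\<zero>} (cs @ [b])" using append reg(1) by blast
  \<comment> \<open>No power of \<open>x\<close> lies in \<open>(cs)\<close>, since cancelling it
    would put \<open>\<one>\<close> there.\<close>
  moreover have "\<not> ipow J (Suc n) \<subseteq> ?c"
  proof
    assume "ipow J (Suc n) \<subseteq> ?c"
    then have "\<one> \<otimes> x [^] (k * Suc n) \<in> ?c" using xk[of "Suc n"] xc by auto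
    then have "\<one> \<in> colon ?c (x [^] (k * Suc n))" by (intro colonI) auto
    then show False using colon_pow_subset[OF reg(2) xc c] c_proper by blast
  qed
  ultimately show thesis using that b(1,3) by blast
qed

text \<open>Starting from an arbitrary maximal regular sequence, its members are replaced one by one by
  elements of \<open>J\<close> that stay independent modulo \<open>\<mm> J\<close>.\<close>
lemma parameter_ideal_regular:
  assumes a: "\<And>i. i < d \<Longrightarrow> a i \<in> carrier R" and Ja: "J = Idl (a ` {..<d})"
    and J: "finite_colength J" "J \<subseteq> \<mm>"
  obtains bs where "length bs = d" "reg_seq {\<zero>} bs" "set bs \<subseteq> \<mm>" "J = Idl (set bs)"
proof -
  have Ji: "ideal J R" using J(1) by (rule finite_colength_ideal)
  let ?mJ = "\<mm> \<cdot> J"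
  have mJ: "ideal ?mJ R" "?mJ \<subseteq> J"
    by (rule ideal_prod_is_ideal[OF ideal_mm Ji], rule ideal_prod_subset2[OF ideal_mm Ji])
  \<comment> \<open>\<open>bs\<close> holds the elements already exchanged and \<open>ys\<close>
    what is left of the original sequence; the length bound records independence modulo
    \<open>\<mm> J\<close>. The last member of \<open>ys\<close> is replaced, and the new element is
    rotated to the front.\<close>
  have "\<exists>bs ys. length bs = i \<and> length (bs @ ys) = d \<and> set bs \<subseteq> J \<and> set ys \<subseteq> \<mm> \<and>
      reg_seq {\<zero>} (bs @ ys) \<and> enat i \<le> ilen ?mJ (?mJ <+> Idl (set bs))" if "i \<le> d" for i
    using that
  proof (induction i)
    case 0
    obtain xs where "length xs = d" "set xs \<subseteq> \<mm>" "reg_seq {\<zero>} xs"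
      using obtain_reg_seq[OF depth_dim d_pos] by blast
    then show ?case by (intro exI[of _ "[]"] exI[of _ xs]) (simp add: zero_enat_def[symmetric])
  next
    case (Suc i)
    then obtain bs ys where *: "length bs = i" "length (bs @ ys) = d" "set bs \<subseteq> J" "set ys \<subseteq> \<mm>"
      "reg_seq {\<zero>} (bs @ ys)" "enat i \<le> ilen ?mJ (?mJ <+> Idl (set bs))" by auto
    have "ys \<noteq> []" using * Suc.prems by auto
    then obtain zs x where ys: "ys = zs @ [x]" by (metis rev_exhaust)
    let ?cs = "bs @ zs"
    have cs: "length ?cs = d - 1" "set ?cs \<subseteq> \<mm>" "reg_seq {\<zero>} (?cs @ [x])" "x \<in> \<mm>"
      using * ys J(2) by auto
    obtain b n where b: "b \<in> J" "reg_seq {\<zero>} (?cs @ [b])"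
      "ipow J (Suc n) \<subseteq> ((PIdl b) \<cdot> ipow J n) <+> Idl (set ?cs)" "\<not> ipow J (Suc n) \<subseteq> Idl (set ?cs)"
      by (rule reg_seq_exchange[OF cs J])
    have bc: "b \<in> carrier R" using ideal.Icarr[OF Ji b(1)] .
    have bsc: "set bs \<subseteq> carrier R" and csc: "set ?cs \<subseteq> carrier R"
      using *(3) cs(2) ideal_subset[OF Ji] ideal_subset[OF ideal_mm] by auto
    have ids: "ideal (Idl (set bs)) R" "ideal (Idl (set ?cs)) R" "ideal (PIdl b) R"
      using genideal_ideal[OF bsc] genideal_ideal[OF csc] cgenideal_ideal[OF bc] by auto
    have "reg_seq {\<zero>} (b # ?cs)" by (rule reg_seq_rotate[OF zeroideal cs(2) bc b(2)])
    let ?A = "?mJ <+> Idl (set bs)" and ?A' = "?mJ <+> Idl (set (b # bs))"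
    have A: "ideal ?A R" using mJ(1) ids(1) by (rule add_ideals)
    have A'_eq: "?A' = ?A <+> PIdl b"
      using Idl_insert[OF bc bsc] ideal_add_comm[OF ids(3,1)] ideal_add_assoc[OF mJ(1) ids(1,3)] by simp
    \<comment> \<open>Otherwise the reduction by \<open>b\<close> puts \<open>J^(n+1)\<close> into
      \<open>\<mm> J^(n+1) + (cs)\<close>, and Nakayama contradicts the last property of
      \<open>b\<close>.\<close>
    have "b \<notin> ?A"
    proof
      assume "b \<in> ?A"
      then have "PIdl b \<subseteq> ?A" using PIdl_subset_iff[OF bc A] by blast
      note I = ideal_ipow[OF Ji]
      let ?B = "(\<mm> \<cdot> ipow J (Suc n)) <+> Idl (set ?cs)"
      have mJn: "ideal (\<mm> \<cdot> ipow J (Suc n)) R" using ideal_mm I by (rule ideal_prod_is_ideal)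
      have B: "ideal ?B R" using mJn ids(2) by (rule add_ideals)
      have csB: "Idl (set ?cs) \<subseteq> ?B" by (rule subset_addI2[OF mJn ids(2)])
      have "(PIdl b) \<cdot> ipow J n \<subseteq> ?A \<cdot> ipow J n"
        by (rule ideal_prod_mono[OF \<open>PIdl b \<subseteq> ?A\<close> order_refl])
      also have "\<dots> = (?mJ \<cdot> ipow J n) <+> (Idl (set bs)) \<cdot> ipow J n"
        by (rule ideal_prod_distr(2)[OF I mJ(1) ids(1)])
      also have "\<dots> \<subseteq> ?B"
      proof (rule add_subset[OF B])
        show "?mJ \<cdot> ipow J n \<subseteq> ?B"
          using ideal_prod_assoc[OF ideal_mm Ji I] subset_addI1[OF mJn ids(2)] by (simp add: ipow_Suc Ji)
        have "Idl (set bs) \<subseteq> Idl (set ?cs)" by (rule Idl_mono[OF _ csc]) auto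
        then show "(Idl (set bs)) \<cdot> ipow J n \<subseteq> ?B"
          using ideal_prod_subset1[OF ids(1) I] csB by blast
      qed
      finally have "((PIdl b) \<cdot> ipow J n) <+> Idl (set ?cs) \<subseteq> ?B" using csB by (intro add_subset B)
      then have "ipow J (Suc n) \<subseteq> ?B" using b(3) by blast
      then have "ipow J (Suc n) \<subseteq> Idl (set ?cs)" by (rule nakayama[OF I ids(2)])
      then show False using b(4) by blast
    qed
    then have "?A \<subset> ?A'"
      unfolding A'_eq using subset_addI1[OF A ids(3)] subset_addI2[OF A ids(3)] cgenideal_self[OF bc] by blast
    moreover have A': "ideal ?A' R" unfolding A'_eq using A ids(3) by (rule add_ideals)
    ultimately have "1 \<le> ilen ?A ?A'" using A by (intro ilen_ge_1)
    with *(6) have "enat i + 1 \<le> ilen ?mJ ?A + ilen ?A ?A'" by (rule add_mono)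
    also have "\<dots> = ilen ?mJ ?A'"
      using \<open>?A \<subset> ?A'\<close> by (intro ilen_additive[symmetric] A A' mJ(1) subset_addI1[OF mJ(1) ids(1)]) auto
    finally have "enat (Suc i) \<le> ilen ?mJ ?A'" by (simp add: one_enat_def)
    then show ?case
      using * ys b(1) \<open>reg_seq {\<zero>} (b # ?cs)\<close> by (intro exI[of _ "b # bs"] exI[of _ zs]) auto
  qed
  from this[of d] obtain bs where bs: "length bs = d" "set bs \<subseteq> J" "reg_seq {\<zero>} bs"
    "enat d \<le> ilen ?mJ (?mJ <+> Idl (set bs))" by auto
  have bsc: "set bs \<subseteq> carrier R" using bs(2) ideal_subset[OF Ji] by blast
  have B: "ideal (Idl (set bs)) R" "Idl (set bs) \<subseteq> J"
    using genideal_ideal[OF bsc] Idl_subset_iff[OF bsc Ji] bs(2) by auto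
  let ?A = "?mJ <+> Idl (set bs)"
  have A: "ideal ?A R" "?A \<subseteq> J" using add_ideals[OF mJ(1) B(1)] add_subset[OF Ji mJ(2) B(2)] by auto
  \<comment> \<open>\<open>J\<close> has at most \<open>d\<close> generators, so \<open>d\<close>
    independent elements already span \<open>J/\<mm>J\<close>.\<close>
  have "ilen ?mJ J \<le> enat (card (a ` {..<d}))"
    unfolding Ja by (rule ilen_mm_prod_le_card) (use a in auto)
  also have "\<dots> \<le> enat d" using card_image_le[of "{..<d}" a] by simp
  finally have "ilen ?mJ J \<le> enat d" .
  moreover have "ilen ?mJ J = ilen ?mJ ?A + ilen ?A J"
    by (rule ilen_additive[OF Ji A(1) mJ(1) subset_addI1[OF mJ(1) B(1)] A(2)])
  ultimately have le: "ilen ?mJ ?A + ilen ?A J \<le> enat d" by simp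
  have "ilen ?A J = 0"
  proof (cases "ilen ?mJ ?A"; cases "ilen ?A J")
    fix p q assume "ilen ?mJ ?A = enat p" "ilen ?A J = enat q"
    then show ?thesis using le bs(4) by (simp add: zero_enat_def)
  qed (use le in auto)
  then have "J = ?A" by (rule ilen_eq_0[OF Ji A(1,2)])
  then have "J = Idl (set bs)" by (rule Idl_of_nakayama[OF Ji bs(2)])
  then show thesis using that[of bs] bs J(2) by blast
qed

text \<open>Growth of order \<open>n^d\<close> yields a reduction by \<open>d\<close> elements.
  Their ideal contains a power of \<open>K\<close>, hence has finite colength, and can be generated
  by a regular sequence.\<close>

lemma exists_minimal_reduction:
  assumes K: "finite_colength K" "K \<subseteq> \<mm>"
  obtains bs n0 where "length bs = d" "reg_seq {\<zero>} bs" "set bs \<subseteq> K" "finite_colength (Idl (set bs))"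
    "ipow K (Suc n0) \<subseteq> (Idl (set bs)) \<cdot> ipow K n0"
proof -
  have Ki: "ideal K R" using K(1) by (rule finite_colength_ideal)
  obtain C where C: "\<forall>n\<ge>1. colength R (ipow K n) \<le> C * n ^ d"
    using colength_ipow_growth[OF K(1)] by blast
  have "colength R ({\<zero>} <+> ipow K n) \<le> C * n ^ d" if "n \<ge> 1" for n
    using C that zero_add_ideal[OF ideal_ipow[OF Ki]] by simp
  then obtain a where "reduction_mod {\<zero>} K d a"
    using exists_reduction_mod[OF infinite_residue_field K zeroideal] by blast
  then obtain n0 where a: "\<And>i. i < d \<Longrightarrow> a i \<in> K"
    and n0: "ipow K (Suc n0) \<subseteq> ((Idl (a ` {..<d})) \<cdot> ipow K n0) <+> {\<zero>}"
    unfolding reduction_mod_def by blast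
  have ac: "a i \<in> carrier R" if "i < d" for i using ideal.Icarr[OF Ki a[OF that]] .
  have A: "a ` {..<d} \<subseteq> carrier R" using ac by auto
  let ?J = "Idl (a ` {..<d})"
  have Ji: "ideal ?J R" using A by (rule genideal_ideal)
  have JK: "?J \<subseteq> K" using Idl_subset_iff[OF A Ki] a by blast
  have prod: "ideal (?J \<cdot> ipow K n0) R" using Ji ideal_ipow[OF Ki] by (rule ideal_prod_is_ideal)
  have red: "ipow K (Suc n0) \<subseteq> ?J \<cdot> ipow K n0"
    using n0 zero_add_ideal[OF prod] ideal_add_comm[OF prod zeroideal] by simp
  have "ipow K (Suc n0) \<subseteq> ?J" using red ideal_prod_subset1[OF Ji ideal_ipow[OF Ki]] by blast
  then have finJ: "finite_colength ?J"
    using finite_colength_mono[OF finite_colength_ipow[OF K(1)] Ji] by blast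
  have Jm: "?J \<subseteq> \<mm>" using JK K(2) by blast
  obtain bs where bs: "length bs = d" "reg_seq {\<zero>} bs" "set bs \<subseteq> \<mm>" "?J = Idl (set bs)"
    by (rule parameter_ideal_regular[where a = a and J = ?J, OF ac HOL.refl finJ Jm])
  have "set bs \<subseteq> K"
    using genideal_self[of "set bs"] bs(3,4) JK ideal_subset[OF ideal_mm] by blast
  then show thesis using that[of bs n0] bs finJ red by simp
qed

section \<open>Estimates for a fixed reduction generated by a regular sequence\<close>

context
  fixes K bs n0
  assumes K: "finite_colength K" "K \<subseteq> \<mm>"
    and bs: "length bs = d" "reg_seq {\<zero>} bs" "set bs \<subseteq> K" "finite_colength (Idl (set bs))"
    and red: "ipow K (Suc n0) \<subseteq> (Idl (set bs)) \<cdot> ipow K n0"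
begin

abbreviation (input) "J \<equiv> Idl (set bs)"

lemma ideal_K: "ideal K R"
  using K(1) by (rule finite_colength_ideal)

lemma bs_carrier: "set bs \<subseteq> carrier R"
  using bs(3) ideal_subset[OF ideal_K] by blast

lemma ideal_J: "ideal J R"
  using bs_carrier by (rule genideal_ideal)

lemma J_subset: "J \<subseteq> K"
  using Idl_subset_iff[OF bs_carrier ideal_K] bs(3) by blast

lemma set_bs: "set bs = (\<lambda>i. bs ! i) ` {..<d}"
  using bs(1) by (auto simp: set_conv_nth)

lemma bs_nth: "i < d \<Longrightarrow> bs ! i \<in> carrier R"
  using bs(1) bs_carrier by auto

lemma ipow_subset_reduction: "ipow K (n0 + n) \<subseteq> ipow J n"
proof -
  have "ipow K (Suc n0) \<subseteq> (J \<cdot> ipow K n0) <+> {\<zero>}"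
    using red subset_addI1[OF ideal_prod_is_ideal[OF ideal_J ideal_ipow[OF ideal_K]] zeroideal] by blast
  then have "ipow K (n0 + n) \<subseteq> (ipow J n \<cdot> ipow K n0) <+> {\<zero>}"
    by (rule ipow_subset_of_reduction[OF ideal_J ideal_K zeroideal])
  also have "\<dots> \<subseteq> ipow J n"
    using ideal_prod_subset1[OF ideal_ipow[OF ideal_J] ideal_ipow[OF ideal_K]]
      ideal_zero[OF ideal_ipow[OF ideal_J]] by (intro add_subset ideal_ipow ideal_J) auto
  finally show ?thesis .
qed

text \<open>\<open>J^n\<close> contains \<open>K^(n0+n)\<close>, and regularity of \<open>bs\<close>
  bounds its colength from below. The leading coefficients will give
  \<open>\<lambda>(R/J) \<le> e_0\<close>.\<close>

lemma colength_J_le: "(\<Sum>k<n. card (multi_indices d k)) * colength R J \<le> colength R (ipow K (n0 + n))"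
proof -
  have "bs \<noteq> []" using bs(1) d_pos by auto
  moreover have "set bs \<subseteq> \<mm>" using bs(3) K(2) by blast
  ultimately have "(\<Sum>k<n. card (multi_indices d k)) * colength R J \<le> colength R (ipow J n)"
    using colength_ipow_reg_seq_ge[OF bs(2) _ _ bs(4), of n] bs(1) by simp
  also have "\<dots> \<le> colength R (ipow K (n0 + n))"
    by (rule colength_antimono[OF finite_colength_ipow[OF K(1)] ideal_ipow[OF ideal_J] ipow_subset_reduction])
  finally show ?thesis .
qed

text \<open>If this length were smaller, \<open>K\<close> would have a reduction with fewer than \<open>d\<close> generators, and
  \<open>\<lambda>(R/K\<^sup>n)\<close> would grow too slowly.\<close>
lemma ilen_mm_prod_add_J: "ilen (\<mm> \<cdot> K) ((\<mm> \<cdot> K) <+> J) = enat d"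
proof -
  let ?B = "\<mm> \<cdot> K"
  have B: "ideal ?B R" "?B \<subseteq> K"
    by (rule ideal_prod_is_ideal[OF ideal_mm ideal_K], rule ideal_prod_subset2[OF ideal_mm ideal_K])
  have BJ: "ideal (?B <+> J) R" "?B \<subseteq> ?B <+> J"
    by (rule add_ideals[OF B(1) ideal_J], rule subset_addI1[OF B(1) ideal_J])
  have "ilen ?B (?B <+> J) \<le> enat (card (set bs))"
    by (rule ilen_generators_mm_le[OF finite_set bs_carrier B(1)])
       (use bs(3) in \<open>auto intro: ideal_prod.prod\<close>)
  also have "\<dots> \<le> enat d" using card_length[of bs] bs(1) by simp
  finally have le: "ilen ?B (?B <+> J) \<le> enat d" .
  moreover have "\<not> ilen ?B (?B <+> J) < enat d"
  proof
    assume lt: "ilen ?B (?B <+> J) < enat d"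
    then obtain q where q: "ilen ?B (?B <+> J) = enat q" by (cases "ilen ?B (?B <+> J)") auto
    obtain S where S: "finite S" "S \<subseteq> ?B <+> J" "card S \<le> q" "?B <+> J = ?B <+> Idl S"
      using generators_of_interval[OF BJ(1) B(1) BJ(2) q] by blast
    obtain a and s :: nat where a: "S = a ` {i. i < s}" "inj_on a {i. i < s}"
      using finite_imp_nat_seg_image_inj_on[OF S(1)] by blast
    have s: "s < d"
    proof -
      have "card S = s" using card_image[OF a(2)] unfolding a(1) by simp
      then show ?thesis using S(3) lt q by simp
    qed
    have S': "S = a ` {..<s}" unfolding a(1) by (simp add: lessThan_def)
    have SK: "S \<subseteq> K" using S(2) add_subset[OF ideal_K B(2) J_subset] by blast
    have Sc: "S \<subseteq> carrier R" using SK ideal_subset[OF ideal_K] by blast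
    have Si: "ideal (Idl S) R" using Sc by (rule genideal_ideal)
    note I = ideal_ipow[OF ideal_K]
    have "ipow K (Suc n0) \<subseteq> J \<cdot> ipow K n0" by (rule red)
    also have "\<dots> \<subseteq> (?B <+> Idl S) \<cdot> ipow K n0"
      by (rule ideal_prod_mono[OF _ order_refl]) (use subset_addI2[OF B(1) ideal_J] S(4) in simp)
    also have "\<dots> = (\<mm> \<cdot> ipow K (Suc n0)) <+> ((Idl S) \<cdot> ipow K n0)"
      using ideal_prod_distr(2)[OF I B(1) Si] ideal_prod_assoc[OF ideal_mm ideal_K I]
      by (simp add: ipow_Suc ideal_K)
    \<comment> \<open>By Nakayama \<open>S\<close> generates a reduction of \<open>K\<close> as
      well, with fewer than \<open>d\<close> elements.\<close>
    finally have red_S: "ipow K (Suc n0) \<subseteq> (Idl S) \<cdot> ipow K n0"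
      by (rule nakayama[OF I ideal_prod_is_ideal[OF Si I]])
    have "ipow K (Suc n0) \<subseteq> Idl S" using red_S ideal_prod_subset1[OF Si I] by blast
    then have finS: "finite_colength (Idl S)"
      using finite_colength_mono[OF finite_colength_ipow[OF K(1)] Si] by blast
    have SK': "Idl S \<subseteq> K" using Idl_subset_iff[OF Sc ideal_K] SK by blast
    \<comment> \<open>Both sides bound the colength of \<open>K^(n0+n)\<close>, from below through
      \<open>J\<close> and from above through \<open>S\<close>. As polynomials in \<open>n\<close>
      they have degrees \<open>d\<close> and at most \<open>s\<close>.\<close>
    have bound: "(\<Sum>k<n. card (multi_indices d k)) \<le> (\<Sum>k<n0+n. card (multi_indices s k)) * colength R (Idl S)" for n
    proof -
      have "Idl (set bs) \<subseteq> \<mm>" using J_subset K(2) by blast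
      then have "1 \<le> colength R J" using colength_pos[OF bs(4)] by blast
      then have "(\<Sum>k<n. card (multi_indices d k)) \<le> (\<Sum>k<n. card (multi_indices d k)) * colength R J" by simp
      also have "\<dots> \<le> colength R (ipow K (n0 + n))" by (rule colength_J_le)
      also have "\<dots> \<le> colength R (ipow (Idl S) (n0 + n))"
        by (rule colength_antimono[OF finite_colength_ipow[OF finS] I ipow_mono[OF Si ideal_K SK']])
      also have "\<dots> \<le> (\<Sum>k<n0+n. card (multi_indices s k)) * colength R (Idl S)"
        unfolding S' by (rule colength_ipow_le) (use Sc finS S' in auto)
      finally show ?thesis .
    qed
    let ?q = "Polynomial.smult (of_nat (colength R (Idl S))) (pcompose (binom_poly s) [:of_nat n0, 1:])"
    have 1: "poly (binom_poly d) (of_nat n) = of_nat (\<Sum>k<n. card (multi_indices d k))" if "n \<ge> 1" for n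
      by (rule sum_card_multi_indices[OF that, symmetric])
    have "Polynomial.degree (binom_poly d) \<le> s"
    proof (rule degree_le_of_eventually_le)
      show "\<forall>\<^sub>F n in sequentially. poly (binom_poly d) (of_nat n) \<ge> 0"
        using eventually_ge_at_top[of 1] by (rule eventually_mono) (simp only: 1 of_nat_0_le_iff)
      show "\<forall>\<^sub>F n in sequentially. poly (binom_poly d) (of_nat n) \<le> poly ?q (of_nat n)"
        using eventually_ge_at_top[of 1]
      proof (rule eventually_mono)
        fix n :: nat assume n: "1 \<le> n"
        have "poly (binom_poly d) (of_nat n) \<le> of_nat ((\<Sum>k<n0+n. card (multi_indices s k)) * colength R (Idl S))"
          unfolding 1[OF n] of_nat_le_iff by (rule bound)
        also have "\<dots> = of_nat (colength R (Idl S)) * of_nat (\<Sum>k<n0+n. card (multi_indices s k))"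
          by simp
        also have "of_nat (\<Sum>k<n0+n. card (multi_indices s k)) = poly (binom_poly s) (of_nat (n0 + n))"
          using n by (intro sum_card_multi_indices) simp
        finally show "poly (binom_poly d) (of_nat n) \<le> poly ?q (of_nat n)" by (simp add: poly_pcompose)
      qed
      show "Polynomial.degree ?q \<le> s"
        by (rule order_trans[OF degree_smult_le]) (simp add: degree_pcompose_shift degree_binom_poly)
    qed
    then show False using s by (simp add: degree_binom_poly)
  qed
  ultimately show ?thesis by simp
qed

text \<open>\<open>J\<close> supplies \<open>d\<close> of the minimal generators of
  \<open>K\<close>, and \<open>r\<close> remain. The generators of \<open>J^n K\<close> account for
  one part of the fiber of \<open>K^(n+1)\<close>; the length of \<open>K^(n+1)/J^n K\<close> bounds
  the rest and is computed through \<open>R/J^n\<close>.\<close>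

lemma min_gens_colength_le:
  assumes r: "min_gens R K = d + r"
  shows "min_gens R (ipow K (Suc n)) + colength R (ipow K (Suc n))
    \<le> (\<Sum>k<n. card (multi_indices d k)) * colength R J + card (multi_indices d n) * (colength R K + r)
      + card (multi_indices d (Suc n))"
proof -
  note I = ideal_ipow[OF ideal_K] and IJ = ideal_ipow[OF ideal_J]
  have B: "ideal (\<mm> \<cdot> K) R" "\<mm> \<cdot> K \<subseteq> K"
    by (rule ideal_prod_is_ideal[OF ideal_mm ideal_K], rule ideal_prod_subset2[OF ideal_mm ideal_K])
  let ?A = "(\<mm> \<cdot> K) <+> J"
  have A: "ideal ?A R" "\<mm> \<cdot> K \<subseteq> ?A" "?A \<subseteq> K"
    by (rule add_ideals[OF B(1) ideal_J], rule subset_addI1[OF B(1) ideal_J],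
        rule add_subset[OF ideal_K B(2) J_subset])
  have "enat (d + r) = enat d + ilen ?A K"
    using ilen_additive[OF ideal_K A(1) B(1) A(2,3)] min_gens_eq[OF ideal_K] r ilen_mm_prod_add_J by simp
  then have "ilen ?A K = enat r" by (cases "ilen ?A K") auto
  then obtain S where S: "finite S" "S \<subseteq> K" "card S \<le> r" "K = ?A <+> Idl S"
    using generators_of_interval[OF ideal_K A(1,3)] by blast
  have Sc: "S \<subseteq> carrier R" using S(2) ideal_subset[OF ideal_K] by blast
  have Si: "ideal (Idl S) R" using Sc by (rule genideal_ideal)
  have JS: "ideal (J <+> Idl S) R" using ideal_J Si by (rule add_ideals)
  have "K \<subseteq> (\<mm> \<cdot> K) <+> (J <+> Idl S)"
    using S(4) ideal_add_assoc[OF B(1) ideal_J Si] by simp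
  then have K_eq: "K \<subseteq> J <+> Idl S" by (rule nakayama[OF ideal_K JS])
  define pp where "pp = power_prod (\<lambda>i. bs ! i) d"
  define M where "M k = pp ` multi_indices d k" for k
  have ppc: "pp \<alpha> \<in> carrier R" for \<alpha> unfolding pp_def by (rule power_prod_closed) (rule bs_nth)
  have Mc: "M k \<subseteq> carrier R" for k using ppc by (auto simp: M_def)
  have J_pow: "ipow J k = Idl (M k)" for k
    unfolding set_bs M_def pp_def by (rule ipow_Idl) (rule bs_nth)
  have J_K: "ipow J k \<subseteq> ipow K k" for k by (rule ipow_mono[OF ideal_J ideal_K J_subset])
  have M_K: "M k \<subseteq> ipow K k" for k using genideal_self[OF Mc] J_pow J_K by blast
  \<comment> \<open>Since \<open>K \<subseteq> J + (S)\<close>, these products together with the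
    monomials of degree \<open>n + 1\<close> generate an ideal containing
    \<open>J^n K\<close>.\<close>
  define G1 where "G1 = (\<lambda>(u, v). u \<otimes> v) ` (M n \<times> S)"
  define G where "G = M (Suc n) \<union> G1"
  define L where "L = ipow J n \<cdot> K"
  have L: "ideal L R" "finite_colength L" "L \<subseteq> ipow K (Suc n)"
  proof -
    show "ideal L R" unfolding L_def using IJ ideal_K by (rule ideal_prod_is_ideal)
    show "finite_colength L" unfolding L_def by (rule finite_colength_prod[OF finite_colength_ipow[OF bs(4)] K(1)])
    have "L \<subseteq> ipow K n \<cdot> K" unfolding L_def by (rule ideal_prod_mono[OF J_K order_refl])
    then show "L \<subseteq> ipow K (Suc n)" using ideal_prod_commute[OF I ideal_K] by (simp add: ipow_Suc ideal_K)
  qed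
  have G1_K: "G1 \<subseteq> ipow K (Suc n)"
  proof -
    have "u \<otimes> v \<in> ipow K n \<cdot> K" if "u \<in> M n" "v \<in> S" for u v
      using M_K S(2) that by (intro ideal_prod.prod) auto
    then show ?thesis
      using ideal_prod_commute[OF I ideal_K] by (auto simp: G1_def ipow_Suc ideal_K)
  qed
  have G_K: "G \<subseteq> ipow K (Suc n)" using G1_K M_K unfolding G_def by blast
  have Gc: "G \<subseteq> carrier R" using G_K ideal_subset[OF I] by blast
  have Gi: "ideal (Idl G) R" using Gc by (rule genideal_ideal)
  have finM: "finite (M k)" "card (M k) \<le> card (multi_indices d k)" for k
    unfolding M_def by (simp_all add: finite_multi_indices card_image_le)
  have finG: "finite G" "card G \<le> card (multi_indices d (Suc n)) + card (multi_indices d n) * r"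
  proof -
    show "finite G" unfolding G_def G1_def using finM S(1) by simp
    have "card G1 \<le> card (M n \<times> S)" unfolding G1_def using finM S(1) by (intro card_image_le) simp
    also have "\<dots> \<le> card (multi_indices d n) * r"
      using finM(2)[of n] S(3) by (simp add: card_cartesian_product mult_le_mono)
    finally show "card G \<le> card (multi_indices d (Suc n)) + card (multi_indices d n) * r"
      using card_Un_le[of "M (Suc n)" G1] finM(2)[of "Suc n"] unfolding G_def by linarith
  qed
  have LG: "L \<subseteq> Idl G"
  proof -
    have "L \<subseteq> ipow J n \<cdot> (J <+> Idl S)" unfolding L_def by (rule ideal_prod_mono[OF order_refl K_eq])
    also have "\<dots> = (ipow J n \<cdot> J) <+> (ipow J n \<cdot> (Idl S))" by (rule ideal_prod_distr(1)[OF IJ ideal_J Si])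
    also have "\<dots> \<subseteq> Idl G"
    proof (rule add_subset[OF Gi])
      have "ipow J n \<cdot> J = ipow J (Suc n)" using ideal_prod_commute[OF IJ ideal_J] by (simp add: ipow_Suc ideal_J)
      also have "\<dots> \<subseteq> Idl G" unfolding J_pow by (rule Idl_mono[OF _ Gc]) (simp add: G_def)
      finally show "ipow J n \<cdot> J \<subseteq> Idl G" .
      show "ipow J n \<cdot> (Idl S) \<subseteq> Idl G"
        unfolding J_pow
      proof (rule prod_Idl_subset[OF Mc Sc Gi])
        fix u v assume "u \<in> M n" "v \<in> S"
        then have "u \<otimes> v \<in> G" by (auto simp: G_def G1_def)
        then show "u \<otimes> v \<in> Idl G" using genideal_self[OF Gc] by blast
      qed
    qed
    finally show ?thesis .
  qed
  let ?B = "\<mm> \<cdot> ipow K (Suc n)"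
  have mB: "ideal ?B R" "?B \<subseteq> ipow K (Suc n)"
    by (rule ideal_prod_is_ideal[OF ideal_mm I], rule ideal_prod_subset2[OF ideal_mm I])
  have GK: "Idl G \<subseteq> ipow K (Suc n)" using Idl_subset_iff[OF Gc I] G_K by blast
  \<comment> \<open>\<open>?D\<close> splits the fiber: the part below it is spanned by
    \<open>G\<close> and annihilated by \<open>\<mm>\<close>, the part above it is a quotient of
    \<open>K^(n+1)/L\<close>.\<close>
  let ?D = "?B <+> Idl G"
  have D: "ideal ?D R" "?B \<subseteq> ?D" "?D \<subseteq> ipow K (Suc n)" "L \<subseteq> ?D"
    using add_ideals[OF mB(1) Gi] subset_addI1[OF mB(1) Gi] add_subset[OF I mB(2) GK]
      subset_addI2[OF mB(1) Gi] LG by auto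
  have "enat (min_gens R (ipow K (Suc n))) = ilen ?B (ipow K (Suc n))" by (rule min_gens_eq[OF I])
  also have "\<dots> = ilen ?B ?D + ilen ?D (ipow K (Suc n))"
    by (rule ilen_additive[OF I D(1) mB(1) D(2,3)])
  also have "\<dots> \<le> enat (card G) + ilen L (ipow K (Suc n))"
  proof (rule add_mono)
    show "ilen ?B ?D \<le> enat (card G)"
      by (rule ilen_generators_mm_le[OF finG(1) Gc mB(1)]) (use G_K in \<open>auto intro: ideal_prod.prod\<close>)
    show "ilen ?D (ipow K (Suc n)) \<le> ilen L (ipow K (Suc n))"
      by (rule ilen_mono[OF I D(1) I L(1) D(4,3) order_refl])
  qed
  also have "ilen L (ipow K (Suc n)) = enat (colength R L - colength R (ipow K (Suc n)))"
    by (rule colength_additive(1)[OF L(2) I L(3)])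
  finally have 1: "min_gens R (ipow K (Suc n)) + colength R (ipow K (Suc n)) \<le> card G + colength R L"
    using colength_additive(2)[OF L(2) I L(3)] by simp
  have L_eq: "L = K \<cdot> ipow J n" unfolding L_def by (rule ideal_prod_commute[OF IJ ideal_K])
  have LJ: "L \<subseteq> ipow J n" unfolding L_def by (rule ideal_prod_subset1[OF IJ ideal_K])
  have "ilen L (ipow J n) \<le> of_nat (card (multi_indices d n)) * ilen K (carrier R)"
    unfolding L_eq set_bs by (rule ilen_prod_ipow_le[OF bs_nth ideal_K])
  then have "enat (colength R L - colength R (ipow J n)) \<le> enat (card (multi_indices d n) * colength R K)"
    using colength_additive(1)[OF L(2) IJ LJ] by (simp add: colength_ilen K(1) of_nat_eq_enat)
  then have 2: "colength R L \<le> card (multi_indices d n) * colength R K + colength R (ipow J n)"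
    using colength_additive(2)[OF L(2) IJ LJ] by simp
  have 3: "colength R (ipow J n) \<le> (\<Sum>k<n. card (multi_indices d k)) * colength R J"
    unfolding set_bs by (rule colength_ipow_le[OF bs_nth]) (use bs(4) set_bs in auto)
  show ?thesis using 1 2 3 finG(2) by (simp add: distrib_left)
qed

end

text \<open>Both sides of \<open>min_gens_colength_le\<close> are eventually polynomial; once
  \<open>\<lambda>(R/J)\<close> is replaced by \<open>e_0\<close>, the terms of degree
  \<open>d\<close> cancel and the coefficients of degree \<open>d - 1\<close> give the
  bound.\<close>

theorem fiber_multiplicity_le:
  assumes K: "finite_colength K" "K \<subseteq> \<mm>"
  shows "fiber_multiplicity R d K
    \<le> of_int (hilbert_coeff R d K 1) - of_int (hilbert_coeff R d K 0)
      + of_nat (colength R K) + of_nat (min_gens R K) - of_nat d + 1"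
proof -
  obtain bs n0 where bs: "length bs = d" "reg_seq {\<zero>} bs" "set bs \<subseteq> K" "finite_colength (Idl (set bs))"
    "ipow K (Suc n0) \<subseteq> (Idl (set bs)) \<cdot> ipow K n0"
    by (rule exists_minimal_reduction[OF K])
  note ctx = K bs
  have Ki: "ideal K R" using K(1) by (rule finite_colength_ideal)
  obtain d' where d: "d = Suc d'" using d_pos by (cases d) auto
  define P where "P = hilbert_poly R K"
  define lenJ where "lenJ = colength R (Idl (set bs))"
  define lenK where "lenK = colength R K"
  have degP: "Polynomial.degree P \<le> d" unfolding P_def by (rule degree_hilbert_poly_le[OF K(1)])
  obtain c where c: "P = (\<Sum>j\<le>d. Polynomial.smult (c j) (binom_poly j))"
    using binom_poly_basis[OF degP] by blast
  have evP: "\<forall>\<^sub>F n in sequentially. of_nat (colength R (ipow K n)) = poly P (of_nat n)"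
    unfolding P_def by (rule eventually_hilbert_poly[OF K(1)])
  then obtain N1 where N1: "\<And>n. n \<ge> N1 \<Longrightarrow> of_nat (colength R (ipow K n)) = poly P (of_nat n)"
    unfolding eventually_sequentially by blast
  \<comment> \<open>Hilbert coefficients have type \<open>int\<close>, so \<open>c\<close> can
    represent them only after integrality is known.\<close>
  have c_int: "c j \<in> \<int>" if "j \<le> d" for j
  proof (rule binom_poly_coeffs_Ints[OF _ that])
    fix n assume "n \<ge> N1"
    then have "of_nat (colength R (ipow K n)) = (\<Sum>j\<le>d. c j * poly (binom_poly j) (of_nat n))"
      using N1[of n] unfolding c by (simp add: poly_sum del: binom_poly.simps)
    then show "(\<Sum>j\<le>d. c j * poly (binom_poly j) (of_nat n)) \<in> \<int>" by (metis Ints_of_nat)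
  qed
  define z where "z j = \<lfloor>c j\<rfloor>" for j
  have cz: "c j = of_int (z j)" if "j \<le> d" for j
    using c_int[OF that] by (auto simp: z_def elim: Ints_cases)
  have P_z: "hilbert_poly R K = (\<Sum>j\<le>d. Polynomial.smult (of_int (z j)) (binom_poly j))"
    using c cz unfolding P_def by simp
  have e0: "of_int (hilbert_coeff R d K 0) = c d" and e1: "of_int (hilbert_coeff R d K 1) = - c d'"
    using hilbert_coeff_eqI[OF P_z, of 0] hilbert_coeff_eqI[OF P_z, of 1] cz by (auto simp: d)
  have e0_ge: "of_nat lenJ \<le> c d"
  proof -
    let ?p = "pcompose P [:of_nat n0, 1:] - Polynomial.smult (of_nat lenJ) (binom_poly d)"
    have "Polynomial.coeff ?p d \<ge> 0"
    proof (rule coeff_nonneg_of_eventually_nonneg)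
      show "Polynomial.degree ?p \<le> d"
        using degP by (intro degree_diff_le order_trans[OF degree_smult_le])
          (simp_all add: degree_pcompose_shift degree_binom_poly)
      show "\<forall>\<^sub>F n in sequentially. poly ?p (of_nat n) \<ge> 0"
        using eventually_ge_at_top[of "max N1 1"]
      proof (rule eventually_mono)
        fix n assume n: "max N1 1 \<le> n"
        have "(of_nat ((\<Sum>k<n. card (multi_indices d k)) * lenJ) :: rat) \<le> of_nat (colength R (ipow K (n0 + n)))"
          unfolding of_nat_le_iff lenJ_def by (rule colength_J_le[OF ctx])
        also have "\<dots> = poly P (of_nat (n0 + n))" using N1[of "n0 + n"] n by simp
        finally show "poly ?p (of_nat n) \<ge> 0"
          using sum_card_multi_indices[of n d] n by (simp add: poly_pcompose mult.commute)
      qed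
    qed
    moreover have "Polynomial.coeff P d = c d / fact d" unfolding c by (rule coeff_sum_binom_poly)
    ultimately have "of_nat lenJ * (1 / fact d) \<le> c d / fact d"
      using coeff_pcompose_shift[OF degP, of "of_nat n0"] by (simp add: coeff_binom_poly del: binom_poly.simps)
    then show ?thesis by (simp add: divide_le_cancel)
  qed
  have "d \<le> min_gens R K"
  proof -
    have mK: "ideal (\<mm> \<cdot> K) R" "\<mm> \<cdot> K \<subseteq> K"
      by (rule ideal_prod_is_ideal[OF ideal_mm Ki], rule ideal_prod_subset2[OF ideal_mm Ki])
    have Ji: "ideal (Idl (set bs)) R" by (rule ideal_J[OF ctx])
    have "ilen (\<mm> \<cdot> K) ((\<mm> \<cdot> K) <+> Idl (set bs)) \<le> ilen (\<mm> \<cdot> K) K"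
      by (rule ilen_mono[OF add_ideals[OF mK(1) Ji] mK(1) Ki mK(1) order_refl subset_addI1[OF mK(1) Ji]
            add_subset[OF Ki mK(2) J_subset[OF ctx]]])
    then show ?thesis using ilen_mm_prod_add_J[OF ctx] min_gens_eq[OF Ki] by (metis enat_ord_simps(1))
  qed
  then obtain r where r: "min_gens R K = d + r" using le_Suc_ex by blast
  obtain p where p: "\<forall>\<^sub>F n in sequentially. of_nat (min_gens R (ipow K n)) = poly p (of_nat n :: rat)"
    using eventually_poly_min_gens[OF Ki] unfolding eventually_poly_def by blast
  then obtain N2 where N2: "\<And>n. n \<ge> N2 \<Longrightarrow> of_nat (min_gens R (ipow K n)) = poly p (of_nat n :: rat)"
    unfolding eventually_sequentially by blast
  \<comment> \<open>The upper bound for \<open>\<mu>(K^m)\<close> with \<open>m = n + 1\<close>,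
    after the terms \<open>c d * binom_poly d\<close> have cancelled. The term \<open>- c d\<close>
    is due to the shift from \<open>n\<close> to \<open>m\<close>; the shifted
    \<open>binom_poly d'\<close> counts the monomials of degree \<open>n + 1\<close>.\<close>
  define q where "q = Polynomial.smult (of_nat (lenK + r) - c d) (binom_poly d')
    + pcompose (binom_poly d') [:1, 1:] - (\<Sum>j\<le>d'. Polynomial.smult (c j) (binom_poly j))"
  have deg_q: "Polynomial.degree q \<le> d'"
    unfolding q_def using degree_sum_binom_poly_le[of c d']
    by (intro degree_diff_le degree_add_le order_trans[OF degree_smult_le])
       (simp_all add: degree_pcompose_shift degree_binom_poly)
  have coeff_q: "Polynomial.coeff q d' = (of_nat (lenK + r) - c d + 1 - c d') / fact d'"
    unfolding q_def coeff_diff coeff_add coeff_smult coeff_sum_binom_poly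
    by (simp add: coeff_pcompose_shift degree_binom_poly coeff_binom_poly diff_divide_distrib
        add_divide_distrib del: binom_poly.simps)
  have le_q: "poly p (of_nat m) \<le> poly q (of_nat m)" if m: "m \<ge> N1 + N2 + 2" for m
  proof -
    obtain n where n: "m = Suc n" "n \<ge> 1" using m by (cases m) auto
    have "of_nat (min_gens R (ipow K m) + colength R (ipow K m)) \<le>
      (of_nat ((\<Sum>k<n. card (multi_indices d k)) * lenJ + card (multi_indices d n) * (lenK + r)
      + card (multi_indices d (Suc n))) :: rat)"
      unfolding of_nat_le_iff lenJ_def lenK_def n(1) by (rule min_gens_colength_le[OF ctx r])
    then have "poly p (of_nat m) + poly P (of_nat m)
        \<le> of_nat (\<Sum>k<n. card (multi_indices d k)) * of_nat lenJ
          + of_nat (card (multi_indices d n)) * of_nat (lenK + r) + of_nat (card (multi_indices d (Suc n)))"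
      using N1[of m] N2[of m] m by (simp del: of_nat_sum)
    \<comment> \<open>The factor in front counts monomials and is nonnegative, so the inequality
      \<open>e0_ge\<close> is enough.\<close>
    also have "\<dots> \<le> of_nat (\<Sum>k<n. card (multi_indices d k)) * c d
          + of_nat (card (multi_indices d n)) * of_nat (lenK + r) + of_nat (card (multi_indices d (Suc n)))"
      by (intro add_right_mono mult_left_mono e0_ge of_nat_0_le_iff)
    also have "of_nat (\<Sum>k<n. card (multi_indices d k))
        = poly (binom_poly d) (of_nat m) - poly (binom_poly d') (of_nat m)"
      using sum_card_multi_indices[OF n(2), of d] poly_binom_poly_diff[of d' "of_nat m"]
      by (simp add: n(1) d del: binom_poly.simps of_nat_sum)
    also have "of_nat (card (multi_indices d n)) = poly (binom_poly d') (of_nat m)"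
      unfolding d n(1) of_nat_card_multi_indices by (simp add: add.commute del: binom_poly.simps)
    also have "of_nat (card (multi_indices d (Suc n))) = poly (binom_poly d') (of_nat m + 1)"
      unfolding d n(1) of_nat_card_multi_indices by simp
    finally have *: "poly p (of_nat m) + poly P (of_nat m)
        \<le> (poly (binom_poly d) (of_nat m) - poly (binom_poly d') (of_nat m)) * c d
          + poly (binom_poly d') (of_nat m) * of_nat (lenK + r) + poly (binom_poly d') (of_nat m + 1)" .
    have Pm: "poly P (of_nat m) = (\<Sum>j\<le>d'. c j * poly (binom_poly j) (of_nat m)) + c d * poly (binom_poly d) (of_nat m)"
      unfolding c d by (simp add: poly_sum del: binom_poly.simps)
    have "poly q (of_nat m) = (of_nat (lenK + r) - c d) * poly (binom_poly d') (of_nat m)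
        + poly (binom_poly d') (of_nat m + 1) - (\<Sum>j\<le>d'. c j * poly (binom_poly j) (of_nat m))"
      unfolding q_def by (simp add: poly_pcompose poly_sum add.commute del: binom_poly.simps)
    then show ?thesis using * unfolding Pm by (simp add: algebra_simps del: binom_poly.simps)
  qed
  \<comment> \<open>The degree bound must come first: coefficients at \<open>d'\<close> can be
    compared only if no higher terms are present.\<close>
  have "Polynomial.degree p \<le> d'"
  proof (rule degree_le_of_eventually_le[OF _ _ deg_q])
    show "\<forall>\<^sub>F n in sequentially. poly p (of_nat n) \<ge> 0"
      using p by (rule eventually_mono) (metis of_nat_0_le_iff)
    show "\<forall>\<^sub>F n in sequentially. poly p (of_nat n) \<le> poly q (of_nat n)"
      using le_q unfolding eventually_sequentially by blast
  qed
  then have "Polynomial.coeff (q - p) d' \<ge> 0"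
  proof (intro coeff_nonneg_of_eventually_nonneg degree_diff_le deg_q)
    show "\<forall>\<^sub>F n in sequentially. poly (q - p) (of_nat n) \<ge> 0"
      using le_q unfolding eventually_sequentially by auto
  qed
  then have "fact d' * Polynomial.coeff p d' \<le> of_nat (lenK + r) - c d + 1 - c d'"
    unfolding coeff_diff coeff_q by (simp add: field_simps)
  moreover have "fiber_multiplicity R d K = fact d' * Polynomial.coeff p d'"
    using eventual_poly_eqI[OF p] by (simp add: fiber_multiplicity_ipow d)
  ultimately show ?thesis unfolding e0 e1 r by (simp add: lenK_def)
qed

text \<open>The fiber multiplicity and the Hilbert coefficients depend only on large powers, which
  \<open>I\<close> shares with its closure; so the bound for the closure is one for
  \<open>I\<close>.\<close>

theorem fiber_multiplicity_ratliff_rush_le: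
  assumes I: "finite_colength I" "I \<subseteq> \<mm>"
  shows "fiber_multiplicity R d I
    \<le> of_int (hilbert_coeff R d I 1) - of_int (hilbert_coeff R d I 0)
      + of_nat (colength R (ratliff_rush R I)) + of_nat (min_gens R (ratliff_rush R I)) - of_nat d + 1"
proof -
  let ?K = "ratliff_rush R I"
  note K = ratliff_rush_greatest[OF I(1)]
  have Ii: "ideal I R" using I(1) by (rule finite_colength_ideal)
  have Kf: "finite_colength ?K" using I(1) K(1,2) by (rule finite_colength_mono)
  have ev: "\<forall>\<^sub>F n in sequentially. ipow ?K n = ipow I n"
    using hilbert_poly_eq_iff[OF I(1) K(1,2)] K(3) by blast
  then obtain N where N: "\<And>n. n \<ge> N \<Longrightarrow> ipow ?K n = ipow I n"
    unfolding eventually_sequentially by blast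
  \<comment> \<open>Otherwise a positive power of \<open>I\<close> would be all of \<open>R\<close>,
    although it lies in \<open>\<mm>\<close>.\<close>
  have "?K \<noteq> carrier R"
  proof
    assume K_eq: "?K = carrier R"
    have "ipow (carrier R) n = carrier R" for n
      by (induction n) (simp_all add: ipow_Suc oneideal one_prod)
    then have "carrier R = ipow I (Suc N)" using N[of "Suc N"] unfolding K_eq by simp
    also have "\<dots> \<subseteq> I" using ideal_prod_subset1[OF Ii ideal_ipow[OF Ii]] by (simp add: ipow_Suc Ii)
    finally show False using I(2) one_notin_mm by blast
  qed
  then have Km: "?K \<subseteq> \<mm>" by (rule proper_subset_mm[OF K(1)])
  have "fiber_multiplicity R d I = fiber_multiplicity R d ?K"
    unfolding fiber_multiplicity_ipow
    by (intro arg_cong[where f = "\<lambda>p. fact (d - 1) * Polynomial.coeff p (d - 1)"] eventual_poly_cong)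
       (use ev in \<open>auto elim: eventually_mono\<close>)
  moreover have "hilbert_coeff R d I = hilbert_coeff R d ?K"
    unfolding hilbert_coeff_def K(3) ..
  ultimately show ?thesis using fiber_multiplicity_le[OF Kf Km] by simp
qed

end

theorem corollary4p2:
  fixes R :: "('a, 'b) ring_scheme" and \<mm> I :: "'a set" and d :: nat
  assumes "cohen_macaulay_local_ring R \<mm>"
    and "krull_dim R = enat d" and "d > 0"
    and "infinite (carrier (R Quot \<mm>))"
    and "primary_to \<mm> I R"
  shows "fiber_multiplicity R d I
           \<le> of_int (hilbert_coeff R d I 1) - of_int (hilbert_coeff R d I 0)
             + of_nat (colength R (ratliff_rush R I)) + of_nat (min_gens R (ratliff_rush R I))
             - of_nat d + 1"
proof -
  interpret cohen_macaulay_local_ring R \<mm> by fact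
  interpret cm_local_ring R \<mm> d
    using assms(2-4) depth_eq_dim by unfold_locales auto
  show ?thesis
    using finite_colength_of_primary[OF assms(5)] by (rule fiber_multiplicity_ratliff_rush_le)
qed

end
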